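(* Let $\mathcal F=\{a_1,\dots,a_s\}$ be a finite reduced collection of forbidden words over a symbol set $\Sigma$ of size $q\ge2$ with $\Sigma_{\mathcal F}$ irreducible, let $\mathcal R=\{r_1(m_1),\dots,r_\ell(m_\ell)\}$ be a reduced collection of repeated words, let $p\ge2$ be the length of the longest word in $\mathcal F\cup\mathcal R$, and suppose all words in $\mathcal R$ have length $p$. Let $A$ be the adjacency matrix associated with $\mathcal F$ and $\mathcal R$, $\theta$ its Perron root, assume $\theta>1$, and assume that the edge shift $\Sigma_A$ satisfies property (P). If $W=(X_1*X_2)_{i_1}\dots(X_n*X_{n+1})_{i_n}$ is an allowed word in $\Sigma_A$, then the Parry measure of the cylinder $C_W$ based at $W$ is $$\mu(C_W)=\frac{U_{X_1}V_{X_{n+1}}}{\theta^{\,n+p-1}\bigl(1+R'(\theta)\bigr)},$$ where $$U_X=1-\theta\sum_{i=1}^{\ell}\Bigl(1-\frac1{m_i}\Bigr)R_i(\theta)(\tilde r_i,X)_\theta+\theta\sum_{j=1}^{s}R_{\ell+j}(\theta)(\tilde a_j,X)_\theta,$$ $$V_X=1-\theta\sum_{i=1}^{\ell}\Bigl(1-\frac1{m_i}\Bigr)S_i(\theta)(X,r_i)_\theta+\theta\sum_{j=1}^{s}S_{\ell+j}(\theta)(X,a_j)_\theta$$ for $X\in\mathcal L_{p-1}$, and $R'(\theta)$ is the derivative at $z=\theta$ of $R(z)=z\sum_{i=1}^{\ell}(1-\frac1{m_i})R_i(z)-z\sum_{j=1}^{s}R_{\ell+j}(z)$.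
   Context: $\Sigma$ is a finite set of $q$ symbols; a word is a finite sequence over $\Sigma$ and $|w|$ is its length. A collection of words is reduced if for any two distinct words in it neither is a (contiguous) subword of the other. $\mathcal F$ is a finite reduced collection of words of length at least $2$; $\Sigma_{\mathcal F}\subseteq\Sigma^{\mathbb N}$ is the set of one-sided sequences containing no word of $\mathcal F$. A word is allowed if it is a subword of some sequence in $\Sigma_{\mathcal F}$; $\mathcal L_n$ is the set of allowed words of length $n$. All symbols are assumed allowed. $\Sigma_{\mathcal F}$ is irreducible: for all allowed $u,v$ there is a word $w$ with $uwv$ allowed. $\mathcal R$ is a finite reduced collection of allowed words $r_1,\dots,r_\ell$, each $r_i$ assigned an integer multiplicity $m_i\ge2$. For an allowed word $w$, $m(w)=\prod_{i}m_i^{n(w;r_i)}$, where $n(w;r_i)$ is the number of occurrences of $r_i$ as a subword of $w$. For $X=x_1\dots x_{p-1}$, $Y=y_1\dots y_{p-1}$ in $\mathcal L_{p-1}$, $X*Y$ is defined only if $x_2\dots x_{p-1}=y_1\dots y_{p-2}$ (no condition if $p=2$), and then $X*Y=x_1\dots x_{p-1}y_{p-1}$. Since all words of $\mathcal R$ have length $p$, the adjacency matrix $A$ associated with $\mathcal F$ and $\mathcal R$ is indexed by $\mathcal L_{p-1}$, with $A_{XY}=m(X*Y)$ if $X*Y$ is defined and lies in $\mathcal L_p$, and $A_{XY}=0$ otherwise. $\mathcal G_A$ is the directed multigraph with vertex set $\mathcal L_{p-1}$ and edges $(X*Y)_1,\dots,(X*Y)_{A_{XY}}$ from $X$ to $Y$;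 $\Sigma_A$ is the set of one-sided infinite paths of edges in $\mathcal G_A$. To a word $W=(X_1*X_2)_{i_1}\dots(X_{n-p+1}*X_{n-p+2})_{i_{n-p+1}}$ of $\Sigma_A$ is associated the unique $w=x_1\dots x_n\in\mathcal L_n$ with $X_i=x_i\dots x_{i+p-2}$. The cylinder $C_W$ is the set of sequences in $\Sigma_A$ beginning with $W$. The (Shannon–)Parry measure $\mu$ on $\Sigma_A$ is the probability measure with $\mu(C_W)=\bar U_{X_1}\bar V_{X_{n+1}}/\theta^n$ for every allowed word $W=(X_1*X_2)_{i_1}\dots(X_n*X_{n+1})_{i_n}$, where $\bar U,\bar V$ are left and right Perron eigenvectors of $A$ normalized by $\bar U^T\bar V=1$. Property (P): there exist $X,Y\in\mathcal L_{p-1}$, a point $\alpha=\alpha_1\alpha_2\dots\in\Sigma_A$ and a strictly increasing sequence $(n_k)_{k\ge1}$ of natural numbers such that for each $k$, $W_{n_k-p+1}=\alpha_1\dots\alpha_{n_k-p+1}$ is a path from vertex $X$ to vertex $Y$ and $m(w_{n_k})=1$, where $w_{n_k}\in\mathcal L_{n_k}$ is the word associated to $W_{n_k-p+1}$. Correlation: for words $u,v$, $(u,v)=(c_1,\dots,c_{|u|})$ where $c_i=1$ if, placing $v$ below $u$ so that the leftmost symbol of $v$ lies under the $i$-th symbol of $u$, the overlapping segments are identical, and $c_i=0$ otherwise; $(u,v)_z=\sum_{i=1}^{|u|}c_iz^{|u|-i}$, and $(u,v)_\theta$ is its value at $z=\theta$. $\tilde w$ denotes $w$ with its first symbol removed.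 $P(z)$ is the $(\ell+s)\times(\ell+s)$ matrix $$P(z)_{ij}=\begin{cases}z(1-\frac1{m_j})(r_j,r_i)_z-\delta_{ij}z^{|r_j|}, & 1\le i,j\le\ell,\\ -z(a_{j-\ell},r_i)_z, & i\le\ell<j,\\ z(1-\frac1{m_j})(r_j,a_{i-\ell})_z, & j\le\ell<i,\\ -z(a_{j-\ell},a_{i-\ell})_z, & i,j>\ell,\end{cases}$$ which is invertible over the rational functions. $D(z)$ is diagonal with $D_{ii}(z)=z(1-\frac1{m_i})$ for $1\le i\le\ell$ and $D_{ii}(z)=-z$ for $\ell<i\le\ell+s$; $Q=D^{-1}P^TD$. $R_i(z)$ and $S_i(z)$ are the $i$-th row sums of $P^{-1}(z)$ and $Q^{-1}(z)$, viewed as rational functions; their values at $\theta$ exist. *)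

theory Defs
  imports
    "HOL-Probability.Probability_Measure"
    "HOL-Library.Sublist"
    "HOL-Computational_Algebra.Fraction_Field"
    "Jordan_Normal_Form.Gauss_Jordan_Elimination"
    "Jordan_Normal_Form.Spectral_Radius"
begin

section \<open>Words and subshifts\<close>

text \<open>One-sided sequences are functions on \<^typ>\<open>nat\<close>; positions are counted from 0.\<close>

definition segment :: "(nat \<Rightarrow> 'b) \<Rightarrow> nat \<Rightarrow> nat \<Rightarrow> 'b list" where
  "segment x i n = map x [i..<i + n]"

definition language :: "(nat \<Rightarrow> 'b) set \<Rightarrow> 'b list set" where
  "language S = {segment x i n | x i n. x \<in> S}"

definition cylinder :: "(nat \<Rightarrow> 'b) set \<Rightarrow> 'b list \<Rightarrow> (nat \<Rightarrow> 'b) set" where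
  "cylinder S W = {x \<in> S. segment x 0 (length W) = W}"

definition reduced_words :: "'a list set \<Rightarrow> bool" where
  "reduced_words C \<longleftrightarrow> (\<forall>u\<in>C. \<forall>v\<in>C. u \<noteq> v \<longrightarrow> \<not> sublist u v)"

definition subshift :: "'a list set \<Rightarrow> (nat \<Rightarrow> 'a) set" where
  "subshift F = {x. \<forall>w\<in>F. \<forall>i. segment x i (length w) \<noteq> w}"

definition allowed :: "'a list set \<Rightarrow> 'a list \<Rightarrow> bool" where
  "allowed F w \<longleftrightarrow> w \<in> language (subshift F)"

definition allowed_words :: "'a list set \<Rightarrow> nat \<Rightarrow> 'a list set" where
  "allowed_words F n = {w. allowed F w \<and> length w = n}"

definition irreducible_subshift :: "'a list set \<Rightarrow> bool" where
  "irreducible_subshift F \<longleftrightarrow>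
     (\<forall>u v. allowed F u \<longrightarrow> allowed F v \<longrightarrow> (\<exists>w. allowed F (u @ w @ v)))"

section \<open>Multiplicities, adjacency matrix and edge shift\<close>

text \<open>
  A collection of repeated words is a list of pairs of a word and its multiplicity.
\<close>

definition occurrences :: "'a list \<Rightarrow> 'a list \<Rightarrow> nat" where
  "occurrences w r = card {i. i + length r \<le> length w \<and> take (length r) (drop i w) = r}"

definition multiplicity_of :: "('a list \<times> nat) list \<Rightarrow> 'a list \<Rightarrow> nat" where
  "multiplicity_of R w = (\<Prod>i<length R. snd (R ! i) ^ occurrences w (fst (R ! i)))"

definition star_defined :: "'a list \<Rightarrow> 'a list \<Rightarrow> bool" where
  "star_defined X Y \<longleftrightarrow> tl X = butlast Y"

definition star :: "'a list \<Rightarrow> 'a list \<Rightarrow> 'a list" where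
  "star X Y = X @ [last Y]"

definition adjacency ::
  "'a list set \<Rightarrow> ('a list \<times> nat) list \<Rightarrow> nat \<Rightarrow> 'a list \<Rightarrow> 'a list \<Rightarrow> nat" where
  "adjacency F R p X Y =
     (if star_defined X Y \<and> star X Y \<in> allowed_words F p
      then multiplicity_of R (star X Y) else 0)"

text \<open>
  The triple \<open>(X, Y, i)\<close> encodes the edge \<open>(X * Y)\<^sub>i\<close> from \<open>X\<close> to \<open>Y\<close>.
\<close>

type_synonym 'a edge = "'a list \<times> 'a list \<times> nat"

definition source :: "'a edge \<Rightarrow> 'a list" where
  "source e = fst e"

definition target :: "'a edge \<Rightarrow> 'a list" where
  "target e = fst (snd e)"

definition edges :: "'a list set \<Rightarrow> ('a list \<times> nat) list \<Rightarrow> nat \<Rightarrow> 'a edge set" where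
  "edges F R p =
     {(X, Y, i). X \<in> allowed_words F (p - 1) \<and> Y \<in> allowed_words F (p - 1) \<and>
        1 \<le> i \<and> i \<le> adjacency F R p X Y}"

definition edge_shift ::
  "'a list set \<Rightarrow> ('a list \<times> nat) list \<Rightarrow> nat \<Rightarrow> (nat \<Rightarrow> 'a edge) set" where
  "edge_shift F R p =
     {\<alpha>. \<forall>k. \<alpha> k \<in> edges F R p \<and> target (\<alpha> k) = source (\<alpha> (Suc k))}"

definition associated_word :: "'a list set \<Rightarrow> nat \<Rightarrow> 'a edge list \<Rightarrow> 'a list" where
  "associated_word F p W =
     (THE w. w \<in> allowed_words F (length W + p - 1) \<and>
        (\<forall>i<length W. take (p - 1) (drop i w) = source (W ! i) \<and>
                       take (p - 1) (drop (Suc i) w) = target (W ! i)))"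

text \<open>
  The requirement \<open>p \<le> n k\<close> says that each initial path has at least one edge.
\<close>

definition property_P :: "'a list set \<Rightarrow> ('a list \<times> nat) list \<Rightarrow> nat \<Rightarrow> bool" where
  "property_P F R p \<longleftrightarrow>
     (\<exists>X \<in> allowed_words F (p - 1). \<exists>Y \<in> allowed_words F (p - 1).
      \<exists>\<alpha> \<in> edge_shift F R p. \<exists>n :: nat \<Rightarrow> nat. strict_mono n \<and>
        (\<forall>k. p \<le> n k \<and>
          (let W = segment \<alpha> 0 (n k - p + 1) in
             source (hd W) = X \<and> target (last W) = Y \<and>
             multiplicity_of R (associated_word F p W) = 1)))"

section \<open>Perron root, Perron eigenvectors and Parry measure\<close>

text \<open>
  Matrices indexed by a finite set \<open>I\<close> of words are functions of two indices. The spectral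
  radius does not depend on the enumeration \<^term>\<open>from_nat_into I\<close> of \<open>I\<close>.
\<close>

definition perron_root :: "'i set \<Rightarrow> ('i \<Rightarrow> 'i \<Rightarrow> nat) \<Rightarrow> real" where
  "perron_root I A =
     spectral_radius (Matrix.mat (card I) (card I)
       (\<lambda>(i, j). of_nat (A (from_nat_into I i) (from_nat_into I j)) :: complex))"

definition left_perron_vector :: "'i set \<Rightarrow> ('i \<Rightarrow> 'i \<Rightarrow> nat) \<Rightarrow> ('i \<Rightarrow> real) \<Rightarrow> bool" where
  "left_perron_vector I A U \<longleftrightarrow>
     (\<forall>X\<in>I. U X > 0) \<and> (\<forall>Y\<in>I. (\<Sum>X\<in>I. U X * real (A X Y)) = perron_root I A * U Y)"

definition right_perron_vector :: "'i set \<Rightarrow> ('i \<Rightarrow> 'i \<Rightarrow> nat) \<Rightarrow> ('i \<Rightarrow> real) \<Rightarrow> bool" where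
  "right_perron_vector I A V \<longleftrightarrow>
     (\<forall>X\<in>I. V X > 0) \<and> (\<forall>X\<in>I. (\<Sum>Y\<in>I. real (A X Y) * V Y) = perron_root I A * V X)"

text \<open>
  Left and right Perron eigenvectors are unique up to scaling because the adjacency matrix is
  irreducible, so the cylinder weights do not depend on the choice of \<open>U\<close> and \<open>V\<close>.
\<close>

definition parry_measure ::
  "'a list set \<Rightarrow> ('a list \<times> nat) list \<Rightarrow> nat \<Rightarrow> (nat \<Rightarrow> 'a edge) measure \<Rightarrow> bool" where
  "parry_measure F R p \<mu> \<longleftrightarrow>
     (let I = allowed_words F (p - 1); A = adjacency F R p;
          \<theta> = perron_root I A; S = edge_shift F R p
      in prob_space \<mu> \<and> space \<mu> = S \<and> sets \<mu> = sigma_sets S (cylinder S ` language S) \<and>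
         (\<exists>U V. left_perron_vector I A U \<and> right_perron_vector I A V \<and>
            (\<Sum>X\<in>I. U X * V X) = 1 \<and>
            (\<forall>W \<in> language S. W \<noteq> [] \<longrightarrow>
               measure \<mu> (cylinder S W) =
                 U (source (hd W)) * V (target (last W)) / \<theta> ^ length W)))"

section \<open>Correlations\<close>

text \<open>The entry at position \<open>k\<close> is the bit \<open>c\<^sub>i\<close> with \<open>i = k + 1\<close>.\<close>

definition correlation :: "'a list \<Rightarrow> 'a list \<Rightarrow> nat list" where
  "correlation u v =
     map (\<lambda>k. let n = min (length u - k) (length v)
               in if take n (drop k u) = take n v then 1 else 0) [0..<length u]"

definition correlation_poly :: "'a list \<Rightarrow> 'a list \<Rightarrow> real poly" where
  "correlation_poly u v =
     (\<Sum>k<length u. monom (real (correlation u v ! k)) (length u - 1 - k))"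

section \<open>The matrices of rational functions\<close>

type_synonym ratfun = "real poly fract"

definition ratfun_of_poly :: "real poly \<Rightarrow> ratfun" where
  "ratfun_of_poly f = Fraction_Field.Fract f 1"

text \<open>
  The value is that of any representative whose denominator does not vanish at \<open>x\<close>; it is
  unspecified when \<open>x\<close> is a pole.
\<close>

definition ratfun_eval :: "ratfun \<Rightarrow> real \<Rightarrow> real" where
  "ratfun_eval f x =
     (THE y. \<exists>a b. f = Fraction_Field.Fract a b \<and> poly b x \<noteq> 0 \<and> y = poly a x / poly b x)"

definition inverse_matrix :: "ratfun mat \<Rightarrow> ratfun mat" where
  "inverse_matrix M = the (mat_inverse M)"

definition row_sum :: "ratfun mat \<Rightarrow> nat \<Rightarrow> ratfun" where
  "row_sum M i = (\<Sum>j<dim_col M. M $$ (i, j))"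

abbreviation mult_coeff :: "('a list \<times> nat) list \<Rightarrow> nat \<Rightarrow> real" where
  "mult_coeff R i \<equiv> 1 - 1 / real (snd (R ! i))"

text \<open>
  Here \<open>[:0, c:]\<close> is the polynomial \<open>c z\<close>. Repeated words come before forbidden words.
\<close>

definition P_entry ::
  "'a list list \<Rightarrow> ('a list \<times> nat) list \<Rightarrow> nat \<Rightarrow> nat \<Rightarrow> real poly" where
  "P_entry Fs R i j =
     (let l = length R; r = (\<lambda>i. fst (R ! i)); a = (\<lambda>i. Fs ! (i - l)) in
      if i < l \<and> j < l then
        [:0, mult_coeff R j:] * correlation_poly (r j) (r i)
          - (if i = j then monom 1 (length (r j)) else 0)
      else if i < l then
        - [:0, 1:] * correlation_poly (a j) (r i)
      else if j < l then
        [:0, mult_coeff R j:] * correlation_poly (r j) (a i)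
      else
        - [:0, 1:] * correlation_poly (a j) (a i))"

definition P_matrix :: "'a list list \<Rightarrow> ('a list \<times> nat) list \<Rightarrow> ratfun mat" where
  "P_matrix Fs R =
     Matrix.mat (length R + length Fs) (length R + length Fs)
       (\<lambda>(i, j). ratfun_of_poly (P_entry Fs R i j))"

definition D_matrix :: "'a list list \<Rightarrow> ('a list \<times> nat) list \<Rightarrow> ratfun mat" where
  "D_matrix Fs R =
     mat_diag (length R + length Fs)
       (\<lambda>i. ratfun_of_poly (if i < length R then [:0, mult_coeff R i:] else - [:0, 1:]))"

definition Q_matrix :: "'a list list \<Rightarrow> ('a list \<times> nat) list \<Rightarrow> ratfun mat" where
  "Q_matrix Fs R =
     inverse_matrix (D_matrix Fs R) * transpose_mat (P_matrix Fs R) * D_matrix Fs R"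

text \<open>
  Row indices start at 0: \<open>R_sum Fs R i z\<close> is \<open>R\<^sub>i\<^sub>+\<^sub>1(z)\<close>, and likewise for \<open>S_sum\<close>.
\<close>

definition R_sum :: "'a list list \<Rightarrow> ('a list \<times> nat) list \<Rightarrow> nat \<Rightarrow> real \<Rightarrow> real" where
  "R_sum Fs R i = ratfun_eval (row_sum (inverse_matrix (P_matrix Fs R)) i)"

definition S_sum :: "'a list list \<Rightarrow> ('a list \<times> nat) list \<Rightarrow> nat \<Rightarrow> real \<Rightarrow> real" where
  "S_sum Fs R i = ratfun_eval (row_sum (inverse_matrix (Q_matrix Fs R)) i)"

definition R_total :: "'a list list \<Rightarrow> ('a list \<times> nat) list \<Rightarrow> real \<Rightarrow> real" where
  "R_total Fs R z =
     z * (\<Sum>i<length R. mult_coeff R i * R_sum Fs R i z)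
     - z * (\<Sum>j<length Fs. R_sum Fs R (length R + j) z)"

definition U_vec :: "'a list list \<Rightarrow> ('a list \<times> nat) list \<Rightarrow> real \<Rightarrow> 'a list \<Rightarrow> real" where
  "U_vec Fs R \<theta> X =
     1 - \<theta> * (\<Sum>i<length R. mult_coeff R i * R_sum Fs R i \<theta>
               * poly (correlation_poly (tl (fst (R ! i))) X) \<theta>)
       + \<theta> * (\<Sum>j<length Fs. R_sum Fs R (length R + j) \<theta>
               * poly (correlation_poly (tl (Fs ! j)) X) \<theta>)"

definition V_vec :: "'a list list \<Rightarrow> ('a list \<times> nat) list \<Rightarrow> real \<Rightarrow> 'a list \<Rightarrow> real" where
  "V_vec Fs R \<theta> X =
     1 - \<theta> * (\<Sum>i<length R. mult_coeff R i * S_sum Fs R i \<theta>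
               * poly (correlation_poly X (fst (R ! i))) \<theta>)
       + \<theta> * (\<Sum>j<length Fs. S_sum Fs R (length R + j) \<theta>
               * poly (correlation_poly X (Fs ! j)) \<theta>)"

end

(*
A finite word avoiding the forbidden words is weighted by the product of its multiplicities. Appending
a word v letter by letter to an arbitrary word changes the weight only when a pattern is completed;
when v contains no pattern, this happens through a proper overlap of a pattern with v. For the
generating function F(z) of all words and those of the words ending in a pattern this gives a linear
system with matrix P(z), whence -F R_i is the generating function of the words ending in the i-th
pattern, F (z - q + R) = z, and F(z) U_X(z) is, up to a power of z, the generating function of the
words ending in X. Reversing all words turns P into Q and gives the same for V_X and the words
beginning with X.

The words ending (beginning) with X satisfy the linear recurrence given by A (its transpose) up to
finitely many terms, so their residues at theta form a left (right) Perron eigenvector. Limits are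
taken along one sequence decreasing to theta on which the finitely many bounded quantities
(z - theta) E_X(z) converge; boundedness of R_i along it excludes a pole at theta. Comparing residues
identifies the normalizing constants and 1 + R'(theta) with theta divided by the residue of F.
*)
theory Submission
  imports Defs
begin

section \<open>Weighted words and overlaps\<close>

text \<open>A forbidden word is treated as a pattern of multiplicity 0. Completing a pattern with
  factor M then always adds (M - 1) times the weight before completion, so repeated and forbidden
  words obey the same equations. The form of P comes from splitting M - 1: for a repeated word it is
  (1 - 1/m) times m, for a forbidden word (-1) times 1. The first factors are the coefficients in P
  and D, the second ones are absorbed into the unknowns.

  Two obstacles shape the analytic part. The R_i are formal rational functions, while the series
  converge only for z > theta; hence their identities are available only at points above theta and
  away from unspecified poles, and theta itself is reached by a limit. Moreover A may be periodic,
  so counts divided by theta^n need not converge. A positive eigenvector still bounds them by a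
  multiple of theta^n, which is what makes (z - theta) E_X(z) bounded and allows a convergent
  subsequence. The choice of subsequence does not matter: its limits are determined up to scalars by
  uniqueness of the positive eigenvector, and the scalars cancel in the product U_X V_Y.\<close>

lemma occurrences_Cons:
  assumes "r \<noteq> []"
  shows "occurrences (x # u) r = occurrences u r + (if prefix r (x # u) then 1 else 0)"
proof -
  let ?S = "{i. i + length r \<le> length u \<and> take (length r) (drop i u) = r}"
  let ?T = "{i. i + length r \<le> length (x # u) \<and> take (length r) (drop i (x # u)) = r}"
  have fin: "finite ?S" by (rule finite_subset[of _ "{..length u}"]) auto
  have pre: "prefix r (x # u) \<longleftrightarrow> 0 \<in> ?T"
    by (simp, metis take_is_prefix prefix_length_le length_Cons append_eq_conv_conj prefixE)
  have "i \<in> ?T \<longleftrightarrow> i \<in> Suc ` ?S \<union> (if prefix r (x # u) then {0} else {})" for i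
    using pre by (cases i) auto
  then have "?T = Suc ` ?S \<union> (if prefix r (x # u) then {0} else {})"
    by blast
  then have "card ?T = card (Suc ` ?S) + card (if prefix r (x # u) then {0::nat} else {})"
    using fin by (simp only:) (rule card_Un_disjoint, auto)
  then show ?thesis by (simp add: occurrences_def card_image)
qed

lemma occurrences_snoc:
  assumes "r \<noteq> []"
  shows "occurrences (u @ [x]) r = occurrences u r + (if suffix r (u @ [x]) then 1 else 0)"
proof -
  let ?S = "{i. i + length r \<le> length u \<and> take (length r) (drop i u) = r}"
  let ?T = "{i. i + length r \<le> length (u @ [x]) \<and> take (length r) (drop i (u @ [x])) = r}"
  let ?E = "if suffix r (u @ [x]) then {Suc (length u) - length r} else {}"
  have fin: "finite ?S" by (rule finite_subset[of _ "{..length u}"]) auto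
  have "i \<in> ?T \<longleftrightarrow> i \<in> ?S \<union> ?E" for i
  proof -
    consider "i + length r \<le> length u" | "i + length r = Suc (length u)" | "i + length r > Suc (length u)"
      by linarith
    then show ?thesis
    proof cases
      case 1
      then have "i \<noteq> Suc (length u) - length r" by auto
      with 1 show ?thesis by auto
    next
      case 2
      then have "take (length r) (drop i (u @ [x])) = drop i (u @ [x])" by simp
      moreover have "drop i (u @ [x]) = r \<longleftrightarrow> suffix r (u @ [x])"
        using 2 suffix_drop[of i "u @ [x]"] 
        by (metis add_diff_cancel_right' append_eq_conv_conj length_append length_append_singleton suffix_def)
      ultimately show ?thesis using 2 by auto
    next
      case 3
      then show ?thesis by (auto dest: suffix_length_le)
    qed
  qed
  then have "?T = ?S \<union> ?E" by blast
  moreover have "?S \<inter> ?E = {}"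
    using suffix_length_le[of r "u @ [x]"] by auto
  ultimately have "card ?T = card ?S + card ?E"
    using fin by (simp only:) (rule card_Un_disjoint, auto)
  then show ?thesis by (simp add: occurrences_def)
qed

lemma occurrences_Nil: "r \<noteq> [] \<Longrightarrow> occurrences [] r = 0"
  by (simp add: occurrences_def)

lemma occurrences_rev:
  assumes "r \<noteq> []"
  shows "occurrences (rev u) (rev r) = occurrences u r"
proof (induction u)
  case Nil
  show ?case using assms by (simp add: occurrences_Nil)
next
  case (Cons x u)
  have "suffix (rev r) (rev u @ [x]) \<longleftrightarrow> prefix r (x # u)"
    by (simp add: suffix_to_prefix)
  with Cons assms show ?case
    by (simp add: occurrences_Cons occurrences_snoc)
qed

lemma occurrences_eq_0_iff: 
  "occurrences u r = 0 \<longleftrightarrow> \<not> sublist r u"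
proof -
  have fin: "finite {i. i + length r \<le> length u \<and> take (length r) (drop i u) = r}"
    by (rule finite_subset[of _ "{..length u}"]) auto
  have "sublist r u \<longleftrightarrow> (\<exists>i. i + length r \<le> length u \<and> take (length r) (drop i u) = r)"
  proof
    assume "sublist r u"
    then obtain a b where "u = a @ r @ b" by (auto simp: sublist_def)
    then show "\<exists>i. i + length r \<le> length u \<and> take (length r) (drop i u) = r"
      by (intro exI[of _ "length a"]) auto
  next
    assume "\<exists>i. i + length r \<le> length u \<and> take (length r) (drop i u) = r"
    then show "sublist r u" by (metis sublist_order.order_trans sublist_take sublist_drop)
  qed
  then show ?thesis using fin unfolding occurrences_def by (auto simp: card_eq_0_iff)
qed

section \<open>Sums over all words of a given length\<close>

definition words :: "nat \<Rightarrow> 'a::finite list set" where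
  "words n = {u. length u = n}"

lemma finite_words [simp]: "finite (words n)"
  using finite_lists_length_eq[of "UNIV :: 'a set" n] by (simp add: words_def)

lemma words_0 [simp]: "words 0 = {[]}"
  by (auto simp: words_def)

lemma sum_words_add:
  "(\<Sum>u\<in>words (n + k). h u) = (\<Sum>u\<in>words n. \<Sum>v\<in>words k. h (u @ v))"
proof -
  have "(\<Sum>u\<in>words n. \<Sum>v\<in>words k. h (u @ v)) = (\<Sum>(u, v)\<in>words n \<times> words k. h (u @ v))"
    by (simp add: sum.cartesian_product)
  also have "\<dots> = (\<Sum>u\<in>words (n + k). h u)"
    by (rule sum.reindex_bij_witness[of _ "\<lambda>u. (take n u, drop n u)" "\<lambda>(u, v). u @ v"])
      (auto simp: words_def)
  finally show ?thesis ..
qed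

lemma sum_words_1: "(\<Sum>v\<in>words (Suc 0). h v) = (\<Sum>x\<in>UNIV. h [x])"
  by (rule sum.reindex_bij_witness[of _ "\<lambda>x. [x]" hd]) (auto simp: words_def length_Suc_conv)

lemma sum_words_rev: "(\<Sum>u\<in>words n. h (rev u)) = (\<Sum>u\<in>words n. h u)"
  by (rule sum.reindex_bij_witness[of _ rev rev]) (auto simp: words_def)

locale pattern_system =
  fixes K :: nat and w :: "nat \<Rightarrow> 'a::finite list" and M :: "nat \<Rightarrow> real"
  assumes pattern_length: "i < K \<Longrightarrow> length (w i) \<ge> 2"
    and antichain: "i < K \<Longrightarrow> j < K \<Longrightarrow> sublist (w i) (w j) \<Longrightarrow> i = j"
    and M_nonneg: "i < K \<Longrightarrow> M i \<ge> 0"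
begin

definition weight :: "'a list \<Rightarrow> real" where
  "weight u = (\<Prod>i<K. M i ^ occurrences u (w i))"

definition ext_count :: "'a list \<Rightarrow> nat \<Rightarrow> real" where
  "ext_count v n = (\<Sum>u\<in>words n. weight (u @ v))"

text \<open>Dropping the last letter makes the count meaningful for forbidden words too: what is counted is
  the words in which a forbidden word occurs at the very end and nowhere earlier.\<close>

definition end_count :: "nat \<Rightarrow> nat \<Rightarrow> real" where
  "end_count j n = (\<Sum>u\<in>words n. if suffix (w j) u then weight (butlast u) else 0)"

lemma pattern_nonempty: "i < K \<Longrightarrow> w i \<noteq> []"
  using pattern_length by fastforce

lemma weight_nonneg: "weight u \<ge> 0"
  unfolding weight_def by (intro prod_nonneg) (auto simp: M_nonneg)

lemma weight_Nil [simp]: "weight [] = 1"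
  unfolding weight_def by (intro prod.neutral) (auto simp: occurrences_Nil pattern_nonempty)

lemma weight_eq_1: "(\<And>j. j < K \<Longrightarrow> \<not> sublist (w j) u) \<Longrightarrow> weight u = 1"
  unfolding weight_def by (intro prod.neutral) (auto simp: occurrences_eq_0_iff[THEN iffD2])

lemma weight_snoc_mult:
  "weight (u @ [x]) = weight u * (\<Prod>j<K. if suffix (w j) (u @ [x]) then M j else 1)"
  unfolding weight_def prod.distrib[symmetric]
  by (intro prod.cong) (auto simp: occurrences_snoc pattern_nonempty)

lemma weight_Cons_mult:
  "weight (x # u) = weight u * (\<Prod>j<K. if prefix (w j) (x # u) then M j else 1)"
  unfolding weight_def prod.distrib[symmetric]
  by (intro prod.cong) (auto simp: occurrences_Cons pattern_nonempty)

text \<open>Two patterns ending at the same letter are suffixes of one word, hence one is a suffix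
  of the other, which \<open>antichain\<close> excludes. So at most one factor in
  \<open>weight_snoc_mult\<close> can differ from 1, and M = 1 + (M - 1) turns the product into a
  sum. This makes the equations for the counts linear.\<close>

lemma weight_snoc:
  "weight (u @ [x]) = weight u + (\<Sum>j<K. (M j - 1) * (if suffix (w j) (u @ [x]) then weight u else 0))"
proof (cases "\<exists>j<K. suffix (w j) (u @ [x])")
  case True
  then obtain i where i: "i < K" "suffix (w i) (u @ [x])" by blast
  have only: "suffix (w j) (u @ [x]) \<longleftrightarrow> j = i" if "j < K" for j
    using suffix_same_cases[OF i(2), of "w j"] antichain[OF that i(1)] antichain[OF i(1) that] i(2)
    by (metis suffix_imp_sublist)
  have p: "(\<Prod>j<K. if suffix (w j) (u @ [x]) then M j else 1) = (\<Prod>j<K. if i = j then M j else 1)"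
    by (intro prod.cong refl) (use only in \<open>auto simp del: suffix_snoc\<close>)
  have s: "(\<Sum>j<K. (M j - 1) * (if suffix (w j) (u @ [x]) then weight u else 0)) =
      (\<Sum>j<K. if i = j then (M j - 1) * weight u else 0)"
    by (intro sum.cong refl) (use only in \<open>auto simp del: suffix_snoc\<close>)
  show ?thesis unfolding weight_snoc_mult p s using i(1) by (simp add: algebra_simps)
next
  case False
  have p: "(\<Prod>j<K. if suffix (w j) (u @ [x]) then M j else 1) = 1"
    using False by (intro prod.neutral) auto
  have s: "(\<Sum>j<K. (M j - 1) * (if suffix (w j) (u @ [x]) then weight u else 0)) = 0"
    using False by (intro sum.neutral) auto
  show ?thesis unfolding weight_snoc_mult p s by simp
qed

text \<open>Telescoping over the letters of \<open>v\<close>, each of which completes at most one pattern.\<close>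

lemma weight_append:
  "weight (u @ v) = weight u + (\<Sum>j<K. (M j - 1) * (\<Sum>k=1..length v.
     if suffix (w j) (u @ take k v) then weight (u @ take (k - 1) v) else 0))"
proof (induction v rule: rev_induct)
  case Nil
  show ?case by simp
next
  case (snoc x v)
  let ?t = "\<lambda>v j k. if suffix (w j) (u @ take k v) then weight (u @ take (k - 1) v) else 0"
  have eq: "(\<Sum>k=1..length (v @ [x]). ?t (v @ [x]) j k) =
      (\<Sum>k=1..length v. ?t v j k) + (if suffix (w j) ((u @ v) @ [x]) then weight (u @ v) else 0)" for j
  proof -
    have "(\<Sum>k=1..length v. ?t (v @ [x]) j k) = (\<Sum>k=1..length v. ?t v j k)"
      by (intro sum.cong) auto
    then show ?thesis by simp
  qed
  show ?case
    unfolding eq distrib_left sum.distrib append_assoc[symmetric]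
    using snoc weight_snoc[of "u @ v" x] by simp
qed

text \<open>As \<open>v\<close> contains no pattern, an occurrence of \<open>w j\<close> that ends
  after \<open>k\<close> letters of \<open>v\<close> must begin inside \<open>u\<close>; so
  \<open>k\<close> is less than its length and these \<open>k\<close> letters are its last ones. For
  such \<open>k\<close> every word of length \<open>n + k\<close> ending in \<open>w j\<close> has
  the form \<open>u @ take k v\<close>, so nothing is lost in passing to
  \<open>end_count\<close>.\<close>

lemma suffix_count_eq:
  assumes "\<not> sublist (w j) v" "1 \<le> k" "k \<le> length v"
  shows "(\<Sum>u\<in>words n. if suffix (w j) (u @ take k v) then weight (u @ take (k - 1) v) else 0) =
    (if k < length (w j) \<and> take k v = drop (length (w j) - k) (w j) then end_count j (n + k) else 0)"
proof (cases "k < length (w j) \<and> take k v = drop (length (w j) - k) (w j)")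
  case True
  \<comment> \<open>Ending in \<open>w j\<close> forces the last \<open>k\<close> letters, which
    collapses the sum over \<open>y\<close>.\<close>
  have *: "y = take k v" if "u \<in> words n" "y \<in> words k" "suffix (w j) (u @ y)" for u y
  proof -
    have "suffix (drop (length (w j) - k) (w j)) (u @ y)"
      using that(3) suffix_drop suffix_order.trans by blast
    then have "suffix (take k v) (u @ y)" using True by simp
    moreover have "length (take k v) = length y" using that assms by (simp add: words_def)
    ultimately show ?thesis by (metis suffix_append suffix_order.eq_iff suffix_length_suffix
          suffix_order.refl order.refl suffix_def append_eq_append_conv)
  qed
  have "end_count j (n + k) = (\<Sum>u\<in>words n. \<Sum>y\<in>words k.
      if suffix (w j) (u @ y) then weight (butlast (u @ y)) else 0)"
    by (simp add: end_count_def sum_words_add)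
  also have "\<dots> = (\<Sum>u\<in>words n. \<Sum>y\<in>words k. if take k v = y then
      if suffix (w j) (u @ y) then weight (butlast (u @ y)) else 0 else 0)"
    by (intro sum.cong) (auto dest: *)
  also have "\<dots> = (\<Sum>u\<in>words n. if suffix (w j) (u @ take k v)
      then weight (butlast (u @ take k v)) else 0)"
    using assms by (intro sum.cong) (auto simp: words_def sum.delta finite_words[unfolded words_def])
  also have "\<dots> = (\<Sum>u\<in>words n. if suffix (w j) (u @ take k v)
      then weight (u @ take (k - 1) v) else 0)"
  proof (intro sum.cong refl)
    fix u
    have "take k v \<noteq> []" using assms by auto
    then have "butlast (u @ take k v) = u @ take (k - 1) v"
      using assms by (simp add: butlast_append butlast_take)
    then show "(if suffix (w j) (u @ take k v) then weight (butlast (u @ take k v)) else 0) =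
      (if suffix (w j) (u @ take k v) then weight (u @ take (k - 1) v) else 0)" by simp
  qed
  finally show ?thesis using True by simp
next
  case False
  have "\<not> suffix (w j) (u @ take k v)" for u
  proof
    assume s: "suffix (w j) (u @ take k v)"
    have len: "length (take k v) = k" using assms by simp
    show False
    proof (cases "length (w j) \<le> k")
      case True
      then have "suffix (w j) (take k v)"
        using s len by (metis suffix_length_suffix suffix_def)
      then show False using assms(1)
        by (meson sublist_order.order_trans sublist_take suffix_imp_sublist)
    next
      case F: False
      then have "suffix (take k v) (w j)"
        using s len by (metis nat_le_linear suffix_length_suffix suffix_def)
      then have "take k v = drop (length (w j) - k) (w j)"
        using len F by (metis append_eq_conv_conj suffix_def length_append add_diff_cancel_right')
      with F False show False by simp
    qed
  qed
  then show ?thesis using False by auto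
qed

lemma ext_count_overlap:
  assumes "\<And>j. j < K \<Longrightarrow> \<not> sublist (w j) v"
  shows "ext_count v n = ext_count [] n + (\<Sum>j<K. (M j - 1) * (\<Sum>k=1..length v.
     if k < length (w j) \<and> take k v = drop (length (w j) - k) (w j) then end_count j (n + k) else 0))"
proof -
  have "ext_count v n = ext_count [] n + (\<Sum>u\<in>words n. \<Sum>j<K. (M j - 1) * (\<Sum>k=1..length v.
     if suffix (w j) (u @ take k v) then weight (u @ take (k - 1) v) else 0))"
    unfolding ext_count_def weight_append[of _ v] sum.distrib by simp
  also have "(\<Sum>u\<in>words n. \<Sum>j<K. (M j - 1) * (\<Sum>k=1..length v.
     if suffix (w j) (u @ take k v) then weight (u @ take (k - 1) v) else 0)) =
     (\<Sum>j<K. (M j - 1) * (\<Sum>k=1..length v. \<Sum>u\<in>words n.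
     if suffix (w j) (u @ take k v) then weight (u @ take (k - 1) v) else 0))"
    by (subst sum.swap) (simp add: sum_distrib_left sum.swap[of _ "words n"])
  also have "\<dots> = (\<Sum>j<K. (M j - 1) * (\<Sum>k=1..length v.
     if k < length (w j) \<and> take k v = drop (length (w j) - k) (w j) then end_count j (n + k) else 0))"
    using assms by (intro sum.cong refl arg_cong2[where f = "(*)"] suffix_count_eq) auto
  finally show ?thesis .
qed

text \<open>A word counted by \<open>end_count i\<close> loses its last letter in the weight, and
  what then remains of the pattern, \<open>butlast (w i)\<close>, contains no pattern at all
  (\<open>not_sublist_butlast\<close>). So \<open>ext_count_overlap\<close> applies to it, which
  closes the linear system.\<close>

lemma end_count_eq_ext_count:
  assumes "i < K"
  shows "end_count i (n + length (w i)) = ext_count (butlast (w i)) n"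
proof -
  have *: "y = w i" if "u \<in> words n" "y \<in> words (length (w i))" "suffix (w i) (u @ y)" for u y
    using that by (auto simp: words_def suffix_def)
  have "end_count i (n + length (w i)) = (\<Sum>u\<in>words n. \<Sum>y\<in>words (length (w i)).
      if suffix (w i) (u @ y) then weight (butlast (u @ y)) else 0)"
    by (simp add: end_count_def sum_words_add)
  also have "\<dots> = (\<Sum>u\<in>words n. \<Sum>y\<in>words (length (w i)).
      if w i = y then weight (butlast (u @ y)) else 0)"
    by (intro sum.cong) (auto dest: * simp: suffix_def)
  also have "\<dots> = (\<Sum>u\<in>words n. weight (u @ butlast (w i)))"
    using pattern_nonempty[OF assms]
    by (intro sum.cong) (auto simp: words_def sum.delta finite_words[unfolded words_def] butlast_append)
  finally show ?thesis by (simp add: ext_count_def)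
qed

lemma end_count_eq_0:
  assumes "n < length (w j)"
  shows "end_count j n = 0"
  unfolding end_count_def using assms
  by (intro sum.neutral) (auto simp: words_def dest: suffix_length_le)

lemma ext_count_Suc:
  "ext_count [] (Suc n) = real CARD('a) * ext_count [] n + (\<Sum>j<K. (M j - 1) * end_count j (Suc n))"
proof -
  have "ext_count [] (n + Suc 0) = (\<Sum>u\<in>words n. \<Sum>x\<in>UNIV. weight (u @ [x]))"
    by (simp only: ext_count_def sum_words_add sum_words_1 append_Nil2)
  also have "\<dots> = real CARD('a) * ext_count [] n + (\<Sum>u\<in>words n. \<Sum>x\<in>UNIV.
     \<Sum>j<K. (M j - 1) * (if suffix (w j) (u @ [x]) then weight u else 0))"
    by (subst weight_snoc) (simp add: sum.distrib ext_count_def sum_distrib_left)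
  also have "(\<Sum>u\<in>words n. \<Sum>x\<in>UNIV.
     \<Sum>j<K. (M j - 1) * (if suffix (w j) (u @ [x]) then weight u else 0)) =
     (\<Sum>u\<in>words n. \<Sum>j<K. (M j - 1) * (\<Sum>x\<in>UNIV. if suffix (w j) (u @ [x]) then weight u else 0))"
    by (subst sum.swap) (simp add: sum_distrib_left)
  also have "\<dots> = (\<Sum>j<K. (M j - 1) * (\<Sum>u\<in>words n. \<Sum>x\<in>UNIV. if suffix (w j) (u @ [x]) then weight u else 0))"
    by (subst sum.swap) (simp add: sum_distrib_left)
  also have "\<dots> = (\<Sum>j<K. (M j - 1) * end_count j (n + Suc 0))"
    by (simp only: end_count_def sum_words_add sum_words_1 butlast_snoc)
  finally show ?thesis by simp
qed

lemma ext_count_nonneg: "ext_count v n \<ge> 0"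
  unfolding ext_count_def by (intro sum_nonneg weight_nonneg)

lemma end_count_nonneg: "end_count j n \<ge> 0"
  unfolding end_count_def by (intro sum_nonneg) (auto simp: weight_nonneg)

text \<open>The weight in \<open>end_count\<close> is that of the word without its last letter, so
  each shorter word is charged at most once per letter. This crude bound later keeps R_i(z) bounded
  near theta.\<close>

lemma end_count_le: "end_count j (Suc n) \<le> real CARD('a) * ext_count [] n"
proof -
  have "end_count j (n + Suc 0) = (\<Sum>u\<in>words n. \<Sum>x\<in>UNIV. if suffix (w j) (u @ [x]) then weight u else 0)"
    by (simp only: end_count_def sum_words_add sum_words_1 butlast_snoc)
  also have "\<dots> \<le> (\<Sum>u\<in>words n. \<Sum>x\<in>(UNIV::'a set). weight u)"
    by (intro sum_mono) (auto simp: weight_nonneg)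
  also have "\<dots> = real CARD('a) * ext_count [] n"
    by (simp add: ext_count_def sum_distrib_left)
  finally show ?thesis by simp
qed

end

section \<open>Generating functions\<close>

text \<open>A series in 1/z: it converges for z above the growth rate, and an index shift by
  \<open>k\<close> becomes multiplication by z^k, as in the correlation polynomials.\<close>

definition gf :: "(nat \<Rightarrow> real) \<Rightarrow> real \<Rightarrow> real" where
  "gf h z = (\<Sum>n. h n / z ^ n)"

abbreviation gf_summable :: "(nat \<Rightarrow> real) \<Rightarrow> real \<Rightarrow> bool" where
  "gf_summable h z \<equiv> summable (\<lambda>n. h n / z ^ n)"

lemma gf_summable_shift_iff:
  assumes "z > 0"
  shows "gf_summable (\<lambda>n. h (n + k)) z \<longleftrightarrow> gf_summable h z"
proof -
  have "gf_summable h z \<longleftrightarrow> summable (\<lambda>n. h (n + k) / z ^ (n + k))"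
    by (rule summable_iff_shift[symmetric])
  also have "(\<lambda>n. h (n + k) / z ^ (n + k)) = (\<lambda>n. (1 / z ^ k) * (h (n + k) / z ^ n))"
    using assms by (auto simp: power_add field_simps)
  also have "summable \<dots> \<longleftrightarrow> gf_summable (\<lambda>n. h (n + k)) z"
    by (subst summable_cmult_iff) (use assms in auto)
  finally show ?thesis ..
qed

lemma gf_shift:
  assumes "z > 0" "gf_summable h z"
  shows "gf (\<lambda>n. h (n + k)) z = z ^ k * (gf h z - (\<Sum>n<k. h n / z ^ n))"
proof -
  have "gf h z - (\<Sum>n<k. h n / z ^ n) = (\<Sum>n. h (n + k) / z ^ (n + k))"
    unfolding gf_def using suminf_split_initial_segment[OF assms(2), of k] by simp
  also have "(\<lambda>n. h (n + k) / z ^ (n + k)) = (\<lambda>n. (1 / z ^ k) * (h (n + k) / z ^ n))"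
    using assms by (auto simp: power_add field_simps)
  also have "(\<Sum>n. (1 / z ^ k) * (h (n + k) / z ^ n)) = (1 / z ^ k) * gf (\<lambda>n. h (n + k)) z"
    unfolding gf_def using assms gf_summable_shift_iff[of z h k] by (intro suminf_mult) simp
  finally show ?thesis using assms by simp
qed

lemma gf_shift_0:
  assumes "z > 0" "gf_summable h z" "\<And>n. n < k \<Longrightarrow> h n = 0"
  shows "gf (\<lambda>n. h (n + k)) z = z ^ k * gf h z"
  using gf_shift[OF assms(1,2), of k] assms(3) by simp

lemma gf_add: "gf_summable f z \<Longrightarrow> gf_summable h z \<Longrightarrow> gf (\<lambda>n. f n + h n) z = gf f z + gf h z"
  unfolding gf_def add_divide_distrib by (rule suminf_add[symmetric])

lemma gf_summable_cmult: "gf_summable f z \<Longrightarrow> gf_summable (\<lambda>n. c * f n) z"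
  using summable_mult[of "\<lambda>n. f n / z ^ n" c] by simp

lemma gf_cmult: "gf_summable f z \<Longrightarrow> gf (\<lambda>n. c * f n) z = c * gf f z"
  unfolding gf_def using suminf_mult[of "\<lambda>n. f n / z ^ n" c] by simp

lemma gf_summable_sum: "(\<And>i. i \<in> I \<Longrightarrow> gf_summable (f i) z) \<Longrightarrow> gf_summable (\<lambda>n. \<Sum>i\<in>I. f i n) z"
  unfolding sum_divide_distrib by (rule summable_sum)

lemma gf_sum: "(\<And>i. i \<in> I \<Longrightarrow> gf_summable (f i) z) \<Longrightarrow> gf (\<lambda>n. \<Sum>i\<in>I. f i n) z = (\<Sum>i\<in>I. gf (f i) z)"
  unfolding gf_def sum_divide_distrib by (rule suminf_sum)

lemma gf_mono:
  assumes "z > 0" "\<And>n. f n \<le> h n" "gf_summable f z" "gf_summable h z"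
  shows "gf f z \<le> gf h z"
  unfolding gf_def by (intro suminf_le) (use assms in \<open>auto intro: divide_right_mono\<close>)

lemma gf_nonneg:
  assumes "z > 0" "\<And>n. f n \<ge> 0" "gf_summable f z"
  shows "gf f z \<ge> 0"
  unfolding gf_def by (intro suminf_nonneg) (use assms in auto)

lemma gf_summable_le:
  assumes "z > 0" "\<And>n. n \<ge> N \<Longrightarrow> 0 \<le> f n" "\<And>n. n \<ge> N \<Longrightarrow> f n \<le> h n" "gf_summable h z"
  shows "gf_summable f z"
  by (rule summable_comparison_test'[OF assms(4), of N]) (use assms in \<open>auto intro: divide_right_mono\<close>)

lemma gf_geometric:
  assumes "0 \<le> \<theta>" "\<theta> < z"
  shows "gf_summable (\<lambda>n. C * \<theta> ^ n) z" "gf (\<lambda>n. C * \<theta> ^ n) z = C * z / (z - \<theta>)"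
proof -
  have eq: "(\<lambda>n. C * \<theta> ^ n / z ^ n) = (\<lambda>n. C * (\<theta> / z) ^ n)"
    by (auto simp: power_divide)
  have lt: "norm (\<theta> / z) < 1" using assms by simp
  have "(\<lambda>n. (\<theta> / z) ^ n) sums (1 / (1 - \<theta> / z))" by (rule geometric_sums[OF lt])
  then have "(\<lambda>n. C * (\<theta> / z) ^ n) sums (C * (1 / (1 - \<theta> / z)))" by (rule sums_mult)
  moreover have "C * (1 / (1 - \<theta> / z)) = C * z / (z - \<theta>)" using assms by (simp add: field_simps)
  ultimately have "(\<lambda>n. C * \<theta> ^ n / z ^ n) sums (C * z / (z - \<theta>))" by (simp only: eq)
  then show "gf_summable (\<lambda>n. C * \<theta> ^ n) z" "gf (\<lambda>n. C * \<theta> ^ n) z = C * z / (z - \<theta>)"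
    unfolding gf_def by (auto simp: sums_iff)
qed

text \<open>The exponent is the length of the overlap, one more than in
  \<open>correlation_poly\<close>. Overlaps that use up all of \<open>u\<close> and placements in
  which \<open>v\<close> ends before \<open>u\<close> are left out. The correlations in P, U and V
  all reduce to this polynomial.\<close>

definition overlap_poly :: "'a list \<Rightarrow> 'a list \<Rightarrow> real poly" where
  "overlap_poly u v = (\<Sum>k=1..length v.
     if k < length u \<and> take k v = drop (length u - k) u then monom 1 k else 0)"

context pattern_system
begin

lemma end_count_summable:
  assumes "z > 0" "gf_summable (ext_count []) z"
  shows "gf_summable (end_count j) z"
proof -
  have "gf_summable (\<lambda>n. end_count j (n + 1)) z"
    by (rule gf_summable_le[where N = 0, OF assms(1) _ _ gf_summable_cmult[OF assms(2), of "real CARD('a)"]])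
      (auto simp: end_count_nonneg intro: end_count_le)
  then show ?thesis by (subst (asm) gf_summable_shift_iff[OF assms(1)])
qed

lemma end_gf_le:
  assumes "z > 0" "gf_summable (ext_count []) z" "j < K"
  shows "gf (end_count j) z \<le> real CARD('a) / z * gf (ext_count []) z"
proof -
  have "gf (\<lambda>n. end_count j (n + 1)) z = z ^ 1 * gf (end_count j) z"
    using end_count_summable[OF assms(1,2), of j] assms pattern_length[OF assms(3)]
    by (intro gf_shift_0) (auto intro!: end_count_eq_0)
  moreover have "gf (\<lambda>n. end_count j (n + 1)) z \<le> gf (\<lambda>n. real CARD('a) * ext_count [] n) z"
    using assms end_count_summable[OF assms(1,2), of j] gf_summable_shift_iff[OF assms(1), of "end_count j" 1]
    by (intro gf_mono gf_summable_cmult) (auto simp: end_count_le)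
  ultimately show ?thesis using assms by (simp add: gf_cmult field_simps)
qed

text \<open>Each overlap of length \<open>k\<close> shifts an index by \<open>k\<close> and so
  contributes z^k. No initial terms have to be subtracted: \<open>k < length (w j)\<close>, and
  \<open>end_count j n\<close> vanishes for \<open>n < length (w j)\<close>.\<close>

lemma ext_gf_overlap:
  assumes z: "z > 0" "gf_summable (ext_count []) z" and v: "\<And>j. j < K \<Longrightarrow> \<not> sublist (w j) v"
  shows "gf (ext_count v) z = gf (ext_count []) z +
    (\<Sum>j<K. (M j - 1) * (poly (overlap_poly (w j) v) z * gf (end_count j) z))"
proof -
  let ?t = "\<lambda>j k n. if k < length (w j) \<and> take k v = drop (length (w j) - k) (w j) then end_count j (n + k) else 0"
  have sm: "gf_summable (?t j k) z" for j k
    by (cases "k < length (w j) \<and> take k v = drop (length (w j) - k) (w j)")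
      (auto simp: gf_summable_shift_iff z end_count_summable)
  have t: "gf (?t j k) z = poly (if k < length (w j) \<and> take k v = drop (length (w j) - k) (w j)
      then monom 1 k else 0) z * gf (end_count j) z" for j k
    by (cases "k < length (w j) \<and> take k v = drop (length (w j) - k) (w j)")
      (auto simp: poly_monom gf_shift_0 z end_count_summable end_count_eq_0, auto simp: gf_def)
  have "gf (ext_count v) z = gf (\<lambda>n. ext_count [] n + (\<Sum>j<K. (M j - 1) * (\<Sum>k=1..length v. ?t j k n))) z"
    using ext_count_overlap[of v] v by (intro arg_cong2[where f = gf]) auto
  also have "\<dots> = gf (ext_count []) z + gf (\<lambda>n. \<Sum>j<K. (M j - 1) * (\<Sum>k=1..length v. ?t j k n)) z"
    by (intro gf_add z gf_summable_sum gf_summable_cmult sm)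
  also have "gf (\<lambda>n. \<Sum>j<K. (M j - 1) * (\<Sum>k=1..length v. ?t j k n)) z =
      (\<Sum>j<K. gf (\<lambda>n. (M j - 1) * (\<Sum>k=1..length v. ?t j k n)) z)"
    by (intro gf_sum gf_summable_sum gf_summable_cmult sm)
  also have "\<dots> = (\<Sum>j<K. (M j - 1) * (\<Sum>k=1..length v. gf (?t j k) z))"
    by (intro sum.cong refl, subst gf_cmult, intro gf_summable_sum sm, subst gf_sum, rule sm, rule refl)
  also have "\<dots> = (\<Sum>j<K. (M j - 1) * (poly (overlap_poly (w j) v) z * gf (end_count j) z))"
    unfolding t overlap_poly_def poly_sum sum_distrib_right ..
  finally show ?thesis .
qed

text \<open>This is \<open>weight_snoc\<close> summed over all words and all last letters; it
  becomes the scalar equation relating F and R once the end counts are expressed by F and the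
  R_i.\<close>

lemma gf_ext_count_Nil:
  assumes z: "z > 0" "gf_summable (ext_count []) z"
  shows "z * (gf (ext_count []) z - 1) = real CARD('a) * gf (ext_count []) z
    + z * (\<Sum>j<K. (M j - 1) * gf (end_count j) z)"
proof -
  have sh: "gf (\<lambda>n. end_count j (n + 1)) z = z ^ 1 * gf (end_count j) z" if "j < K" for j
    using end_count_summable[OF z, of j] z pattern_length[OF that]
    by (intro gf_shift_0) (auto intro!: end_count_eq_0)
  have "ext_count [] 0 = 1" by (simp add: ext_count_def)
  then have "z * (gf (ext_count []) z - 1) = gf (\<lambda>n. ext_count [] (n + 1)) z"
    by (subst gf_shift) (use z in auto)
  also have "(\<lambda>n. ext_count [] (n + 1)) = (\<lambda>n. real CARD('a) * ext_count [] n +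
     (\<Sum>j<K. (M j - 1) * end_count j (n + 1)))"
    by (simp add: ext_count_Suc)
  also have "gf \<dots> z = real CARD('a) * gf (ext_count []) z + (\<Sum>j<K. (M j - 1) * gf (\<lambda>n. end_count j (n + 1)) z)"
    by (subst gf_add, intro gf_summable_cmult z, intro gf_summable_sum gf_summable_cmult)
      (auto simp: gf_summable_shift_iff z end_count_summable gf_cmult gf_sum gf_summable_cmult 
        simp del: One_nat_def)
  also have "(\<Sum>j<K. (M j - 1) * gf (\<lambda>n. end_count j (n + 1)) z) = (\<Sum>j<K. z * ((M j - 1) * gf (end_count j) z))"
    by (intro sum.cong refl) (simp add: sh del: One_nat_def)
  finally show ?thesis by (simp add: sum_distrib_left)
qed

lemma not_sublist_butlast:
  assumes "i < K" "j < K"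
  shows "\<not> sublist (w j) (butlast (w i))"
proof
  assume s: "sublist (w j) (butlast (w i))"
  then have "sublist (w j) (w i)"
    by (meson sublist_butlast sublist_order.order_trans)
  then have "j = i" using antichain assms by blast
  with sublist_length_le[OF s] pattern_length[OF assms(1)] show False by simp
qed

lemma end_gf_overlap:
  assumes z: "z > 0" "gf_summable (ext_count []) z" and i: "i < K"
  shows "z ^ length (w i) * gf (end_count i) z = gf (ext_count []) z +
    (\<Sum>j<K. (M j - 1) * (poly (overlap_poly (w j) (butlast (w i))) z * gf (end_count j) z))"
proof -
  have "z ^ length (w i) * gf (end_count i) z = gf (\<lambda>n. end_count i (n + length (w i))) z"
    using end_count_summable[OF z, of i] z by (intro gf_shift_0[symmetric]) (auto intro!: end_count_eq_0)
  also have "\<dots> = gf (ext_count (butlast (w i))) z"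
    using end_count_eq_ext_count[OF i] by simp
  finally show ?thesis using ext_gf_overlap[OF z, of "butlast (w i)"] not_sublist_butlast[OF i] by simp
qed

end

section \<open>Rational functions and their values\<close>

definition regular_at :: "ratfun \<Rightarrow> real \<Rightarrow> bool" where
  "regular_at f x \<longleftrightarrow> (\<exists>a b. f = Fraction_Field.Fract a b \<and> poly b x \<noteq> 0)"

lemma ratfun_eval_Fract:
  assumes "poly b x \<noteq> 0"
  shows "ratfun_eval (Fraction_Field.Fract a b) x = poly a x / poly b x"
  unfolding ratfun_eval_def
proof (rule the_equality)
  show "\<exists>a' b'. Fraction_Field.Fract a b = Fraction_Field.Fract a' b' \<and> poly b' x \<noteq> 0 \<and>
    poly a x / poly b x = poly a' x / poly b' x"
    using assms by blast
next
  fix y assume "\<exists>a' b'. Fraction_Field.Fract a b = Fraction_Field.Fract a' b' \<and> poly b' x \<noteq> 0 \<and>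
    y = poly a' x / poly b' x"
  then obtain a' b' where *: "Fraction_Field.Fract a b = Fraction_Field.Fract a' b'" "poly b' x \<noteq> 0"
    "y = poly a' x / poly b' x" by blast
  have "b \<noteq> 0" "b' \<noteq> 0" using assms * by auto
  with *(1) have "a * b' = a' * b" by (simp add: eq_fract)
  then have "poly a x * poly b' x = poly a' x * poly b x" by (metis poly_mult)
  then have "poly b' x * (poly a x - y * poly b x) = 0" using * by (simp add: algebra_simps)
  with * assms show "y = poly a x / poly b x" by (simp add: field_simps)
qed

lemma regular_at_Fract: "poly b x \<noteq> 0 \<Longrightarrow> regular_at (Fraction_Field.Fract a b) x"
  by (auto simp: regular_at_def)

lemma regular_at_add:
  assumes "regular_at f x" "regular_at g x"
  shows "regular_at (f + g) x" "ratfun_eval (f + g) x = ratfun_eval f x + ratfun_eval g x"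
proof -
  obtain a b c d where *: "f = Fraction_Field.Fract a b" "poly b x \<noteq> 0" "g = Fraction_Field.Fract c d" "poly d x \<noteq> 0"
    using assms by (auto simp: regular_at_def)
  then have eq: "f + g = Fraction_Field.Fract (a * d + c * b) (b * d)" by (subst *(1), subst *(3), subst add_fract) auto
  have nz: "poly (b * d) x \<noteq> 0" using * by simp
  show "regular_at (f + g) x" unfolding eq using nz by (rule regular_at_Fract)
  show "ratfun_eval (f + g) x = ratfun_eval f x + ratfun_eval g x"
    unfolding eq ratfun_eval_Fract[OF nz] using * by (simp add: ratfun_eval_Fract field_simps)
qed

lemma regular_at_mult:
  assumes "regular_at f x" "regular_at g x"
  shows "regular_at (f * g) x" "ratfun_eval (f * g) x = ratfun_eval f x * ratfun_eval g x"
proof -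
  obtain a b c d where *: "f = Fraction_Field.Fract a b" "poly b x \<noteq> 0" "g = Fraction_Field.Fract c d" "poly d x \<noteq> 0"
    using assms by (auto simp: regular_at_def)
  then have eq: "f * g = Fraction_Field.Fract (a * c) (b * d)" by simp
  have nz: "poly (b * d) x \<noteq> 0" using * by simp
  show "regular_at (f * g) x" unfolding eq using nz by (rule regular_at_Fract)
  show "ratfun_eval (f * g) x = ratfun_eval f x * ratfun_eval g x"
    unfolding eq ratfun_eval_Fract[OF nz] using * by (simp add: ratfun_eval_Fract)
qed

lemma regular_at_of_poly: "regular_at (ratfun_of_poly p) x" "ratfun_eval (ratfun_of_poly p) x = poly p x"
  by (auto simp: ratfun_of_poly_def ratfun_eval_Fract intro: regular_at_Fract)

lemma ratfun_of_poly_hom: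
  "ratfun_of_poly 0 = 0" "ratfun_of_poly 1 = 1"
  "ratfun_of_poly (p + q) = ratfun_of_poly p + ratfun_of_poly q"
  "ratfun_of_poly (p * q) = ratfun_of_poly p * ratfun_of_poly q"
  by (auto simp: ratfun_of_poly_def Zero_fract_def One_fract_def)

lemma ratfun_of_poly_eq_0_iff: "ratfun_of_poly p = 0 \<longleftrightarrow> p = 0"
  by (simp add: ratfun_of_poly_def Zero_fract_def eq_fract)

lemma comm_ring_hom_ratfun_of_poly: "comm_ring_hom ratfun_of_poly"
  by standard (simp_all add: ratfun_of_poly_hom)

lemma regular_at_sum:
  assumes "\<And>i. i \<in> I \<Longrightarrow> regular_at (f i) x"
  shows "regular_at (\<Sum>i\<in>I. f i) x \<and> ratfun_eval (\<Sum>i\<in>I. f i) x = (\<Sum>i\<in>I. ratfun_eval (f i) x)"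
  using assms
proof (induction I rule: infinite_finite_induct)
  case (insert i I)
  then show ?case by (simp add: regular_at_add)
qed (use regular_at_of_poly[of 0 x] in \<open>auto simp: ratfun_of_poly_hom\<close>)

lemma eventually_poly_nonzero:
  fixes b :: "real poly"
  assumes "b \<noteq> 0"
  shows "eventually (\<lambda>x. poly b x \<noteq> 0) (at x0)"
proof -
  have "finite {x. poly b x = 0}" using assms by (rule poly_roots_finite)
  then have "eventually (\<lambda>x. \<forall>y\<in>{x. poly b x = 0}. x \<noteq> y) (at x0)"
    by (intro eventually_ball_finite ballI) (auto intro: eventually_neq_at_within)
  then show ?thesis by eventually_elim auto
qed

lemma eventually_regular_at: "eventually (regular_at f) (at x0)"
proof -
  obtain a b where f: "f = Fraction_Field.Fract a b" "b \<noteq> 0" by (cases f) auto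
  from eventually_poly_nonzero[OF f(2), of x0] show ?thesis
    by eventually_elim (auto simp: f intro: regular_at_Fract)
qed

lemma ratfun_eval_differentiable:
  assumes "regular_at f x"
  shows "ratfun_eval f differentiable (at x)"
proof -
  obtain a b where f: "f = Fraction_Field.Fract a b" "poly b x \<noteq> 0" using assms by (auto simp: regular_at_def)
  have "b \<noteq> 0" using f by auto
  have ev: "eventually (\<lambda>y. poly b y \<noteq> 0) (nhds x)"
    using eventually_poly_nonzero[OF \<open>b \<noteq> 0\<close>, of x] f(2) by (auto simp: eventually_nhds_conv_at)
  then have ev: "eventually (\<lambda>y. ratfun_eval f y = poly a y / poly b y) (nhds x)"
    by eventually_elim (simp add: f ratfun_eval_Fract)
  have "((\<lambda>y. poly a y / poly b y) has_real_derivative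
      (poly (pderiv a) x * poly b x - poly a x * poly (pderiv b) x) / (poly b x * poly b x)) (at x)"
    by (intro DERIV_divide poly_DERIV f)
  then have "(ratfun_eval f has_real_derivative
      (poly (pderiv a) x * poly b x - poly a x * poly (pderiv b) x) / (poly b x * poly b x)) (at x)"
    by (subst DERIV_cong_ev[OF refl ev refl])
  then show ?thesis by (auto simp: real_differentiable_def)
qed

lemma ratfun_eval_tendsto:
  assumes "regular_at f x" "(g \<longlongrightarrow> x) F"
  shows "((\<lambda>k. ratfun_eval f (g k)) \<longlongrightarrow> ratfun_eval f x) F"
  using differentiable_imp_continuous_within[OF ratfun_eval_differentiable[OF assms(1)]]
  by (rule isCont_tendsto_compose[OF _ assms(2)])

text \<open>A representative with denominator of least degree has no common zero at \<open>x\<close>, so a pole at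
  \<open>x\<close> would make the values unbounded.\<close>

lemma bounded_imp_regular_at:
  fixes z :: "nat \<Rightarrow> real"
  assumes z: "z \<longlonglongrightarrow> x" "\<And>k. z k \<noteq> x"
    and bd: "eventually (\<lambda>k. \<bar>ratfun_eval f (z k)\<bar> \<le> C) sequentially"
  shows "regular_at f x"
proof -
  define S where "S = {b. b \<noteq> 0 \<and> (\<exists>a. f = Fraction_Field.Fract a b)}"
  have "\<exists>b. b \<in> S" unfolding S_def by (cases f) auto
  then obtain b where b: "b \<in> S" "\<And>b'. b' \<in> S \<Longrightarrow> degree b \<le> degree b'"
    using ex_has_least_nat[of "\<lambda>b. b \<in> S" _ degree] by blast
  then obtain a where f: "f = Fraction_Field.Fract a b" and "b \<noteq> 0" by (auto simp: S_def)
  have "poly b x \<noteq> 0"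
  proof
    assume b0: "poly b x = 0"
    then obtain b' where b': "b = [:-x, 1:] * b'" by (auto simp: poly_eq_0_iff_dvd)
    have "b' \<noteq> 0" using b' \<open>b \<noteq> 0\<close> by auto
    have a0: "poly a x \<noteq> 0"
    proof
      assume "poly a x = 0"
      then obtain a' where a': "a = [:-x, 1:] * a'" by (auto simp: poly_eq_0_iff_dvd)
      have "f = Fraction_Field.Fract a' b'"
        unfolding f using \<open>b \<noteq> 0\<close> \<open>b' \<noteq> 0\<close> by (simp add: eq_fract a' b' del: mult_pCons_left)
      then have "b' \<in> S" using \<open>b' \<noteq> 0\<close> by (auto simp: S_def)
      moreover have "degree b = Suc (degree b')"
        unfolding b' using \<open>b' \<noteq> 0\<close> by (subst degree_mult_eq) auto
      ultimately show False using b(2)[of b'] by simp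
    qed
    have "filterlim z (at x) sequentially" using z by (intro filterlim_atI) auto
    then have "eventually (\<lambda>k. poly b (z k) \<noteq> 0) sequentially"
      by (rule eventually_compose_filterlim[OF eventually_poly_nonzero[OF \<open>b \<noteq> 0\<close>]])
    with bd have "eventually (\<lambda>k. \<bar>poly a (z k)\<bar> \<le> C * \<bar>poly b (z k)\<bar>) sequentially"
      by eventually_elim (simp add: f ratfun_eval_Fract abs_divide field_simps)
    moreover have "(\<lambda>k. \<bar>poly a (z k)\<bar>) \<longlonglongrightarrow> \<bar>poly a x\<bar>" "(\<lambda>k. C * \<bar>poly b (z k)\<bar>) \<longlonglongrightarrow> C * \<bar>poly b x\<bar>"
      by (intro tendsto_intros z)+
    ultimately have "\<bar>poly a x\<bar> \<le> C * \<bar>poly b x\<bar>"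
      using tendsto_le[OF trivial_limit_sequentially] by blast
    with a0 b0 show False by simp
  qed
  then show ?thesis unfolding f by (rule regular_at_Fract)
qed

section \<open>Inversion of matrices over the rational functions\<close>

lemma inverse_matrix_props:
  assumes P: "P \<in> carrier_mat n n" and "det P \<noteq> 0"
  shows "inverse_matrix P \<in> carrier_mat n n" "inverse_matrix P * P = 1\<^sub>m n" "P * inverse_matrix P = 1\<^sub>m n"
proof -
  have "P \<in> Units (ring_mat TYPE(ratfun) n undefined)" using assms by (rule det_non_zero_imp_unit)
  then obtain B where B: "mat_inverse P = Some B"
    using mat_inverse(1)[OF P, of undefined] by (cases "mat_inverse P") auto
  then show "inverse_matrix P \<in> carrier_mat n n" "inverse_matrix P * P = 1\<^sub>m n" "P * inverse_matrix P = 1\<^sub>m n"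
    using mat_inverse(2)[OF P B] by (auto simp: inverse_matrix_def)
qed

text \<open>Diagonal dominance measured by degrees. In a nonzero kernel vector of the transpose take
  an entry \<open>j\<close> of largest degree; in equation \<open>j\<close> the diagonal term has
  strictly larger degree than all others and cannot cancel.\<close>

lemma column_dominant_det:
  fixes p :: "nat \<Rightarrow> nat \<Rightarrow> real poly"
  assumes diag: "\<And>j. j < n \<Longrightarrow> p j j \<noteq> 0" "\<And>j. j < n \<Longrightarrow> degree (p j j) > 0"
    and off: "\<And>i j. i < n \<Longrightarrow> j < n \<Longrightarrow> i \<noteq> j \<Longrightarrow> degree (p i j) < degree (p j j)"
  shows "det (Matrix.mat n n (\<lambda>(i, j). p i j)) \<noteq> 0"
proof
  let ?A = "Matrix.mat n n (\<lambda>(i, j). p i j)"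
  assume "det ?A = 0"
  then have "det (transpose_mat ?A) = 0" by (subst det_transpose) auto
  then obtain v where v: "v \<in> carrier_vec n" "v \<noteq> 0\<^sub>v n" "transpose_mat ?A *\<^sub>v v = 0\<^sub>v n"
    by (subst (asm) det_0_iff_vec_prod_zero[of _ n]) auto
  have ker: "(\<Sum>i<n. p i j * vec_index v i) = 0" if "j < n" for j
  proof -
    have "vec_index (transpose_mat ?A *\<^sub>v v) j = (\<Sum>i<n. p i j * vec_index v i)"
      using that v(1) by (simp add: scalar_prod_def lessThan_atLeast0)
    then show ?thesis using v(3) that by simp
  qed
  define S where "S = {i. i < n \<and> vec_index v i \<noteq> 0}"
  have "S \<noteq> {}" using v(1,2) unfolding S_def by (auto simp: vec_eq_iff)
  moreover have "finite S" by (simp add: S_def)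
  ultimately have "Max ((\<lambda>i. degree (vec_index v i)) ` S) \<in> (\<lambda>i. degree (vec_index v i)) ` S"
    by (intro Max_in) auto
  then obtain j where j: "j \<in> S" "Max ((\<lambda>i. degree (vec_index v i)) ` S) = degree (vec_index v j)"
    by auto
  have jmax: "degree (vec_index v i) \<le> degree (vec_index v j)" if "i \<in> S" for i
    unfolding j(2)[symmetric] using \<open>finite S\<close> that by (intro Max_ge) auto
  have "j < n" "vec_index v j \<noteq> 0" using j(1) by (auto simp: S_def)
  have "p j j * vec_index v j = - (\<Sum>i\<in>{..<n} - {j}. p i j * vec_index v i)"
    using ker[OF \<open>j < n\<close>] \<open>j < n\<close> by (subst (asm) sum.remove[of _ j]) (auto simp: eq_neg_iff_add_eq_0)
  moreover have "degree (\<Sum>i\<in>{..<n} - {j}. p i j * vec_index v i) < degree (p j j) + degree (vec_index v j)"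
  proof (rule degree_sum_less)
    fix i assume i: "i \<in> {..<n} - {j}"
    show "degree (p i j * vec_index v i) < degree (p j j) + degree (vec_index v j)"
    \<comment> \<open>A vanishing entry gives the zero polynomial, of degree 0; this is below the
      bound because diagonal degrees are positive.\<close>
    proof (cases "vec_index v i = 0")
      case True
      then show ?thesis using diag(2)[OF \<open>j < n\<close>] by simp
    next
      case False
      then have "degree (vec_index v i) \<le> degree (vec_index v j)" using i jmax[of i] by (auto simp: S_def)
      moreover have "degree (p i j) < degree (p j j)" using off i \<open>j < n\<close> by auto
      ultimately show ?thesis using degree_mult_le[of "p i j" "vec_index v i"] by linarith
    qed
  qed (use diag(2)[OF \<open>j < n\<close>] in auto)
  moreover have "degree (p j j * vec_index v j) = degree (p j j) + degree (vec_index v j)"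
    using diag(1)[OF \<open>j < n\<close>] \<open>vec_index v j \<noteq> 0\<close> by (rule degree_mult_eq)
  ultimately show False by simp
qed

lemma det_ratfun_of_poly_nonzero:
  assumes "det (Matrix.mat n n (\<lambda>(i, j). p i j)) \<noteq> 0"
  shows "det (Matrix.mat n n (\<lambda>(i, j). ratfun_of_poly (p i j))) \<noteq> 0"
proof -
  interpret comm_ring_hom ratfun_of_poly by (rule comm_ring_hom_ratfun_of_poly)
  have "Matrix.mat n n (\<lambda>(i, j). ratfun_of_poly (p i j)) = mat_hom (Matrix.mat n n (\<lambda>(i, j). p i j))"
    by (intro eq_matI) auto
  then show ?thesis using assms by (simp add: ratfun_of_poly_eq_0_iff)
qed

text \<open>Evaluating \<open>N * P = 1\<close> at \<open>z\<close> uses that all entries of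
  \<open>N\<close> are regular there, which fails at finitely many points; hence the filter
  \<open>at x\<close>, which claims nothing at \<open>x\<close>. With the same right-hand side
  \<open>c\<close> in every equation, multiplying by \<open>N\<close> leaves only its row
  sums.\<close>

lemma inverse_row_sum_eval:
  fixes p :: "nat \<Rightarrow> nat \<Rightarrow> real poly" and n :: nat
  defines "P \<equiv> Matrix.mat n n (\<lambda>(i, j). ratfun_of_poly (p i j))"
  assumes det: "det P \<noteq> 0"
  shows "eventually (\<lambda>z. \<forall>g c. (\<forall>i<n. (\<Sum>j<n. poly (p i j) z * g j) = c) \<longrightarrow>
    (\<forall>i<n. g i = c * ratfun_eval (row_sum (inverse_matrix P) i) z)) (at x)"
proof -
  define N where "N = inverse_matrix P"
  have "P \<in> carrier_mat n n" by (simp add: P_def)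
  note inv = inverse_matrix_props[OF this det, folded N_def]
  have NP: "(\<Sum>k<n. N $$ (i, k) * ratfun_of_poly (p k j)) = (if i = j then 1 else 0)" if "i < n" "j < n" for i j
  proof -
    have "(N * P) $$ (i, j) = (\<Sum>k<n. N $$ (i, k) * ratfun_of_poly (p k j))"
      using that inv(1) by (simp add: scalar_prod_def lessThan_atLeast0 P_def)
    then show ?thesis using inv(2) that by simp
  qed
  have "eventually (\<lambda>z. \<forall>i\<in>{..<n}. \<forall>k\<in>{..<n}. regular_at (N $$ (i, k)) z) (at x)"
    by (intro eventually_ball_finite ballI eventually_regular_at) auto
  then show ?thesis
  proof eventually_elim
    case (elim z)
    show ?case
    proof (intro allI impI)
      fix g :: "nat \<Rightarrow> real" and c i
      assume g: "\<forall>i<n. (\<Sum>j<n. poly (p i j) z * g j) = c" and i: "i < n"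
      have rs: "ratfun_eval (row_sum N i) z = (\<Sum>k<n. ratfun_eval (N $$ (i, k)) z)"
        using elim i inv(1) regular_at_sum[of "{..<n}" "\<lambda>k. N $$ (i, k)" z] by (auto simp: row_sum_def)
      have ev: "(\<Sum>k<n. ratfun_eval (N $$ (i, k)) z * poly (p k j) z) = (if i = j then 1 else 0)" if "j < n" for j
      proof -
        have "(\<Sum>k<n. ratfun_eval (N $$ (i, k)) z * poly (p k j) z) =
            ratfun_eval (\<Sum>k<n. N $$ (i, k) * ratfun_of_poly (p k j)) z"
          using elim i regular_at_sum[of "{..<n}" "\<lambda>k. N $$ (i, k) * ratfun_of_poly (p k j)" z]
          by (simp add: regular_at_mult regular_at_of_poly)
        also have "\<dots> = (if i = j then 1 else 0)"
          unfolding NP[OF i that] using regular_at_of_poly(2)[of 1 z] regular_at_of_poly(2)[of 0 z]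
          by (simp add: ratfun_of_poly_hom)
        finally show ?thesis .
      qed
      have "g i = (\<Sum>j<n. if i = j then g j else 0)" using i by simp
      also have "\<dots> = (\<Sum>j<n. (\<Sum>k<n. ratfun_eval (N $$ (i, k)) z * poly (p k j) z) * g j)"
        by (intro sum.cong) (auto simp: ev)
      also have "\<dots> = (\<Sum>j<n. \<Sum>k<n. ratfun_eval (N $$ (i, k)) z * (poly (p k j) z * g j))"
        by (simp add: sum_distrib_right mult.assoc)
      also have "\<dots> = (\<Sum>k<n. ratfun_eval (N $$ (i, k)) z * (\<Sum>j<n. poly (p k j) z * g j))"
        by (subst sum.swap) (simp add: sum_distrib_left)
      also have "\<dots> = c * (\<Sum>k<n. ratfun_eval (N $$ (i, k)) z)"
        using g by (simp add: sum_distrib_left mult.commute)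
      finally show "g i = c * ratfun_eval (row_sum (inverse_matrix P) i) z"
        using rs by (simp add: N_def)
    qed
  qed
qed

section \<open>Correlation polynomials and the matrix P\<close>

text \<open>Reindexed by the number \<open>k\<close> of letters of \<open>u\<close> from the
  placement of \<open>v\<close> onwards. The factor z raises the exponent from \<open>k - 1\<close>
  to \<open>k\<close>, and \<open>min k (length v)\<close> allows for \<open>v\<close> ending before
  \<open>u\<close>.\<close>

lemma correlation_poly_shift:
  "[:0, 1:] * correlation_poly u v = (\<Sum>k=1..length u.
     if take (min k (length v)) (drop (length u - k) u) = take (min k (length v)) v then monom 1 k else 0)"
proof -
  have m: "[:0, 1:] * monom (c::real) n = monom c (Suc n)" for c n
    by (simp add: monom_Suc)
  have "[:0, 1:] * correlation_poly u v =
      (\<Sum>k<length u. monom (real (correlation u v ! k)) (Suc (length u - 1 - k)))"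
    unfolding correlation_poly_def sum_distrib_left m ..
  also have "\<dots> = (\<Sum>k=1..length u. monom (real (correlation u v ! (length u - k))) k)"
    by (rule sum.reindex_bij_witness[of _ "\<lambda>k. length u - k" "\<lambda>k. length u - k"]) (auto simp: Suc_diff_Suc)
  also have "\<dots> = (\<Sum>k=1..length u.
     if take (min k (length v)) (drop (length u - k) u) = take (min k (length v)) v then monom 1 k else 0)"
    by (intro sum.cong) (auto simp: correlation_def Let_def)
  finally show ?thesis .
qed

lemma overlap_poly_butlast:
  "overlap_poly u (butlast v) = (\<Sum>k\<in>{1..<min (length u) (length v)}.
     if take k v = drop (length u - k) u then monom 1 k else 0)"
proof -
  have "overlap_poly u (butlast v) = (\<Sum>k=1..length v - 1.
      if k < length u \<and> take k v = drop (length u - k) u then monom 1 k else 0)"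
    unfolding overlap_poly_def by (intro sum.cong) (auto simp: take_butlast)
  also have "\<dots> = (\<Sum>k\<in>{1..<min (length u) (length v)}.
      if k < length u \<and> take k v = drop (length u - k) u then monom 1 k else 0)"
    by (rule sum.mono_neutral_right) auto
  also have "\<dots> = (\<Sum>k\<in>{1..<min (length u) (length v)}.
     if take k v = drop (length u - k) u then monom 1 k else 0)"
    by (intro sum.cong) auto
  finally show ?thesis .
qed

lemma rev_overlap_iff:
  assumes "k \<le> length u" "k \<le> length v"
  shows "take k (rev v) = drop (length u - k) (rev u) \<longleftrightarrow> take k u = drop (length v - k) v"
  using assms by (auto simp: take_rev drop_rev)

text \<open>Reversal turns a suffix of \<open>u\<close> that is a prefix of \<open>v\<close> into a
  prefix of \<open>rev u\<close> that is a suffix of \<open>rev v\<close>, and the range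
  \<open>k < min (length u) (length v)\<close> is symmetric. This exchange of \<open>u\<close> and
  \<open>v\<close> is the source of the transpose in Q.\<close>

lemma overlap_poly_butlast_rev:
  "overlap_poly (rev u) (butlast (rev v)) = overlap_poly v (butlast u)"
  unfolding overlap_poly_butlast
  by (intro sum.cong) (auto simp: rev_overlap_iff[of _ u v] min.commute)

text \<open>Once the overlap reaches the full length of \<open>u\<close> or \<open>v\<close>, one
  word is contained in the other. For distinct patterns this is excluded, and for
  \<open>u = v\<close> only the trivial placement remains.\<close>

lemma correlation_poly_antichain:
  assumes "sublist v u \<Longrightarrow> u = v" "sublist u v \<Longrightarrow> u = v" "u \<noteq> []"
  shows "[:0, 1:] * correlation_poly u v =
    overlap_poly u (butlast v) + (if u = v then monom 1 (length u) else 0)"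
proof -
  let ?t = "\<lambda>k. if take k v = drop (length u - k) u then monom (1::real) k else 0"
  have "[:0, 1:] * correlation_poly u v = (\<Sum>k=1..length u.
     (if k < min (length u) (length v) then ?t k else 0) +
     (if k = length u then (if u = v then monom 1 (length u) else 0) else 0))"
    unfolding correlation_poly_shift
  proof (intro sum.cong refl)
    fix k assume k: "k \<in> {1..length u}"
    let ?c = "take (min k (length v)) (drop (length u - k) u) = take (min k (length v)) v"
    consider "k < length u" "k < length v" | "k = length u" "k < length v" | "length v \<le> k"
      using k by fastforce
    then show "(if ?c then monom 1 k else 0) =
      (if k < min (length u) (length v) then ?t k else 0) +
      (if k = length u then (if u = v then monom (1::real) (length u) else 0) else 0)"
    proof cases
      case 1
      then show ?thesis by auto
    next
      case 2
      then have "?c \<longleftrightarrow> u = take k v" by auto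
      moreover have "u \<noteq> take k v"
      proof
        assume "u = take k v"
        then have "sublist u v" using sublist_take by metis
        then show False using assms(2) 2 by auto
      qed
      ultimately show ?thesis using 2 by auto
    next
      case 3
      then have c: "?c \<longleftrightarrow> take (length v) (drop (length u - k) u) = v" by (simp add: min_absorb2)
      show ?thesis
      proof (cases "u = v")
        case True
        then show ?thesis using 3 k c by auto
      next
        case False
        have "\<not> ?c"
        proof
          assume ?c
          then have "sublist v u" using c by (metis sublist_drop sublist_order.order_trans sublist_take)
          then show False using False assms(1) by simp
        qed
        then show ?thesis using 3 False by auto
      qed
    qed
  qed
  also have "\<dots> = (\<Sum>k=1..length u. if k < min (length u) (length v) then ?t k else 0) +
     (if u = v then monom 1 (length u) else 0)"
    using assms(3) by (simp add: sum.distrib sum.delta Suc_le_eq)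
  also have "(\<Sum>k=1..length u. if k < min (length u) (length v) then ?t k else 0) = overlap_poly u (butlast v)"
    unfolding overlap_poly_butlast by (rule sum.mono_neutral_cong_right) auto
  finally show ?thesis .
qed

text \<open>Removing the first letter of \<open>u\<close> discards exactly the overlap of full
  length, and the length hypothesis lets \<open>X\<close> reach at least to the end of
  \<open>tl u\<close>. This is why the words in the formula for U_X are shortened.\<close>

lemma correlation_poly_tl:
  assumes "u \<noteq> []" "length u \<le> Suc (length X)"
  shows "[:0, 1:] * correlation_poly (tl u) X = overlap_poly u X"
proof -
  have "[:0, 1:] * correlation_poly (tl u) X = (\<Sum>k=1..length u - 1.
      if k < length u \<and> take k X = drop (length u - k) u then monom 1 k else 0)"
    unfolding correlation_poly_shift length_tl
  proof (intro sum.cong refl)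
    fix k assume k: "k \<in> {1..length u - 1}"
    then have "Suc (length u - 1 - k) = length u - k" by auto
    then have "drop (length u - 1 - k) (tl u) = drop (length u - k) u"
      by (metis drop_Suc)
    then show "(if take (min k (length X)) (drop (length u - 1 - k) (tl u)) = take (min k (length X)) X
        then monom 1 k else 0) =
      (if k < length u \<and> take k X = drop (length u - k) u then monom (1::real) k else 0)"
      using k assms by auto
  qed
  also have "\<dots> = overlap_poly u X"
    unfolding overlap_poly_def by (rule sum.mono_neutral_left) (use assms in auto)
  finally show ?thesis .
qed

text \<open>Here no letter has to be removed: an overlap of full length would put \<open>u\<close>
  inside \<open>X\<close>. The right-hand side is reversed because V_X arises from the reversed
  system.\<close>

lemma correlation_poly_right:
  assumes "\<not> sublist u X"
  shows "[:0, 1:] * correlation_poly X u = overlap_poly (rev u) (rev X)"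
  unfolding correlation_poly_shift overlap_poly_def length_rev
proof (intro sum.cong refl)
  fix k assume k: "k \<in> {1..length X}"
  show "(if take (min k (length u)) (drop (length X - k) X) = take (min k (length u)) u then monom 1 k else 0) =
    (if k < length u \<and> take k (rev X) = drop (length u - k) (rev u) then monom (1::real) k else 0)"
  proof (cases "k < length u")
    case True
    then show ?thesis using k rev_overlap_iff[of k u X] by auto
  next
    case False
    have "take (length u) (drop (length X - k) X) \<noteq> u"
      using assms by (metis sublist_drop sublist_order.order_trans sublist_take)
    then show ?thesis using False by (simp add: min_absorb2)
  qed
qed

section \<open>Repeated and forbidden words as a single family of patterns\<close>

definition pat :: "'a list list \<Rightarrow> ('a list \<times> nat) list \<Rightarrow> nat \<Rightarrow> 'a list" where
  "pat Fs R i = (if i < length R then fst (R ! i) else Fs ! (i - length R))"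

definition pat_mult :: "('a list \<times> nat) list \<Rightarrow> nat \<Rightarrow> real" where
  "pat_mult R i = (if i < length R then real (snd (R ! i)) else 0)"

text \<open>Multiplied by z, these are the diagonal entries of D(z).\<close>

definition pat_coeff :: "('a list \<times> nat) list \<Rightarrow> nat \<Rightarrow> real" where
  "pat_coeff R i = (if i < length R then mult_coeff R i else - 1)"

text \<open>The unknowns of the linear system with matrix \<open>P\<close> are the generating functions of
  \<^term>\<open>pattern_system.end_count\<close> multiplied by these factors.\<close>

definition pat_scale :: "('a list \<times> nat) list \<Rightarrow> nat \<Rightarrow> real" where
  "pat_scale R i = (if i < length R then real (snd (R ! i)) else 1)"

locale repeated_forbidden =
  fixes Fs :: "'a::finite list list" and R :: "('a list \<times> nat) list"
  assumes pat_antichain: "i < length R + length Fs \<Longrightarrow> j < length R + length Fs \<Longrightarrow>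
      sublist (pat Fs R i) (pat Fs R j) \<Longrightarrow> i = j"
    and pat_length: "i < length R + length Fs \<Longrightarrow> length (pat Fs R i) \<ge> 2"
    and mult_ge_2: "i < length R \<Longrightarrow> snd (R ! i) \<ge> 2"
begin

sublocale pattern_system "length R + length Fs" "pat Fs R" "pat_mult R"
  by standard (auto simp: pat_length pat_mult_def intro: pat_antichain)

abbreviation "K \<equiv> length R + length Fs"

lemma pat_mult_minus_1: "pat_mult R i - 1 = pat_coeff R i * pat_scale R i"
  using mult_ge_2[of i] by (auto simp: pat_mult_def pat_coeff_def pat_scale_def field_simps)

lemma pat_scale_pos: "pat_scale R i > 0"
  using mult_ge_2[of i] by (auto simp: pat_scale_def)

lemma pat_coeff_nonzero: "pat_coeff R i \<noteq> 0"
  using mult_ge_2[of i] by (auto simp: pat_coeff_def field_simps)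

text \<open>The trivial self-overlap contributes \<open>pat_coeff R j\<close> to the diagonal. For a
  repeated word the extra monomial in P changes this to (1 - 1/m) - 1 = -1/m, for a forbidden word
  it stays -1; both are \<open>- 1 / pat_scale R j\<close>. So the four blocks of P have one common
  form.\<close>

lemma P_entry_overlap:
  assumes "i < K" "j < K"
  shows "P_entry Fs R i j = Polynomial.smult (pat_coeff R j) (overlap_poly (pat Fs R j) (butlast (pat Fs R i)))
     - (if i = j then monom (1 / pat_scale R j) (length (pat Fs R j)) else 0)"
proof -
  have inj: "pat Fs R j = pat Fs R i \<longleftrightarrow> i = j"
    using pat_antichain[OF assms] by auto
  have corr: "[:0, 1:] * correlation_poly (pat Fs R j) (pat Fs R i) =
      overlap_poly (pat Fs R j) (butlast (pat Fs R i)) + (if i = j then monom 1 (length (pat Fs R j)) else 0)"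
    using correlation_poly_antichain[of "pat Fs R i" "pat Fs R j"] pat_antichain[OF assms]
      pat_antichain[OF assms(2,1)] pat_length[OF assms(2)] inj by fastforce
  have sm: "[:0, c:] * q = Polynomial.smult c ([:0, 1:] * q)" for c and q :: "real poly"
    by simp
  have "P_entry Fs R i j = Polynomial.smult (pat_coeff R j) ([:0, 1:] * correlation_poly (pat Fs R j) (pat Fs R i))
     - (if i = j \<and> i < length R then monom 1 (length (pat Fs R j)) else 0)"
    unfolding P_entry_def Let_def sm[of "mult_coeff R j"] using assms
    by (auto simp: pat_def pat_coeff_def simp del: mult_pCons_left)
  also have "\<dots> = Polynomial.smult (pat_coeff R j) (overlap_poly (pat Fs R j) (butlast (pat Fs R i)))
     - (if i = j then monom (1 / pat_scale R j) (length (pat Fs R j)) else 0)"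
  proof (cases "i = j")
    case True
    have "monom (pat_coeff R j) n - (if j < length R then monom 1 n else 0) = - monom (1 / pat_scale R j) n" for n
      using mult_ge_2[of j] by (auto simp: pat_coeff_def pat_scale_def diff_monom minus_monom)
    then show ?thesis using True unfolding corr
      by (simp add: smult_add_right smult_monom add_diff_eq[symmetric])
  qed (simp add: corr del: mult_pCons_left)
  finally show ?thesis .
qed

end

lemma degree_overlap_poly: "u \<noteq> [] \<Longrightarrow> degree (overlap_poly u v) < length u"
  unfolding overlap_poly_def by (rule degree_sum_less) (auto simp: degree_monom_eq)

lemma degree_diff_monom:
  assumes "degree p < n" "c \<noteq> 0"
  shows "degree (p - monom (c::real) n) = n" "p - monom c n \<noteq> 0"
proof -
  have "degree (- monom c n) = n" using assms by (simp add: degree_monom_eq)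
  then show "degree (p - monom c n) = n"
    using degree_add_eq_right[of p "- monom c n"] assms(1) by simp
  then show "p - monom c n \<noteq> 0" using assms by auto
qed

context repeated_forbidden
begin

text \<open>Column \<open>j\<close> collects proper overlaps of the \<open>j\<close>-th pattern, all
  shorter than the pattern, whereas the diagonal entry also carries a monomial of its full
  length.\<close>

lemma det_P_matrix: "det (P_matrix Fs R) \<noteq> 0"
proof -
  have ne: "pat Fs R j \<noteq> []" if "j < K" for j using pattern_nonempty[OF that] .
  have d: "degree (Polynomial.smult c (overlap_poly (pat Fs R j) v)) < length (pat Fs R j)" if "j < K" for j c v
    using le_less_trans[OF degree_smult_le degree_overlap_poly[OF ne[OF that]]] .
  have dg: "P_entry Fs R j j = Polynomial.smult (pat_coeff R j) (overlap_poly (pat Fs R j) (butlast (pat Fs R j)))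
     - monom (1 / pat_scale R j) (length (pat Fs R j))" if "j < K" for j
    using P_entry_overlap[OF that that] by simp
  have "1 / pat_scale R j \<noteq> 0" for j using pat_scale_pos[of j] by simp
  note deg = degree_diff_monom[OF d this]
  have "det (Matrix.mat K K (\<lambda>(i, j). P_entry Fs R i j)) \<noteq> 0"
  proof (rule column_dominant_det)
    fix j assume j: "j < K"
    show "P_entry Fs R j j \<noteq> 0" unfolding dg[OF j] by (rule deg(2)[OF j])
    show "degree (P_entry Fs R j j) > 0" unfolding dg[OF j] deg(1)[OF j] using pat_length[OF j] by linarith
    fix i assume i: "i < K" "i \<noteq> j"
    show "degree (P_entry Fs R i j) < degree (P_entry Fs R j j)"
      unfolding dg[OF j] deg(1)[OF j] using P_entry_overlap[OF i(1) j] d[OF j] i(2) by simp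
  qed
  then show ?thesis unfolding P_matrix_def by (rule det_ratfun_of_poly_nonzero)
qed

text \<open>Row \<open>i\<close> is \<open>end_gf_overlap\<close> for pattern \<open>i\<close>:
  \<open>pat_mult_minus_1\<close> distributes each factor between matrix and unknown, and on the
  diagonal \<open>pat_scale\<close> cancels.\<close>

lemma P_system:
  assumes z: "z > 0" "gf_summable (ext_count []) z" and i: "i < K"
  shows "(\<Sum>j<K. poly (P_entry Fs R i j) z * (pat_scale R j * gf (end_count j) z)) = - gf (ext_count []) z"
proof -
  have "(\<Sum>j<K. poly (P_entry Fs R i j) z * (pat_scale R j * gf (end_count j) z)) =
    (\<Sum>j<K. (pat_mult R j - 1) * (poly (overlap_poly (pat Fs R j) (butlast (pat Fs R i))) z * gf (end_count j) z)
      - (if i = j then z ^ length (pat Fs R i) * gf (end_count i) z else 0))"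
  proof (intro sum.cong refl)
    fix j assume "j \<in> {..<K}"
    then show "poly (P_entry Fs R i j) z * (pat_scale R j * gf (end_count j) z) =
      (pat_mult R j - 1) * (poly (overlap_poly (pat Fs R j) (butlast (pat Fs R i))) z * gf (end_count j) z)
      - (if i = j then z ^ length (pat Fs R i) * gf (end_count i) z else 0)"
      using i pat_scale_pos[of j]
      by (auto simp: P_entry_overlap pat_mult_minus_1 poly_monom algebra_simps)
  qed
  also have "\<dots> = (\<Sum>j<K. (pat_mult R j - 1) * (poly (overlap_poly (pat Fs R j) (butlast (pat Fs R i))) z * gf (end_count j) z))
      - z ^ length (pat Fs R i) * gf (end_count i) z"
    using i by (simp add: sum_subtractf)
  also have "\<dots> = - gf (ext_count []) z" using end_gf_overlap[OF z i] by simp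
  finally show ?thesis .
qed

lemma eventually_end_gf:
  "eventually (\<lambda>z. z > 0 \<longrightarrow> gf_summable (ext_count []) z \<longrightarrow>
     (\<forall>i<K. pat_scale R i * gf (end_count i) z = - gf (ext_count []) z * R_sum Fs R i z)) (at x)"
  using inverse_row_sum_eval[OF det_P_matrix[unfolded P_matrix_def], of x, folded P_matrix_def]
proof eventually_elim
  case (elim z)
  show ?case
  proof (intro impI)
    assume "z > 0" "gf_summable (ext_count []) z"
    then show "\<forall>i<K. pat_scale R i * gf (end_count i) z = - gf (ext_count []) z * R_sum Fs R i z"
      using elim[rule_format, of "\<lambda>j. pat_scale R j * gf (end_count j) z" "- gf (ext_count []) z"] P_system
      by (auto simp: R_sum_def)
  qed
qed

text \<open>The factor between \<open>gf (ext_count v)\<close> and \<open>gf (ext_count [])\<close>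
  for a pattern-free \<open>v\<close>, see \<open>eventually_ext_gf\<close>. It becomes U_X for
  \<open>v = X\<close>, and V_X in the reversed system for \<open>v = rev X\<close>.\<close>

definition overlap_form :: "real \<Rightarrow> 'a list \<Rightarrow> real" where
  "overlap_form z v = 1 - (\<Sum>j<K. pat_coeff R j * poly (overlap_poly (pat Fs R j) v) z * R_sum Fs R j z)"

lemma sum_patterns: "(\<Sum>j<K. h j) = (\<Sum>i<length R. h i) + (\<Sum>j<length Fs. h (length R + j))"
proof -
  have "(\<Sum>j<K. h j) = (\<Sum>j\<in>{0..<length R + length Fs}. h j)" by (simp add: lessThan_atLeast0)
  also have "\<dots> = (\<Sum>j\<in>{0..<length R}. h j) + (\<Sum>j\<in>{length R..<length R + length Fs}. h j)"
    by (rule sum.atLeastLessThan_concat[symmetric]) auto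
  also have "(\<Sum>j\<in>{length R..<length R + length Fs}. h j) = (\<Sum>j\<in>{0..<length Fs}. h (length R + j))"
    using sum.shift_bounds_nat_ivl[of h 0 "length R" "length Fs"] by (simp add: add.commute)
  finally show ?thesis by (simp add: lessThan_atLeast0)
qed

lemma R_total_sum: "R_total Fs R z = z * (\<Sum>j<K. pat_coeff R j * R_sum Fs R j z)"
  unfolding R_total_def sum_patterns by (simp add: pat_coeff_def sum_negf right_diff_distrib)

lemma U_vec_overlap_form:
  assumes "\<And>j. j < K \<Longrightarrow> length (pat Fs R j) \<le> Suc (length X)"
  shows "U_vec Fs R z X = overlap_form z X"
proof -
  have e: "z * poly (correlation_poly (tl (pat Fs R j)) X) z = poly (overlap_poly (pat Fs R j) X) z" if "j < K" for j
    using correlation_poly_tl[of "pat Fs R j" X] assms[OF that] pat_length[OF that]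
    by (metis (no_types, lifting) list.size(3) not_numeral_le_zero poly_mult poly_pCons poly_0 mult_zero_right
        add_0 add_0_right mult.right_neutral)
  have "overlap_form z X = 1 - (\<Sum>j<K. pat_coeff R j * (z * poly (correlation_poly (tl (pat Fs R j)) X) z) * R_sum Fs R j z)"
    unfolding overlap_form_def by (simp add: e)
  also have "\<dots> = U_vec Fs R z X"
    unfolding U_vec_def sum_patterns
    by (simp add: pat_coeff_def pat_def sum_distrib_left sum_negf algebra_simps)
  finally show ?thesis ..
qed

lemma eventually_ext_gf:
  "eventually (\<lambda>z. z > 0 \<longrightarrow> gf_summable (ext_count []) z \<longrightarrow> (\<forall>v. (\<forall>j<K. \<not> sublist (pat Fs R j) v) \<longrightarrow>
     gf (ext_count v) z = gf (ext_count []) z * overlap_form z v)) (at x)"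
  using eventually_end_gf[of x]
proof eventually_elim
  case (elim z)
  show ?case
  proof (intro impI allI)
    fix v assume z: "z > 0" "gf_summable (ext_count []) z" and v: "\<forall>j<K. \<not> sublist (pat Fs R j) v"
    have "(\<Sum>j<K. (pat_mult R j - 1) * (poly (overlap_poly (pat Fs R j) v) z * gf (end_count j) z)) =
      (\<Sum>j<K. pat_coeff R j * poly (overlap_poly (pat Fs R j) v) z * (pat_scale R j * gf (end_count j) z))"
      by (simp add: pat_mult_minus_1 mult_ac)
    also have "\<dots> = (\<Sum>j<K. pat_coeff R j * poly (overlap_poly (pat Fs R j) v) z * (- gf (ext_count []) z * R_sum Fs R j z))"
      using elim z by (intro sum.cong refl) auto
    also have "\<dots> = - gf (ext_count []) z * (\<Sum>j<K. pat_coeff R j * poly (overlap_poly (pat Fs R j) v) z * R_sum Fs R j z)"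
      by (simp add: sum_distrib_left mult_ac)
    finally show "gf (ext_count v) z = gf (ext_count []) z * overlap_form z v"
      using ext_gf_overlap[OF z] v by (simp add: overlap_form_def algebra_simps)
  qed
qed

lemma eventually_R_total:
  "eventually (\<lambda>z. z > 0 \<longrightarrow> gf_summable (ext_count []) z \<longrightarrow>
     gf (ext_count []) z * (z - real CARD('a) + R_total Fs R z) = z) (at x)"
  using eventually_end_gf[of x]
proof eventually_elim
  case (elim z)
  show ?case
  proof (intro impI)
    assume z: "z > 0" "gf_summable (ext_count []) z"
    have "(\<Sum>j<K. (pat_mult R j - 1) * gf (end_count j) z) =
      (\<Sum>j<K. pat_coeff R j * (pat_scale R j * gf (end_count j) z))"
      by (simp add: pat_mult_minus_1 mult_ac)
    also have "\<dots> = (\<Sum>j<K. pat_coeff R j * (- gf (ext_count []) z * R_sum Fs R j z))"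
      using elim z by (intro sum.cong refl) auto
    also have "\<dots> = - gf (ext_count []) z * (\<Sum>j<K. pat_coeff R j * R_sum Fs R j z)"
      by (simp add: sum_distrib_left mult_ac)
    finally show "gf (ext_count []) z * (z - real CARD('a) + R_total Fs R z) = z"
      using gf_ext_count_Nil[OF z] by (simp add: R_total_sum algebra_simps)
  qed
qed

text \<open>Once the row sums are regular at theta, the identities valid near theta pass to the
  limit: after multiplication by z - theta, \<open>overlap_form\<close> becomes a ratio of residues,
  and the scalar equation for F determines a derivative at theta.\<close>

lemma residue_formulas:
  fixes z :: "nat \<Rightarrow> real"
  assumes z: "z \<longlonglongrightarrow> \<theta>" "\<And>k. z k > \<theta>" and \<theta>: "\<theta> > 0"
    and sm: "\<And>z. z > \<theta> \<Longrightarrow> gf_summable (ext_count []) z"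
    and \<rho>: "(\<lambda>k. (z k - \<theta>) * gf (ext_count []) (z k)) \<longlonglongrightarrow> \<rho>" "\<rho> > 0"
  shows "\<lbrakk>\<And>j. j < K \<Longrightarrow> \<not> sublist (pat Fs R j) v; (\<lambda>k. (z k - \<theta>) * gf (ext_count v) (z k)) \<longlonglongrightarrow> l\<rbrakk> \<Longrightarrow>
      overlap_form \<theta> v = l / \<rho>"
    and "1 + deriv (R_total Fs R) \<theta> = \<theta> / \<rho>"
proof -
  let ?F = "\<lambda>k. gf (ext_count []) (z k)"
  have fl: "filterlim z (at \<theta>) sequentially"
    using z by (intro filterlim_atI) (auto simp: less_imp_neq[symmetric])
  have z0: "z k > 0" "gf_summable (ext_count []) (z k)" for k
    using z(2)[of k] \<theta> sm by auto
  have Fpos: "eventually (\<lambda>k. ?F k > 0) sequentially"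
    using order_tendstoD(1)[OF \<rho>]
    by eventually_elim (use z(2) in \<open>auto simp: zero_less_mult_iff dest: order.asym\<close>)
  \<comment> \<open>Up to a scale factor, \<open>- F * R_i\<close> is the series of an end count,
    which lies between 0 and a constant times F; dividing by F > 0 bounds R_i along the
    sequence.\<close>
  have reg: "regular_at (row_sum (inverse_matrix (P_matrix Fs R)) i) \<theta>" if i: "i < K" for i
  proof (rule bounded_imp_regular_at[OF z(1)])
    show "z k \<noteq> \<theta>" for k using z(2)[of k] by simp
    let ?C = "pat_scale R i * real CARD('a) / \<theta>"
    show "eventually (\<lambda>k. \<bar>ratfun_eval (row_sum (inverse_matrix (P_matrix Fs R)) i) (z k)\<bar> \<le> ?C) sequentially"
      using Fpos eventually_compose_filterlim[OF eventually_end_gf fl]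
    proof eventually_elim
      case (elim k)
      then have eq: "pat_scale R i * gf (end_count i) (z k) = - ?F k * R_sum Fs R i (z k)" using i z0 by blast
      have g: "0 \<le> gf (end_count i) (z k)"
        using z0 by (intro gf_nonneg end_count_nonneg end_count_summable) auto
      have "?F k * \<bar>R_sum Fs R i (z k)\<bar> = \<bar>- ?F k * R_sum Fs R i (z k)\<bar>"
        using elim(1) by (simp add: abs_mult)
      also have "\<dots> = pat_scale R i * gf (end_count i) (z k)"
        unfolding eq[symmetric] using g pat_scale_pos[of i] by simp
      also have "\<dots> \<le> pat_scale R i * (real CARD('a) / z k * ?F k)"
        using pat_scale_pos[of i] end_gf_le[OF z0 i] by (intro mult_left_mono) auto
      also have "\<dots> \<le> pat_scale R i * (real CARD('a) / \<theta> * ?F k)"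
        using pat_scale_pos[of i] elim(1) \<theta> z(2)[of k]
        by (intro mult_left_mono mult_right_mono divide_left_mono) auto
      also have "\<dots> = ?F k * ?C" by simp
      finally have "\<bar>R_sum Fs R i (z k)\<bar> \<le> ?C" using elim(1) by (rule mult_left_le_imp_le)
      then show ?case by (simp add: R_sum_def)
    qed
  qed
  have R_tendsto: "(\<lambda>k. R_sum Fs R i (z k)) \<longlonglongrightarrow> R_sum Fs R i \<theta>" if "i < K" for i
    unfolding R_sum_def by (rule ratfun_eval_tendsto[OF reg[OF that] z(1)])
  {
    assume v: "\<And>j. j < K \<Longrightarrow> \<not> sublist (pat Fs R j) v"
      and l: "(\<lambda>k. (z k - \<theta>) * gf (ext_count v) (z k)) \<longlonglongrightarrow> l"
    have "(\<lambda>k. (z k - \<theta>) * ?F k * overlap_form (z k) v) \<longlonglongrightarrow> \<rho> * overlap_form \<theta> v"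
      unfolding overlap_form_def by (intro tendsto_intros \<rho> R_tendsto z(1)) auto
    moreover have "eventually (\<lambda>k. (z k - \<theta>) * ?F k * overlap_form (z k) v = (z k - \<theta>) * gf (ext_count v) (z k)) sequentially"
      using eventually_compose_filterlim[OF eventually_ext_gf fl]
      by eventually_elim (use z0 v in auto)
    ultimately have "(\<lambda>k. (z k - \<theta>) * gf (ext_count v) (z k)) \<longlonglongrightarrow> \<rho> * overlap_form \<theta> v"
      by (rule Lim_transform_eventually)
    then have "l = \<rho> * overlap_form \<theta> v" using l LIMSEQ_unique by blast
    then show "overlap_form \<theta> v = l / \<rho>" using \<rho>(2) by simp
  }
  \<comment> \<open>Since F H = z and (z - theta) F tends to rho, the quotient
    \<open>H (z k) / (z k - \<theta>)\<close> tends to theta / rho. This forces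
    \<open>H \<theta> = 0\<close>, so the quotient is a difference quotient of \<open>H\<close> and
    its limit is the derivative.\<close>
  define H where "H x = x - real CARD('a) + R_total Fs R x" for x
  have "R_sum Fs R j differentiable (at \<theta>)" if "j < K" for j
    unfolding R_sum_def by (rule ratfun_eval_differentiable[OF reg[OF that]])
  then have diff: "R_total Fs R differentiable (at \<theta>)"
    unfolding R_total_sum[abs_def] by (intro derivative_intros) auto
  then have Rd: "(R_total Fs R has_real_derivative deriv (R_total Fs R) \<theta>) (at \<theta>)"
    using DERIV_deriv_iff_real_differentiable by blast
  then have Hd: "(H has_real_derivative 1 + deriv (R_total Fs R) \<theta>) (at \<theta>)"
    unfolding H_def by (auto intro!: derivative_eq_intros)
  have HF: "eventually (\<lambda>k. z k / ((z k - \<theta>) * ?F k) = H (z k) / (z k - \<theta>)) sequentially"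
    using Fpos eventually_compose_filterlim[OF eventually_R_total fl]
  proof eventually_elim
    case (elim k)
    then have "?F k * H (z k) = z k" using z0 by (auto simp: H_def)
    then have "z k / ((z k - \<theta>) * ?F k) = (?F k * H (z k)) / (?F k * (z k - \<theta>))" by (simp add: mult.commute)
    then show ?case using elim(1) by simp
  qed
  have "(\<lambda>k. z k / ((z k - \<theta>) * ?F k)) \<longlonglongrightarrow> \<theta> / \<rho>"
    by (intro tendsto_intros z(1) \<rho>) (use \<rho>(2) in auto)
  then have quot: "(\<lambda>k. H (z k) / (z k - \<theta>)) \<longlonglongrightarrow> \<theta> / \<rho>"
    using HF by (rule Lim_transform_eventually)
  have "(\<lambda>k. H (z k) / (z k - \<theta>) * (z k - \<theta>)) \<longlonglongrightarrow> \<theta> / \<rho> * (\<theta> - \<theta>)"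
    by (intro tendsto_intros quot z(1))
  moreover have "H (z k) / (z k - \<theta>) * (z k - \<theta>) = H (z k)" for k using z(2)[of k] by simp
  ultimately have "(\<lambda>k. H (z k)) \<longlonglongrightarrow> 0" by simp
  moreover have "(\<lambda>k. H (z k)) \<longlonglongrightarrow> H \<theta>"
    by (rule isCont_tendsto_compose[OF DERIV_isCont[OF Hd] z(1)])
  ultimately have H0: "H \<theta> = 0" using LIMSEQ_unique by blast
  have "((\<lambda>x. (H x - H \<theta>) / (x - \<theta>)) \<longlongrightarrow> 1 + deriv (R_total Fs R) \<theta>) (at \<theta>)"
    using Hd by (simp add: has_field_derivative_iff)
  from filterlim_compose[OF this fl] have "(\<lambda>k. H (z k) / (z k - \<theta>)) \<longlonglongrightarrow> 1 + deriv (R_total Fs R) \<theta>"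
    by (simp add: H0)
  then show "1 + deriv (R_total Fs R) \<theta> = \<theta> / \<rho>" using quot LIMSEQ_unique by blast
qed

end

section \<open>Reversed patterns and the matrix Q\<close>

definition rev_patterns :: "('a list \<times> nat) list \<Rightarrow> ('a list \<times> nat) list" where
  "rev_patterns R = map (\<lambda>(r, m). (rev r, m)) R"

lemma length_rev_patterns [simp]: "length (rev_patterns R) = length R"
  by (simp add: rev_patterns_def)

lemma snd_rev_patterns: "i < length R \<Longrightarrow> snd (rev_patterns R ! i) = snd (R ! i)"
  by (simp add: rev_patterns_def split: prod.split)

lemma pat_rev: "i < length R + length Fs \<Longrightarrow> pat (map rev Fs) (rev_patterns R) i = rev (pat Fs R i)"
  by (auto simp: pat_def rev_patterns_def split: prod.split)

lemma pat_mult_rev: "pat_mult (rev_patterns R) i = pat_mult R i"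
  by (simp add: pat_mult_def snd_rev_patterns)

lemma pat_coeff_rev: "pat_coeff (rev_patterns R) i = pat_coeff R i"
  by (simp add: pat_coeff_def snd_rev_patterns)

lemma pat_scale_rev: "pat_scale (rev_patterns R) i = pat_scale R i"
  by (simp add: pat_scale_def snd_rev_patterns)

lemma sublist_rev: "sublist (rev u) (rev v) \<longleftrightarrow> sublist u v"
proof -
  have "sublist (rev u) (rev v)" if s: "sublist u v" for u v :: "'b list"
  proof -
    obtain a b where "v = a @ u @ b" using s unfolding sublist_def by blast
    then have "rev v = rev b @ rev u @ rev a" by simp
    then show ?thesis unfolding sublist_def by blast
  qed
  from this[of u v] this[of "rev u" "rev v"] show ?thesis by auto
qed

text \<open>Kept apart from \<open>repeated_forbidden\<close> so that the reversed instance is not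
  itself reversed again without end.\<close>

locale reversible_patterns = repeated_forbidden
begin

sublocale reversed: repeated_forbidden "map rev Fs" "rev_patterns R"
  by standard (auto simp: pat_rev sublist_rev snd_rev_patterns pat_antichain pat_length mult_ge_2)

lemma reversed_weight: "reversed.weight (rev u) = weight u"
  unfolding reversed.weight_def weight_def
  by (intro prod.cong) (auto simp: pat_rev pat_mult_rev occurrences_rev pattern_nonempty)

lemma reversed_ext_count: "reversed.ext_count (rev v) n = (\<Sum>u\<in>words n. weight (v @ u))"
proof -
  have "reversed.ext_count (rev v) n = (\<Sum>u\<in>words n. reversed.weight (rev u @ rev v))"
    unfolding reversed.ext_count_def by (rule sum_words_rev[symmetric])
  also have "\<dots> = (\<Sum>u\<in>words n. weight (v @ u))"
    by (intro sum.cong refl) (metis reversed_weight rev_append)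
  finally show ?thesis .
qed

lemma reversed_ext_count_Nil: "reversed.ext_count [] = ext_count []"
  using reversed_ext_count[of "[]"] by (auto simp: ext_count_def)

text \<open>Let P' be the matrix of the reversed patterns and c_i = \<open>pat_coeff R i\<close>. By
  \<open>overlap_poly_butlast_rev\<close>, entry (i, j) of both D P' and P^T D is z c_i c_j times
  the overlap polynomial of pattern i with the shortened pattern j, up to the same diagonal term. It
  remains to cancel D, which is invertible because every c_i is nonzero.\<close>

lemma Q_matrix_eq: "Q_matrix Fs R = P_matrix (map rev Fs) (rev_patterns R)"
proof -
  define dd where "dd = (\<lambda>i. ratfun_of_poly (if i < length R then [:0, mult_coeff R i:] else - [:0, 1:]))"
  have D: "D_matrix Fs R = mat_diag K dd" by (simp add: D_matrix_def dd_def)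
  have dd: "dd i = ratfun_of_poly [:0, pat_coeff R i:]" for i by (simp add: dd_def pat_coeff_def)
  have ddnz: "dd i \<noteq> 0" for i
    unfolding dd ratfun_of_poly_eq_0_iff using pat_coeff_nonzero[of i] by simp
  let ?P = "P_matrix Fs R" and ?P' = "P_matrix (map rev Fs) (rev_patterns R)"
  have c: "?P \<in> carrier_mat K K" "?P' \<in> carrier_mat K K" "D_matrix Fs R \<in> carrier_mat K K"
    by (auto simp: P_matrix_def D)
  have "det (D_matrix Fs R) = prod_list (diag_mat (D_matrix Fs R))"
    by (rule det_upper_triangular[OF _ c(3)]) (auto simp: D mat_diag_def)
  also have "\<dots> \<noteq> 0"
    by (auto simp: prod_list_zero_iff diag_mat_def D mat_diag_def ddnz)
  finally have det: "det (D_matrix Fs R) \<noteq> 0" .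
  have "D_matrix Fs R * ?P' = transpose_mat ?P * D_matrix Fs R"
  proof (rule eq_matI)
    fix i j assume "i < dim_row (transpose_mat ?P * D_matrix Fs R)" "j < dim_col (transpose_mat ?P * D_matrix Fs R)"
    then have ij: "i < K" "j < K" by (auto simp: P_matrix_def D mat_diag_def)
    have "(D_matrix Fs R * ?P') $$ (i, j) = dd i * ?P' $$ (i, j)"
      unfolding D using ij by (subst mat_diag_mult_left[OF c(2)]) simp
    also have "\<dots> = ratfun_of_poly ([:0, pat_coeff R i:] * P_entry (map rev Fs) (rev_patterns R) i j)"
      using ij by (simp add: dd P_matrix_def ratfun_of_poly_hom del: mult_pCons_left)
    also have "[:0, pat_coeff R i:] * P_entry (map rev Fs) (rev_patterns R) i j =
      P_entry Fs R j i * [:0, pat_coeff R j:]"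
    proof -
      have sm: "[:0, c:] = Polynomial.smult c [:0, 1:]" for c :: real by simp
      show ?thesis
        unfolding sm[of "pat_coeff R i"] sm[of "pat_coeff R j"]
        using ij by (simp add: P_entry_overlap reversed.P_entry_overlap pat_rev pat_coeff_rev pat_scale_rev
            overlap_poly_butlast_rev smult_diff_right mult.commute del: mult_pCons_left mult_pCons_right smult_pCons butlast_rev)
    qed
    also have "ratfun_of_poly (P_entry Fs R j i * [:0, pat_coeff R j:]) = transpose_mat ?P $$ (i, j) * dd j"
      using ij by (simp add: dd P_matrix_def ratfun_of_poly_hom del: mult_pCons_right)
    also have "\<dots> = (transpose_mat ?P * D_matrix Fs R) $$ (i, j)"
      unfolding D using ij c(1) by (subst mat_diag_mult_right[of _ K]) auto
    finally show "(D_matrix Fs R * ?P') $$ (i, j) = (transpose_mat ?P * D_matrix Fs R) $$ (i, j)" .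
  qed (use c in auto)
  then have "Q_matrix Fs R = inverse_matrix (D_matrix Fs R) * (D_matrix Fs R * ?P')"
    unfolding Q_matrix_def using c inverse_matrix_props(1)[OF c(3) det] 
    by (subst assoc_mult_mat[of _ K K _ K _ K]) auto
  also have "\<dots> = ?P'"
    using c inverse_matrix_props[OF c(3) det] by (subst assoc_mult_mat[of _ K K _ K _ K, symmetric]) auto
  finally show ?thesis .
qed

lemma V_vec_overlap_form:
  assumes "\<And>j. j < K \<Longrightarrow> \<not> sublist (pat Fs R j) X"
  shows "V_vec Fs R z X = reversed.overlap_form z (rev X)"
proof -
  have S: "S_sum Fs R j = R_sum (map rev Fs) (rev_patterns R) j" for j
    by (simp add: S_sum_def R_sum_def Q_matrix_eq)
  have e: "z * poly (correlation_poly X (pat Fs R j)) z = poly (overlap_poly (rev (pat Fs R j)) (rev X)) z" if "j < K" for j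
    using arg_cong[OF correlation_poly_right[OF assms[OF that]], of "\<lambda>p. poly p z"] by simp
  have "reversed.overlap_form z (rev X) =
      1 - (\<Sum>j<K. pat_coeff R j * (z * poly (correlation_poly X (pat Fs R j)) z) * S_sum Fs R j z)"
    unfolding reversed.overlap_form_def by (simp add: e S pat_coeff_rev pat_rev)
  also have "\<dots> = V_vec Fs R z X"
    unfolding V_vec_def sum_patterns
    by (simp add: pat_coeff_def pat_def sum_distrib_left sum_negf algebra_simps)
  finally show ?thesis ..
qed

end

section \<open>Residues and Perron eigenvectors\<close>

lemma bounded_family_subseq:
  fixes f :: "'i \<Rightarrow> nat \<Rightarrow> real"
  assumes "finite I" "\<And>i. i \<in> I \<Longrightarrow> bounded (range (f i))"
  shows "\<exists>r. strict_mono (r :: nat \<Rightarrow> nat) \<and> (\<forall>i\<in>I. convergent (f i \<circ> r))"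
  using assms
proof (induction I rule: finite_induct)
  case empty
  show ?case by (intro exI[of _ id]) (auto simp: strict_mono_def)
next
  case (insert i I)
  then obtain r where r: "strict_mono (r :: nat \<Rightarrow> nat)" "\<forall>i\<in>I. convergent (f i \<circ> r)"
    using insert.IH insert.prems by blast
  have "bounded (range (f i \<circ> r))"
    by (rule bounded_subset[OF insert.prems[of i]]) auto
  then obtain l s where s: "strict_mono (s :: nat \<Rightarrow> nat)" "(f i \<circ> r \<circ> s) \<longlonglongrightarrow> l"
    using bounded_imp_convergent_subsequence[of "f i \<circ> r"] by blast
  show ?case
  proof (intro exI[of _ "r \<circ> s"] conjI ballI)
    show "strict_mono (r \<circ> s)" using r(1) s(1) by (rule strict_mono_o)
    fix j assume "j \<in> insert i I"
    then show "convergent (f j \<circ> (r \<circ> s))"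
      using s r(2) convergent_subseq_convergent[OF _ s(1), of "f j \<circ> r"]
      by (auto simp: o_assoc convergentI)
  qed
qed

text \<open>\<open>h X n\<close> stands for a weighted count of words ending, or beginning, with
  \<open>X\<close>. The threshold \<open>N\<close> leaves room for words that cannot be continued.
  The positive eigenvector \<open>u\<close> yields the growth bound directly, without a spectral
  decomposition.\<close>

locale transfer_sequence =
  fixes I :: "'i set" and B :: "'i \<Rightarrow> 'i \<Rightarrow> real" and u :: "'i \<Rightarrow> real" and \<theta> :: real
    and h :: "'i \<Rightarrow> nat \<Rightarrow> real" and N :: nat
  assumes fin: "finite I"
    and B_nonneg: "X \<in> I \<Longrightarrow> Y \<in> I \<Longrightarrow> B X Y \<ge> 0"
    and u_pos: "X \<in> I \<Longrightarrow> u X > 0"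
    and u_eigen: "Y \<in> I \<Longrightarrow> (\<Sum>X\<in>I. u X * B X Y) = \<theta> * u Y"
    and \<theta>_pos: "\<theta> > 0"
    and h_nonneg: "X \<in> I \<Longrightarrow> h X n \<ge> 0"
    and h_rec: "Y \<in> I \<Longrightarrow> n \<ge> N \<Longrightarrow> h Y (Suc n) = (\<Sum>X\<in>I. h X n * B X Y)"
begin

text \<open>A bound \<open>h X n \<le> C * u X * \<theta> ^ n\<close> reproduces itself under the
  recurrence because \<open>u\<close> is an eigenvector for theta.\<close>

lemma h_upper: "\<exists>C \<ge> 0. \<forall>X\<in>I. \<forall>n. h X n \<le> C * \<theta> ^ n"
proof -
  \<comment> \<open>A sum of nonnegative ratios over all \<open>X\<close> and all
    \<open>n \<le> N\<close> dominates each of them, which settles every index up to the start of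
    the recurrence.\<close>
  define C where "C = (\<Sum>X\<in>I. \<Sum>n\<le>N. h X n / (u X * \<theta> ^ n))"
  have C: "h X n / (u X * \<theta> ^ n) \<le> C" if "X \<in> I" "n \<le> N" for X n
  proof -
    have "h X n / (u X * \<theta> ^ n) \<le> (\<Sum>n\<le>N. h X n / (u X * \<theta> ^ n))"
      using that u_pos[OF that(1)] \<theta>_pos h_nonneg[OF that(1)]
      by (intro member_le_sum) (auto intro!: divide_nonneg_nonneg mult_nonneg_nonneg simp: less_imp_le)
    also have "\<dots> \<le> C" unfolding C_def
      using fin that u_pos \<theta>_pos h_nonneg
      by (intro member_le_sum[where f = "\<lambda>X. \<Sum>n\<le>N. h X n / (u X * \<theta> ^ n)"])
        (auto intro!: sum_nonneg divide_nonneg_nonneg mult_nonneg_nonneg simp: less_imp_le)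
    finally show ?thesis .
  qed
  have C0: "C \<ge> 0" unfolding C_def
    using u_pos \<theta>_pos h_nonneg
    by (auto intro!: sum_nonneg divide_nonneg_nonneg mult_nonneg_nonneg simp: less_imp_le)
  have *: "h X n \<le> C * u X * \<theta> ^ n" if "X \<in> I" for X n
    using that
  proof (induction n arbitrary: X)
    case 0
    then show ?case using C[of X 0] u_pos[of X] by (simp add: field_simps)
  next
    case (Suc n)
    show ?case
    proof (cases "n \<ge> N")
      case True
      have "h X (Suc n) = (\<Sum>Y\<in>I. h Y n * B Y X)" using h_rec Suc.prems True by blast
      also have "\<dots> \<le> (\<Sum>Y\<in>I. C * u Y * \<theta> ^ n * B Y X)"
        using Suc B_nonneg by (intro sum_mono mult_right_mono) auto
      also have "\<dots> = C * \<theta> ^ n * (\<Sum>Y\<in>I. u Y * B Y X)"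
        by (simp add: sum_distrib_left algebra_simps)
      also have "\<dots> = C * u X * \<theta> ^ Suc n" using u_eigen[OF Suc.prems] by simp
      finally show ?thesis .
    next
      case False
      then show ?thesis using C[of X "Suc n"] u_pos[of X] \<theta>_pos Suc.prems by (simp add: field_simps)
    qed
  qed
  define D where "D = C * (\<Sum>X\<in>I. u X)"
  have "D \<ge> 0" unfolding D_def using C0 u_pos by (intro mult_nonneg_nonneg sum_nonneg) (auto simp: less_imp_le)
  moreover have "h X n \<le> D * \<theta> ^ n" if "X \<in> I" for X n
  proof -
    have "u X \<le> (\<Sum>X\<in>I. u X)" using that fin u_pos by (intro member_le_sum) (auto simp: less_imp_le)
    then have "C * u X * \<theta> ^ n \<le> D * \<theta> ^ n"
      unfolding D_def using C0 \<theta>_pos by (intro mult_right_mono mult_left_mono) auto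
    with *[OF that, of n] show ?thesis by simp
  qed
  ultimately show ?thesis by blast
qed

lemma h_summable: "X \<in> I \<Longrightarrow> z > \<theta> \<Longrightarrow> gf_summable (h X) z"
proof -
  assume a: "X \<in> I" "z > \<theta>"
  obtain C where C: "\<forall>X\<in>I. \<forall>n. h X n \<le> C * \<theta> ^ n" using h_upper by blast
  show ?thesis
    by (rule gf_summable_le[where N = 0, OF _ _ _ gf_geometric(1)[of \<theta> z C]])
      (use a C h_nonneg \<theta>_pos in auto)
qed

lemma gf_upper: "\<exists>C \<ge> 0. \<forall>X\<in>I. \<forall>z>\<theta>. (z - \<theta>) * gf (h X) z \<le> C * z"
proof -
  obtain C where C: "C \<ge> 0" "\<forall>X\<in>I. \<forall>n. h X n \<le> C * \<theta> ^ n" using h_upper by blast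
  have "(z - \<theta>) * gf (h X) z \<le> C * z" if "X \<in> I" "z > \<theta>" for X z
  proof -
    have "gf (h X) z \<le> gf (\<lambda>n. C * \<theta> ^ n) z"
      by (rule gf_mono) (use that C h_summable \<theta>_pos gf_geometric(1)[of \<theta> z C] in auto)
    also have "\<dots> = C * z / (z - \<theta>)" using gf_geometric(2)[of \<theta> z C] that \<theta>_pos by simp
    finally show ?thesis using that by (simp add: field_simps)
  qed
  with C show ?thesis by blast
qed

text \<open>The recurrence can fail for at most \<open>N\<close> indices, so the right-hand side
  stays bounded near theta and disappears in the limit after multiplication by z - theta. For
  \<open>N = 0\<close> it is just \<open>z * h Y 0\<close>, which later fixes a scalar.\<close>

lemma gf_rec:
  assumes "Y \<in> I" "z > \<theta>"
  shows "z * gf (h Y) z - (\<Sum>X\<in>I. gf (h X) z * B X Y) =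
    z * h Y 0 + (\<Sum>n<N. (h Y (Suc n) - (\<Sum>X\<in>I. h X n * B X Y)) / z ^ n)"
proof -
  have z: "z > 0" using assms \<theta>_pos by simp
  let ?d = "\<lambda>n. h Y (Suc n) - (\<Sum>X\<in>I. h X n * B X Y)"
  have s1: "gf_summable (\<lambda>n. h Y (Suc n)) z"
    using gf_summable_shift_iff[OF z, of "h Y" 1] h_summable[OF assms] by simp
  have s2: "gf_summable (\<lambda>n. \<Sum>X\<in>I. B X Y * h X n) z"
    by (intro gf_summable_sum gf_summable_cmult h_summable assms)
  have "gf ?d z = gf (\<lambda>n. h Y (Suc n) + (-1) * (\<Sum>X\<in>I. B X Y * h X n)) z"
    by (intro arg_cong2[where f = gf]) (auto simp: mult.commute)
  also have "\<dots> = gf (\<lambda>n. h Y (Suc n)) z + gf (\<lambda>n. (-1) * (\<Sum>X\<in>I. B X Y * h X n)) z"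
    by (intro gf_add s1 s2 gf_summable_cmult)
  also have "gf (\<lambda>n. (-1) * (\<Sum>X\<in>I. B X Y * h X n)) z = (-1) * gf (\<lambda>n. \<Sum>X\<in>I. B X Y * h X n) z"
    by (intro gf_cmult s2)
  also have "gf (\<lambda>n. \<Sum>X\<in>I. B X Y * h X n) z = (\<Sum>X\<in>I. gf (\<lambda>n. B X Y * h X n) z)"
    by (intro gf_sum gf_summable_cmult h_summable assms)
  also have "\<dots> = (\<Sum>X\<in>I. gf (h X) z * B X Y)"
    using assms by (intro sum.cong refl) (simp add: gf_cmult h_summable mult.commute)
  also have "gf (\<lambda>n. h Y (Suc n)) z = z * (gf (h Y) z - h Y 0)"
    using gf_shift[OF z h_summable[OF assms], of 1] by simp
  finally have "gf ?d z = z * (gf (h Y) z - h Y 0) + (-1) * (\<Sum>X\<in>I. gf (h X) z * B X Y)" .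
  moreover have "gf ?d z = (\<Sum>n<N. ?d n / z ^ n)"
    unfolding gf_def using h_rec[OF assms(1)] by (intro suminf_finite) auto
  ultimately show ?thesis by (simp add: algebra_simps)
qed

lemma limit_eigenvector:
  fixes z :: "nat \<Rightarrow> real"
  assumes z: "z \<longlonglongrightarrow> \<theta>" "\<And>k. z k > \<theta>"
    and lim: "\<And>X. X \<in> I \<Longrightarrow> (\<lambda>k. (z k - \<theta>) * gf (h X) (z k)) \<longlonglongrightarrow> l X"
    and Y: "Y \<in> I"
  shows "\<theta> * l Y = (\<Sum>X\<in>I. l X * B X Y)"
proof -
  let ?p = "\<lambda>z. z * h Y 0 + (\<Sum>n<N. (h Y (Suc n) - (\<Sum>X\<in>I. h X n * B X Y)) / z ^ n)"
  have "(\<lambda>k. (z k - \<theta>) * ?p (z k)) \<longlonglongrightarrow> (\<theta> - \<theta>) * ?p \<theta>"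
    by (intro tendsto_intros z(1)) (use \<theta>_pos in auto)
  then have lim1: "(\<lambda>k. (z k - \<theta>) * ?p (z k)) \<longlonglongrightarrow> 0" by simp
  have "(\<lambda>k. z k * ((z k - \<theta>) * gf (h Y) (z k)) - (\<Sum>X\<in>I. (z k - \<theta>) * gf (h X) (z k) * B X Y))
     \<longlonglongrightarrow> \<theta> * l Y - (\<Sum>X\<in>I. l X * B X Y)"
    by (intro tendsto_intros z(1) lim Y)
  moreover have "z k * ((z k - \<theta>) * gf (h Y) (z k)) - (\<Sum>X\<in>I. (z k - \<theta>) * gf (h X) (z k) * B X Y)
     = (z k - \<theta>) * ?p (z k)" for k
    unfolding gf_rec[OF Y z(2)[of k], symmetric]
    by (simp add: right_diff_distrib sum_distrib_left mult.assoc mult.left_commute)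
  ultimately have "(\<lambda>k. (z k - \<theta>) * ?p (z k)) \<longlonglongrightarrow> \<theta> * l Y - (\<Sum>X\<in>I. l X * B X Y)"
    by simp
  from LIMSEQ_unique[OF this lim1] show ?thesis by simp
qed

end

text \<open>Subtracting the largest multiple of \<open>u\<close> below \<open>l\<close> leaves a nonnegative eigenvector with a
  zero entry, which irreducibility spreads everywhere.\<close>

lemma positive_eigenvector_unique:
  fixes B :: "'i \<Rightarrow> 'i \<Rightarrow> real"
  assumes fin: "finite I" and B: "\<And>X Y. X \<in> I \<Longrightarrow> Y \<in> I \<Longrightarrow> B X Y \<ge> 0"
    and u: "\<And>X. X \<in> I \<Longrightarrow> u X > 0" "\<And>Y. Y \<in> I \<Longrightarrow> (\<Sum>X\<in>I. u X * B X Y) = \<theta> * u Y"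
    and irr: "\<And>Z. Z \<subseteq> I \<Longrightarrow> Z \<noteq> {} \<Longrightarrow> (\<And>X Y. Y \<in> Z \<Longrightarrow> X \<in> I \<Longrightarrow> B X Y > 0 \<Longrightarrow> X \<in> Z) \<Longrightarrow> Z = I"
    and l: "\<And>Y. Y \<in> I \<Longrightarrow> (\<Sum>X\<in>I. l X * B X Y) = \<theta> * l Y"
  shows "\<exists>c. \<forall>X\<in>I. l X = c * u X"
proof (cases "I = {}")
  case False
  define c where "c = Min ((\<lambda>X. l X / u X) ` I)"
  have "c \<in> (\<lambda>X. l X / u X) ` I" unfolding c_def using fin False by (intro Min_in) auto
  then obtain X0 where X0: "X0 \<in> I" "c = l X0 / u X0" by auto
  define t where "t X = l X - c * u X" for X
  have t0: "t X \<ge> 0" if "X \<in> I" for X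
  proof -
    have "c \<le> l X / u X" unfolding c_def using fin that by (intro Min_le) auto
    then show ?thesis using u(1)[OF that] by (simp add: t_def field_simps)
  qed
  have te: "(\<Sum>X\<in>I. t X * B X Y) = \<theta> * t Y" if "Y \<in> I" for Y
    using l[OF that] u(2)[OF that]
    by (simp add: t_def left_diff_distrib sum_subtractf mult.assoc flip: sum_distrib_left) (simp add: algebra_simps)
  have "{X \<in> I. t X = 0} = I"
  proof (rule irr)
    show "{X \<in> I. t X = 0} \<noteq> {}" using X0 u(1)[OF X0(1)] by (auto simp: t_def)
    fix X Y assume a: "Y \<in> {X \<in> I. t X = 0}" "X \<in> I" "B X Y > 0"
    then have "(\<Sum>X\<in>I. t X * B X Y) = 0" using te by simp
    moreover have "\<And>X. X \<in> I \<Longrightarrow> t X * B X Y \<ge> 0" using t0 B a by auto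
    ultimately have "t X * B X Y = 0" using sum_nonneg_eq_0_iff[OF fin, of "\<lambda>X. t X * B X Y"] a by auto
    then show "X \<in> {X \<in> I. t X = 0}" using a by simp
  qed auto
  then have "\<forall>X\<in>I. l X = c * u X" by (auto simp: t_def)
  then show ?thesis ..
qed simp

section \<open>The subshift and its edge shift\<close>

lemma length_segment [simp]: "length (segment x i n) = n"
  by (simp add: segment_def)

lemma segment_segment: "k + m \<le> n \<Longrightarrow> take m (drop k (segment x i n)) = segment x (i + k) m"
  by (auto simp: segment_def take_map drop_map drop_upt take_upt add.assoc)

lemma sublist_segmentD:
  assumes "sublist a (segment x i n)"
  shows "\<exists>k. k + length a \<le> n \<and> a = segment x (i + k) (length a)"
proof -
  obtain b c where eq: "segment x i n = b @ a @ c" using assms by (auto simp: sublist_def)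
  then have "n = length b + length a + length c" by (metis length_append length_segment add.assoc)
  moreover have "take (length a) (drop (length b) (segment x i n)) = a" by (simp add: eq)
  ultimately show ?thesis using segment_segment[of "length b" "length a" n x i]
    by (intro exI[of _ "length b"]) simp
qed

text \<open>Weaker than \<open>allowed\<close>: an avoiding word may have no infinite
  continuation.\<close>

definition avoids :: "'a list set \<Rightarrow> 'a list \<Rightarrow> bool" where
  "avoids F u \<longleftrightarrow> (\<forall>a\<in>F. \<not> sublist a u)"

lemma avoids_sublist: "avoids F u \<Longrightarrow> sublist v u \<Longrightarrow> avoids F v"
  by (meson avoids_def sublist_order.order_trans)

lemma allowed_avoids: "allowed F u \<Longrightarrow> avoids F u"
  unfolding avoids_def
proof (intro ballI notI)
  fix a assume "allowed F u" and a: "a \<in> F" "sublist a u"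
  then obtain x i n where x: "u = segment x i n" "x \<in> subshift F"
    unfolding allowed_def language_def by blast
  with sublist_segmentD[of a x i n] a(2) obtain k where "a = segment x (i + k) (length a)" by blast
  with x(2) a(1) show False unfolding subshift_def by (metis (mono_tags, lifting) mem_Collect_eq)
qed

lemma allowed_sublist:
  assumes "allowed F u" "sublist v u"
  shows "allowed F v"
proof -
  obtain x i n where x: "u = segment x i n" "x \<in> subshift F"
    using assms(1) unfolding allowed_def language_def by blast
  with sublist_segmentD[of v x i n] assms(2) obtain k where "v = segment x (i + k) (length v)" by auto
  with x(2) show ?thesis unfolding allowed_def language_def by blast
qed

text \<open>In a one-sided shift a letter can be put in front of a whole sequence starting with
  \<open>u\<close>. A forbidden word at position 0 is no longer than \<open>x # u\<close>, so it
  would already occur there. Appending a letter has no such argument, which is why counts by first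
  word come with a threshold and counts by last word do not.\<close>

lemma allowed_Cons:
  assumes u: "allowed F u" and av: "avoids F (x # u)" and len: "\<And>a. a \<in> F \<Longrightarrow> length a \<le> Suc (length u)"
    and ne: "[] \<notin> F"
  shows "allowed F (x # u)"
proof -
  obtain y i n where y: "u = segment y i n" "y \<in> subshift F"
    using u unfolding allowed_def language_def by blast
  define t where "t = (\<lambda>k::nat. case k of 0 \<Rightarrow> x | Suc k \<Rightarrow> y (i + k))"
  have s0: "segment t 0 (Suc m) = x # segment y i m" for m
  proof (rule nth_equalityI)
    fix k assume "k < length (segment t 0 (Suc m))"
    then show "segment t 0 (Suc m) ! k = (x # segment y i m) ! k"
      by (cases k) (auto simp: segment_def t_def simp del: upt_Suc)
  qed simp
  have s1: "segment t (Suc j) m = segment y (i + j) m" for j m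
    by (rule nth_equalityI) (auto simp: segment_def t_def add.assoc simp del: upt_Suc)
  have "t \<in> subshift F"
    unfolding subshift_def
  proof (intro CollectI ballI allI)
    fix a j assume a: "a \<in> F"
    show "segment t j (length a) \<noteq> a"
    proof (cases j)
      case 0
      obtain m where m: "length a = Suc m" using a ne by (cases a) auto
      have "length a \<le> Suc n" using len[OF a] y(1) by simp
      show ?thesis
      proof
        assume "segment t j (length a) = a"
        then have "a = x # segment y i m" using 0 m s0 by simp
        moreover have "segment y i m = take m u"
          using segment_segment[of 0 m n y i] y(1) m \<open>length a \<le> Suc n\<close> by simp
        ultimately have "a = take (Suc m) (x # u)" by simp
        then have "sublist a (x # u)" using sublist_take by metis
        with av a show False by (simp add: avoids_def)
      qed
    next
      case (Suc k)
      then show ?thesis using y(2) a s1 by (auto simp: subshift_def)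
    qed
  qed
  moreover have "x # u = segment t 0 (Suc n)" by (simp add: s0 y(1))
  ultimately show ?thesis unfolding allowed_def language_def by blast
qed

lemma not_allowed_extension_bound:
  fixes v :: "'a::finite list"
  assumes "\<not> allowed F v"
  shows "\<exists>N. \<forall>u. length u \<ge> N \<longrightarrow> \<not> avoids F (v @ u)"
proof (rule ccontr)
  \<comment> \<open>Koenig's lemma: \<open>G\<close> marks the words with arbitrarily long extensions avoiding \<open>F\<close>.\<close>
  define G where "G v \<longleftrightarrow> (\<forall>N. \<exists>u. length u \<ge> N \<and> avoids F (v @ u))" for v :: "'a list"
  assume "\<not> (\<exists>N. \<forall>u. length u \<ge> N \<longrightarrow> \<not> avoids F (v @ u))"
  then have Gv: "G v" by (auto simp: G_def)
  have step: "\<exists>x. G (v @ [x])" if g: "G v" for v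
  proof (rule ccontr)
    assume "\<nexists>x. G (v @ [x])"
    then have "\<forall>x. \<exists>N. \<forall>u. length u \<ge> N \<longrightarrow> \<not> avoids F (v @ [x] @ u)" by (auto simp: G_def)
    then obtain N where N: "\<And>x u. length u \<ge> N x \<Longrightarrow> \<not> avoids F (v @ [x] @ u)" by metis
    \<comment> \<open>The sum is at least every single \<open>N x\<close>, whatever the first letter
      of \<open>u\<close> turns out to be.\<close>
    obtain u where u: "length u \<ge> Suc (\<Sum>x\<in>UNIV. N x)" "avoids F (v @ u)"
      using g unfolding G_def by blast
    then obtain x u' where u': "u = x # u'" by (cases u) auto
    have "N x \<le> (\<Sum>x\<in>UNIV. N x)" by (rule member_le_sum) auto
    then show False using N[of x u'] u u' by simp
  qed
  define s where "s = rec_nat v (\<lambda>_ w. w @ [SOME x. G (w @ [x])])"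
  have s0: "s 0 = v" and sS: "s (Suc k) = s k @ [SOME x. G (s k @ [x])]" for k by (simp_all add: s_def)
  have Gs: "G (s k)" for k
  proof (induction k)
    case (Suc k)
    show ?case unfolding sS by (rule someI_ex[OF step[OF Suc]])
  qed (simp add: s0 Gv)
  have len: "length (s k) = length v + k" for k by (induction k) (auto simp: s0 sS)
  define y where "y n = s (Suc n) ! n" for n
  have y: "n < length (s k) \<Longrightarrow> s k ! n = y n" for n k
  proof -
    have mono: "s (k + j) ! n = s k ! n" if "n < length (s k)" for k j n
      using that by (induction j) (auto simp: sS nth_append len)
    assume "n < length (s k)"
    then show ?thesis unfolding y_def using mono[of n k "Suc n"] mono[of n "Suc n" k]
      by (simp add: len add.commute)
  qed
  have seg: "segment y 0 (length (s k)) = s k" for k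
    by (rule nth_equalityI) (auto simp: segment_def y)
  have "y \<in> subshift F"
    unfolding subshift_def
  proof (intro CollectI ballI allI notI)
    fix a i assume a: "a \<in> F" "segment y i (length a) = a"
    \<comment> \<open>An occurrence of \<open>a\<close> in the limit sequence lies within a finite
      stage, which still has extensions avoiding \<open>F\<close>.\<close>
    let ?k = "i + length a"
    have "i + length a \<le> length (s ?k)" by (simp add: len)
    then have "take (length a) (drop i (s ?k)) = a"
      using segment_segment[of i "length a" "length (s ?k)" y 0] seg[of ?k] a(2) by simp
    then have sl: "sublist a (s ?k)" by (metis sublist_drop sublist_order.order_trans sublist_take)
    obtain u where "avoids F (s ?k @ u)" using Gs[of ?k] unfolding G_def by blast
    then have "avoids F (s ?k)" by (rule avoids_sublist) simp
    with sl a(1) show False by (simp add: avoids_def)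
  qed
  then have "allowed F v" using seg[of 0] unfolding allowed_def language_def s0 by (metis (mono_tags, lifting) mem_Collect_eq)
  with assms show False by contradiction
qed

lemma not_allowed_uniform_bound:
  fixes S :: "'a::finite list set"
  assumes "finite S" "\<And>v. v \<in> S \<Longrightarrow> \<not> allowed F v"
  shows "\<exists>N. \<forall>v\<in>S. \<forall>u. length u \<ge> N \<longrightarrow> \<not> avoids F (v @ u)"
proof -
  obtain N where N: "\<forall>v\<in>S. \<forall>u. length u \<ge> N v \<longrightarrow> \<not> avoids F (v @ u)"
    using not_allowed_extension_bound assms(2) by metis
  have "N v \<le> (\<Sum>v\<in>S. N v)" if "v \<in> S" for v by (rule member_le_sum) (use assms that in auto)
  with N show ?thesis by (intro exI[of _ "\<Sum>v\<in>S. N v"]) fastforce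
qed

section \<open>Weights, adjacency entries and irreducibility\<close>

locale repeated_shift = reversible_patterns Fs R
  for Fs :: "'a::finite list list" and R :: "('a list \<times> nat) list" +
  fixes p :: nat
  assumes p2: "p \<ge> 2"
    and forbidden_le: "a \<in> set Fs \<Longrightarrow> length a \<le> p"
    and repeated_length: "i < length R \<Longrightarrow> length (fst (R ! i)) = p"
    and irreducible: "irreducible_subshift (set Fs)"
begin

abbreviation "L \<equiv> allowed_words (set Fs) (p - 1)"
abbreviation "A \<equiv> adjacency (set Fs) R p"

lemma forbidden_pat: "a \<in> set Fs \<Longrightarrow> \<exists>j<K. length R \<le> j \<and> pat Fs R j = a"
proof -
  assume "a \<in> set Fs"
  then obtain i where "i < length Fs" "a = Fs ! i" by (auto simp: in_set_conv_nth)
  then show ?thesis by (intro exI[of _ "length R + i"]) (auto simp: pat_def)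
qed

lemma pat_cases:
  assumes "j < K"
  obtains "j < length R" "length (pat Fs R j) = p" | "length R \<le> j" "pat Fs R j \<in> set Fs"
  using assms repeated_length[of j] by (cases "j < length R") (auto simp: pat_def)

lemma pat_le_p: "j < K \<Longrightarrow> length (pat Fs R j) \<le> p"
  by (erule pat_cases) (auto simp: forbidden_le)

lemma finite_L: "finite L"
  by (rule finite_subset[OF _ finite_words[of "p - 1"]]) (auto simp: allowed_words_def words_def)

lemma L_no_pattern:
  assumes "X \<in> L" "j < K"
  shows "\<not> sublist (pat Fs R j) X"
  using assms(2)
proof (cases rule: pat_cases)
  case 1
  then show ?thesis using assms p2 by (auto simp: allowed_words_def dest!: sublist_length_le)
next
  case 2
  then show ?thesis using assms allowed_avoids[of "set Fs" X] by (auto simp: allowed_words_def avoids_def)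
qed

lemma weight_L: "X \<in> L \<Longrightarrow> weight X = 1"
  by (rule weight_eq_1) (rule L_no_pattern)

lemma weight_not_avoids:
  assumes "\<not> avoids (set Fs) u"
  shows "weight u = 0"
proof -
  obtain a where a: "a \<in> set Fs" "sublist a u" using assms by (auto simp: avoids_def)
  obtain j where j: "j < K" "length R \<le> j" "pat Fs R j = a" using forbidden_pat[OF a(1)] by blast
  then have "pat_mult R j ^ occurrences u (pat Fs R j) = 0"
    using a(2) occurrences_eq_0_iff[of u a] by (simp add: pat_mult_def)
  then show ?thesis unfolding weight_def using j(1) by (intro prod_zero) auto
qed

lemma multiplicity_of_eq_weight:
  assumes "avoids (set Fs) u"
  shows "real (multiplicity_of R u) = weight u"
proof -
  have "weight u = (\<Prod>j\<in>{..<length R}. pat_mult R j ^ occurrences u (pat Fs R j))"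
    unfolding weight_def
  proof (rule prod.mono_neutral_right)
    show "\<forall>i\<in>{..<K} - {..<length R}. pat_mult R i ^ occurrences u (pat Fs R i) = 1"
    proof
      fix i assume i: "i \<in> {..<K} - {..<length R}"
      then have "pat Fs R i \<in> set Fs" by (auto simp: pat_def)
      then show "pat_mult R i ^ occurrences u (pat Fs R i) = 1"
        using assms occurrences_eq_0_iff[of u "pat Fs R i"] by (auto simp: avoids_def)
    qed
  qed auto
  then show ?thesis by (simp add: multiplicity_of_def pat_mult_def pat_def)
qed

lemma multiplicity_of_pos: "multiplicity_of R u > 0"
  unfolding multiplicity_of_def using mult_ge_2 by (intro prod_pos) fastforce

text \<open>No pattern is longer than \<open>p = length X + 1\<close>, so those completed by
  \<open>y\<close> lie within \<open>X @ [y]\<close>, and \<open>X\<close> itself has weight 1. This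
  locality is what lets A describe the weights.\<close>

lemma weight_snoc_L:
  assumes "X \<in> L"
  shows "weight (u @ X @ [y]) = weight (u @ X) * weight (X @ [y])"
proof -
  have "suffix (pat Fs R j) ((u @ X) @ [y]) \<longleftrightarrow> suffix (pat Fs R j) (X @ [y])" if "j < K" for j
  proof -
    have "length (pat Fs R j) \<le> length (X @ [y])"
      using pat_le_p[OF that] assms p2 by (simp add: allowed_words_def)
    then show ?thesis using suffix_length_suffix[of "pat Fs R j" "u @ X @ [y]" "X @ [y]"]
        suffix_order.trans[of "pat Fs R j" "X @ [y]" "u @ X @ [y]"]
      by (auto simp: suffix_def)
  qed
  then have "(\<Prod>j<K. if suffix (pat Fs R j) ((u @ X) @ [y]) then pat_mult R j else 1) =
      (\<Prod>j<K. if suffix (pat Fs R j) (X @ [y]) then pat_mult R j else 1)"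
    by (intro prod.cong refl) (simp del: suffix_snoc)
  then show ?thesis
    using weight_snoc_mult[of "u @ X" y] weight_snoc_mult[of X y] weight_L[OF assms] by simp
qed

lemma weight_Cons_L:
  assumes "Y \<in> L"
  shows "weight (x # Y @ u) = weight (Y @ u) * weight (x # Y)"
proof -
  have "prefix (pat Fs R j) (x # Y @ u) \<longleftrightarrow> prefix (pat Fs R j) (x # Y)" if "j < K" for j
  proof -
    have "length (pat Fs R j) \<le> length (x # Y)"
      using pat_le_p[OF that] assms p2 by (simp add: allowed_words_def)
    then show ?thesis using prefix_length_prefix[of "pat Fs R j" "x # Y @ u" "x # Y"]
        prefix_order.trans[of "pat Fs R j" "x # Y" "x # Y @ u"] by auto
  qed
  then have "(\<Prod>j<K. if prefix (pat Fs R j) (x # Y @ u) then pat_mult R j else 1) =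
      (\<Prod>j<K. if prefix (pat Fs R j) (x # Y) then pat_mult R j else 1)"
    by (intro prod.cong refl) simp
  then show ?thesis
    using weight_Cons_mult[of x "Y @ u"] weight_Cons_mult[of x Y] weight_L[OF assms] by simp
qed

lemma adjacency_windows:
  assumes "X \<in> L" "Y \<in> L" "tl X = butlast Y"
  shows "X @ [last Y] = hd X # Y"
    and "real (A X Y) = (if allowed (set Fs) (hd X # Y) then weight (hd X # Y) else 0)"
proof -
  have "X \<noteq> []" "Y \<noteq> []" using assms p2 by (auto simp: allowed_words_def)
  then show eq: "X @ [last Y] = hd X # Y"
    using assms(3) by (metis append_Cons append_butlast_last_id list.collapse)
  have "length (hd X # Y) = p" using assms p2 by (simp add: allowed_words_def)
  then show "real (A X Y) = (if allowed (set Fs) (hd X # Y) then weight (hd X # Y) else 0)"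
    using assms(3) by (simp add: adjacency_def star_defined_def star_def eq allowed_words_def
        multiplicity_of_eq_weight allowed_avoids)
qed

lemma adjacency_eq_0: "tl X \<noteq> butlast Y \<Longrightarrow> A X Y = 0"
  by (simp add: adjacency_def star_defined_def)

lemma sum_predecessors:
  assumes "Y \<in> L"
  shows "(\<Sum>X\<in>L. h X * real (A X Y)) = (\<Sum>x\<in>UNIV. if x # butlast Y \<in> L then h (x # butlast Y) * real (A (x # butlast Y) Y) else 0)"
proof -
  have "(\<Sum>X\<in>L. h X * real (A X Y)) = (\<Sum>X | X \<in> L \<and> tl X = butlast Y. h X * real (A X Y))"
    using finite_L by (intro sum.mono_neutral_right) (auto simp: adjacency_eq_0)
  also have "\<dots> = (\<Sum>x | x # butlast Y \<in> L. h (x # butlast Y) * real (A (x # butlast Y) Y))"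
  proof (rule sum.reindex_bij_witness[of _ "\<lambda>x. x # butlast Y" hd])
    fix X assume X: "X \<in> {X \<in> L. tl X = butlast Y}"
    then have "X \<noteq> []" using p2 by (auto simp: allowed_words_def)
    then have "hd X # butlast Y = X" using X by (metis (mono_tags, lifting) list.collapse mem_Collect_eq)
    then show "hd X # butlast Y = X" "hd X \<in> {x. x # butlast Y \<in> L}"
      "h (hd X # butlast Y) * real (A (hd X # butlast Y) Y) = h X * real (A X Y)"
      using X by auto
  qed auto
  also have "\<dots> = (\<Sum>x\<in>UNIV. if x # butlast Y \<in> L then h (x # butlast Y) * real (A (x # butlast Y) Y) else 0)"
    by (rule sum.mono_neutral_cong_left) auto
  finally show ?thesis .
qed

lemma sum_successors:
  assumes "X \<in> L"
  shows "(\<Sum>Y\<in>L. h Y * real (A X Y)) = (\<Sum>y\<in>UNIV. if tl X @ [y] \<in> L then h (tl X @ [y]) * real (A X (tl X @ [y])) else 0)"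
proof -
  have "(\<Sum>Y\<in>L. h Y * real (A X Y)) = (\<Sum>Y | Y \<in> L \<and> tl X = butlast Y. h Y * real (A X Y))"
    using finite_L by (intro sum.mono_neutral_right) (auto simp: adjacency_eq_0)
  also have "\<dots> = (\<Sum>y | tl X @ [y] \<in> L. h (tl X @ [y]) * real (A X (tl X @ [y])))"
  proof (rule sum.reindex_bij_witness[of _ "\<lambda>y. tl X @ [y]" last])
    fix Y assume Y: "Y \<in> {Y \<in> L. tl X = butlast Y}"
    then have "Y \<noteq> []" using p2 by (auto simp: allowed_words_def)
    then have "tl X @ [last Y] = Y" using Y by auto
    then show "tl X @ [last Y] = Y" "last Y \<in> {y. tl X @ [y] \<in> L}"
      "h (tl X @ [last Y]) * real (A X (tl X @ [last Y])) = h Y * real (A X Y)"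
      using Y by auto
  qed auto
  also have "\<dots> = (\<Sum>y\<in>UNIV. if tl X @ [y] \<in> L then h (tl X @ [y]) * real (A X (tl X @ [y])) else 0)"
    by (rule sum.mono_neutral_cong_left) auto
  finally show ?thesis .
qed

text \<open>Splits off the letter in front of \<open>Y\<close>. It holds for every \<open>n\<close>:
  if \<open>x # Y\<close> is not allowed, it contains a forbidden word by
  \<open>allowed_Cons\<close>, so its weight vanishes along with the adjacency entry.\<close>

lemma ext_count_rec:
  assumes Y: "Y \<in> L"
  shows "ext_count Y (Suc n) = (\<Sum>X\<in>L. ext_count X n * real (A X Y))"
proof -
  have "Y \<noteq> []" using Y p2 by (auto simp: allowed_words_def)
  have w: "weight (u @ x # Y) = (if x # butlast Y \<in> L then weight (u @ x # butlast Y) * real (A (x # butlast Y) Y) else 0)"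
    for u x
  proof (cases "allowed (set Fs) (x # Y)")
    case True
    have "sublist (x # butlast Y) (x # Y)"
      using \<open>Y \<noteq> []\<close> by (metis butlast.simps(2) sublist_butlast)
    then have X: "x # butlast Y \<in> L"
      using allowed_sublist[OF True] Y p2 by (auto simp: allowed_words_def)
    have eq: "(x # butlast Y) @ [last Y] = x # Y" using \<open>Y \<noteq> []\<close> by simp
    show ?thesis
      using weight_snoc_L[OF X, of u "last Y"] adjacency_windows(2)[OF X Y] True X unfolding eq by simp
  next
    case False
    have "\<not> avoids (set Fs) (x # Y)"
    proof
      assume "avoids (set Fs) (x # Y)"
      moreover have "allowed (set Fs) Y" "Suc (length Y) = p" using Y p2 by (auto simp: allowed_words_def)
      moreover have "[] \<notin> set Fs" using forbidden_pat[of "[]"] pattern_nonempty by blast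
      ultimately show False using False allowed_Cons[of "set Fs" Y x] forbidden_le by blast
    qed
    then have "\<not> avoids (set Fs) (u @ x # Y)" using avoids_sublist[of "set Fs" "u @ x # Y" "x # Y"] by auto
    then have "weight (u @ x # Y) = 0" by (rule weight_not_avoids)
    moreover have "A (x # butlast Y) Y = 0" if "x # butlast Y \<in> L"
      using adjacency_windows(2)[OF that Y] False by simp
    ultimately show ?thesis by auto
  qed
  have "ext_count Y (n + Suc 0) = (\<Sum>u\<in>words n. \<Sum>x\<in>UNIV. weight (u @ x # Y))"
    by (simp only: ext_count_def sum_words_add sum_words_1 append_assoc append_Cons append_Nil)
  also have "\<dots> = (\<Sum>x\<in>UNIV. \<Sum>u\<in>words n. weight (u @ x # Y))" by (rule sum.swap)
  also have "\<dots> = (\<Sum>x\<in>UNIV. if x # butlast Y \<in> L then ext_count (x # butlast Y) n * real (A (x # butlast Y) Y) else 0)"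
    by (intro sum.cong refl) (simp add: w ext_count_def sum_distrib_right)
  finally show ?thesis using sum_predecessors[OF Y, of "\<lambda>X. ext_count X n"] by simp
qed

definition begin_count :: "'a list \<Rightarrow> nat \<Rightarrow> real" where
  "begin_count X n = (\<Sum>u\<in>words n. weight (X @ u))"

lemma begin_count_nonneg: "begin_count X n \<ge> 0"
  unfolding begin_count_def by (intro sum_nonneg weight_nonneg)

lemma begin_count_reversed: "reversed.ext_count (rev X) = begin_count X"
  by (intro ext) (unfold begin_count_def, rule reversed_ext_count)

text \<open>Finite words that avoid \<open>Fs\<close> need not be allowed, and the correlation matrices count all of them.
  Only the finitely many terms before \<open>N\<close> see the difference, so residues are unaffected.\<close>

lemma dead_ends: "\<exists>N. (\<forall>X\<in>L. \<forall>n\<ge>N. begin_count X (Suc n) = (\<Sum>Y\<in>L. begin_count Y n * real (A X Y))) \<and>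
    (\<forall>n\<ge>N. ext_count [] (n + (p - 1)) = (\<Sum>X\<in>L. begin_count X n))"
proof -
  \<comment> \<open>Length \<open>p\<close> serves one step \<open>X @ [y]\<close> of the
    recurrence, length \<open>p - 1\<close> the restriction of the total count to first words in
    \<open>L\<close>.\<close>
  have "\<exists>N. \<forall>v\<in>{v \<in> words (p - 1) \<union> words p. \<not> allowed (set Fs) v}. \<forall>u. length u \<ge> N \<longrightarrow> \<not> avoids (set Fs) (v @ u)"
    by (rule not_allowed_uniform_bound) auto
  then obtain N where N: "\<And>v u. \<not> allowed (set Fs) v \<Longrightarrow> v \<in> words (p - 1) \<union> words p \<Longrightarrow> length u \<ge> N \<Longrightarrow> weight (v @ u) = 0"
    using weight_not_avoids by auto
  have "begin_count X (Suc n) = (\<Sum>Y\<in>L. begin_count Y n * real (A X Y))" if X: "X \<in> L" and n: "n \<ge> N" for X n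
  proof -
    have "X \<noteq> []" using X p2 by (auto simp: allowed_words_def)
    have w: "weight (X @ y # u) = (if tl X @ [y] \<in> L then weight (tl X @ [y] @ u) * real (A X (tl X @ [y])) else 0)"
      if u: "length u = n" for u y
    proof -
      have eq: "X @ y # u = hd X # (tl X @ [y]) @ u" "X @ [y] = hd X # tl X @ [y]" using \<open>X \<noteq> []\<close> by auto
      show ?thesis
      proof (cases "allowed (set Fs) (X @ [y])")
        case True
        have "sublist (tl X @ [y]) (X @ [y])" unfolding eq(2) by (simp add: sublist_Cons_right)
        then have Y: "tl X @ [y] \<in> L"
          using allowed_sublist[OF True] X p2 by (auto simp: allowed_words_def)
        show ?thesis
          using weight_Cons_L[OF Y, of "hd X" u] adjacency_windows(2)[OF X Y] True Y unfolding eq by simp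
      next
        case False
        have "X @ [y] \<in> words p" using X p2 by (auto simp: allowed_words_def words_def)
        then have "weight ((X @ [y]) @ u) = 0" using N[OF False] n u by blast
        moreover have "A X (tl X @ [y]) = 0" if "tl X @ [y] \<in> L"
          using adjacency_windows(2)[OF X that] False eq(2) by simp
        ultimately show ?thesis by auto
      qed
    qed
    have "begin_count X (Suc 0 + n) = (\<Sum>y\<in>UNIV. \<Sum>u\<in>words n. weight (X @ y # u))"
      by (simp only: begin_count_def sum_words_add sum_words_1 append_Cons append_Nil)
    also have "\<dots> = (\<Sum>y\<in>UNIV. if tl X @ [y] \<in> L then begin_count (tl X @ [y]) n * real (A X (tl X @ [y])) else 0)"
    proof (intro sum.cong refl)
      fix y
      have "(\<Sum>u\<in>words n. weight (X @ y # u)) = (\<Sum>u\<in>words n.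
          if tl X @ [y] \<in> L then weight (tl X @ [y] @ u) * real (A X (tl X @ [y])) else 0)"
        by (intro sum.cong refl w) (simp add: words_def)
      then show "(\<Sum>u\<in>words n. weight (X @ y # u)) =
          (if tl X @ [y] \<in> L then begin_count (tl X @ [y]) n * real (A X (tl X @ [y])) else 0)"
        by (simp add: begin_count_def sum_distrib_right)
    qed
    finally show ?thesis using sum_successors[OF X, of "\<lambda>X. begin_count X n"] by simp
  qed
  moreover have "ext_count [] (n + (p - 1)) = (\<Sum>X\<in>L. begin_count X n)" if n: "n \<ge> N" for n
  proof -
    have "ext_count [] ((p - 1) + n) = (\<Sum>X\<in>words (p - 1). begin_count X n)"
      by (simp only: ext_count_def sum_words_add begin_count_def append_Nil2)
    also have "\<dots> = (\<Sum>X\<in>L. begin_count X n)"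
    proof (rule sum.mono_neutral_right)
      show "\<forall>X\<in>words (p - 1) - L. begin_count X n = 0"
        unfolding begin_count_def using N n by (auto simp: words_def allowed_words_def intro!: sum.neutral)
      show "L \<subseteq> words (p - 1)" by (auto simp: words_def allowed_words_def)
    qed simp
    finally show ?thesis by (simp add: add.commute)
  qed
  ultimately show ?thesis by blast
qed

text \<open>The words ending in \<open>X\<close> are among all words of that length. In the limit
  this makes the residue of F positive.\<close>

lemma ext_count_le_total: "X \<in> L \<Longrightarrow> ext_count X n \<le> ext_count [] (n + (p - 1))"
proof -
  assume X: "X \<in> L"
  have "ext_count [] (n + (p - 1)) = (\<Sum>u\<in>words n. \<Sum>v\<in>words (p - 1). weight (u @ v))"
    by (simp only: ext_count_def sum_words_add append_Nil2)
  moreover have "ext_count X n \<le> \<dots>"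
    unfolding ext_count_def
  proof (intro sum_mono)
    fix u
    have "X \<in> words (p - 1)" using X by (simp add: words_def allowed_words_def)
    then show "weight (u @ X) \<le> (\<Sum>v\<in>words (p - 1). weight (u @ v))"
      by (rule member_le_sum[where f = "\<lambda>v. weight (u @ v)"]) (auto simp: weight_nonneg)
  qed
  ultimately show ?thesis by simp
qed

lemma adjacency_pos:
  assumes "length X = p - 1" "allowed (set Fs) (X @ [y])"
  shows "A X (tl X @ [y]) > 0"
  using assms p2 multiplicity_of_pos by (auto simp: adjacency_def star_defined_def star_def allowed_words_def)

text \<open>Irreducibility joins any \<open>X\<close> to some \<open>Y\<close> in \<open>Z\<close>
  by an allowed word \<open>X @ w @ Y\<close>. Moving a window of length \<open>p - 1\<close>
  leftwards from \<open>Y\<close>, each window is a predecessor of the one before, so all of them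
  lie in \<open>Z\<close>, finally \<open>X\<close>.\<close>

lemma backward_closed:
  assumes Z: "Z \<subseteq> L" "Z \<noteq> {}" and cl: "\<And>X Y. Y \<in> Z \<Longrightarrow> X \<in> L \<Longrightarrow> A X Y > 0 \<Longrightarrow> X \<in> Z"
  shows "Z = L"
proof -
  obtain Y where Y: "Y \<in> Z" using Z by blast
  then have YL: "allowed (set Fs) Y" "length Y = p - 1" using Z by (auto simp: allowed_words_def)
  have *: "allowed (set Fs) (u @ Y) \<Longrightarrow> take (p - 1) (u @ Y) \<in> Z" for u
  proof (induction u)
    case Nil
    show ?case using Y YL by simp
  next
    case (Cons x u)
    let ?t = "x # u @ Y" and ?Y = "take (p - 1) (u @ Y)"
    have "allowed (set Fs) (u @ Y)" using Cons.prems by (rule allowed_sublist) (simp add: sublist_Cons_right)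
    then have IH: "?Y \<in> Z" using Cons.IH by blast
    obtain k where k: "p - 1 = Suc k" using p2 by (cases "p - 1") auto
    have lk: "k < length (u @ Y)" using YL k by simp
    have X: "take (p - 1) ?t \<in> L"
      using allowed_sublist[OF Cons.prems, of "take (p - 1) ?t"] YL sublist_take[of "p - 1" ?t]
      by (auto simp: allowed_words_def)
    have eq: "?Y = tl (take (p - 1) ?t) @ [(u @ Y) ! k]"
      unfolding k using take_Suc_conv_app_nth[OF lk] by (simp del: take_append)
    have "take (p - 1) ?t @ [(u @ Y) ! k] = take (Suc (Suc k)) ?t"
      unfolding k using take_Suc_conv_app_nth[OF lk] by (simp del: take_append)
    then have "allowed (set Fs) (take (p - 1) ?t @ [(u @ Y) ! k])"
      using allowed_sublist[OF Cons.prems, of "take (Suc (Suc k)) ?t"] sublist_take[of "Suc (Suc k)" ?t] by simp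
    then have "A (take (p - 1) ?t) ?Y > 0"
      unfolding eq using X by (intro adjacency_pos) (auto simp: allowed_words_def)
    then show ?case using cl[OF IH X] by simp
  qed
  have "X \<in> Z" if X: "X \<in> L" for X
  proof -
    obtain w where "allowed (set Fs) (X @ w @ Y)"
      using irreducible X YL unfolding irreducible_subshift_def allowed_words_def by blast
    then show ?thesis using *[of "X @ w"] X by (simp add: allowed_words_def)
  qed
  with Z show ?thesis by blast
qed

text \<open>The same window, now moved rightwards along an allowed word
  \<open>Y @ w @ X\<close>.\<close>

lemma forward_closed:
  assumes Z: "Z \<subseteq> L" "Z \<noteq> {}" and cl: "\<And>X Y. Y \<in> Z \<Longrightarrow> X \<in> L \<Longrightarrow> A Y X > 0 \<Longrightarrow> X \<in> Z"
  shows "Z = L"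
proof -
  obtain Y where Y: "Y \<in> Z" using Z by blast
  then have YL: "allowed (set Fs) Y" "length Y = p - 1" using Z by (auto simp: allowed_words_def)
  have *: "allowed (set Fs) (Y @ u) \<Longrightarrow> drop (length u) (Y @ u) \<in> Z" for u
  proof (induction u rule: rev_induct)
    case Nil
    show ?case using Y by simp
  next
    case (snoc x u)
    let ?Y = "drop (length u) (Y @ u)"
    have "allowed (set Fs) (Y @ u)" using snoc.prems
      by (rule allowed_sublist) (metis append.assoc sublist_append_rightI)
    then have IH: "?Y \<in> Z" using snoc.IH by blast
    then have lY: "length ?Y = p - 1" using Z by (auto simp: allowed_words_def)
    then have ne: "?Y \<noteq> []" using p2 by auto
    have eq: "drop (length (u @ [x])) (Y @ u @ [x]) = tl ?Y @ [x]"
    proof -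
      have "length u < length (Y @ u)" using ne by (metis drop_eq_Nil linorder_not_less)
      then have "Suc (length u) - length (Y @ u) = 0" by linarith
      then have "drop (Suc (length u)) ((Y @ u) @ [x]) = drop (Suc (length u)) (Y @ u) @ [x]"
        by (subst drop_append) (simp only: drop_0)
      then show ?thesis by (simp add: drop_Suc tl_drop del: drop_append)
    qed
    have "sublist (?Y @ [x]) (Y @ u @ [x])"
      using sublist_drop[of "length u" "Y @ u @ [x]"] by simp
    then have al: "allowed (set Fs) (?Y @ [x])" using snoc.prems allowed_sublist by blast
    have "sublist (tl ?Y @ [x]) (?Y @ [x])" using ne by (metis sublist_tl tl_append2)
    then have "tl ?Y @ [x] \<in> L" using allowed_sublist[OF al] lY p2 by (auto simp: allowed_words_def)
    then show ?case unfolding eq using cl[OF IH] adjacency_pos[OF lY al] by blast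
  qed
  have "X \<in> Z" if X: "X \<in> L" for X
  proof -
    obtain w where "allowed (set Fs) (Y @ w @ X)"
      using irreducible X YL unfolding irreducible_subshift_def allowed_words_def by blast
    then show ?thesis using *[of "w @ X"] X YL by (simp add: allowed_words_def)
  qed
  with Z show ?thesis by blast
qed

end

section \<open>Identification of the Parry weights\<close>

context repeated_shift
begin

text \<open>The residues are \<open>cU * U\<close> and \<open>cV * V\<close>, and dividing them by
  rho gives \<open>U_vec\<close> and \<open>V_vec\<close>. With s the sum of \<open>V\<close>, the
  relations cU = theta s and rho = cV s / theta^(p-1) imply cU cV = theta^p rho, so the scalings
  cancel against 1 + R'(theta) = theta / rho.\<close>

lemma parry_weight:
  fixes U V :: "'a list \<Rightarrow> real"
  assumes \<theta>: "\<theta> > 0"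
    and U: "\<And>X. X \<in> L \<Longrightarrow> U X > 0" "\<And>Y. Y \<in> L \<Longrightarrow> (\<Sum>X\<in>L. U X * real (A X Y)) = \<theta> * U Y"
    and V: "\<And>X. X \<in> L \<Longrightarrow> V X > 0" "\<And>X. X \<in> L \<Longrightarrow> (\<Sum>Y\<in>L. real (A X Y) * V Y) = \<theta> * V X"
    and UV: "(\<Sum>X\<in>L. U X * V X) = 1"
    and X: "X \<in> L" and Y: "Y \<in> L"
  shows "U X * V Y = U_vec Fs R \<theta> X * V_vec Fs R \<theta> Y / (\<theta> ^ (p - 1) * (1 + deriv (R_total Fs R) \<theta>))"
proof -
  note One_nat_def [simp del]
  obtain N where N: "\<And>X n. X \<in> L \<Longrightarrow> n \<ge> N \<Longrightarrow> begin_count X (Suc n) = (\<Sum>Y\<in>L. begin_count Y n * real (A X Y))"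
    "\<And>n. n \<ge> N \<Longrightarrow> ext_count [] (n + (p - 1)) = (\<Sum>X\<in>L. begin_count X n)"
    using dead_ends by blast
  have V2: "(\<Sum>Y\<in>L. V Y * real (A X Y)) = \<theta> * V X" if "X \<in> L" for X
    using V(2)[OF that] by (simp add: mult.commute)
  interpret E: transfer_sequence L "\<lambda>X Y. real (A X Y)" U \<theta> ext_count 0
    by standard (auto simp: finite_L U \<theta> ext_count_nonneg ext_count_rec)
  interpret B: transfer_sequence L "\<lambda>X Y. real (A Y X)" V \<theta> begin_count N
    by standard (auto simp: finite_L V V2 \<theta> N(1) begin_count_nonneg)
  let ?F = "gf (ext_count [])"
  \<comment> \<open>F and the sum of the \<open>begin_count\<close> series differ by an index shift
    of \<open>p - 1\<close>, hence the division by z^(p-1), and by finitely many terms, collected in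
    \<open>T\<close>. As \<open>T\<close> is continuous at theta, it contributes nothing to the
    residue.\<close>
  define T where "T z = (\<Sum>n<N + (p - 1). ext_count [] n / z ^ n)
    - (\<Sum>X\<in>L. (\<Sum>n<N. begin_count X n / z ^ n)) / z ^ (p - 1)" for z
  have F: "gf_summable (ext_count []) z \<and> ?F z = T z + (\<Sum>X\<in>L. gf (begin_count X) z) / z ^ (p - 1)"
    if z: "z > \<theta>" for z
  proof -
    have z0: "z > 0" using z \<theta> by simp
    have eq: "ext_count [] (n + (N + (p - 1))) = (\<Sum>X\<in>L. begin_count X (n + N))" for n
      using N(2)[of "n + N"] by (simp add: add.assoc)
    have sB: "gf_summable (\<lambda>n. begin_count X (n + N)) z" if "X \<in> L" for X
      using gf_summable_shift_iff[OF z0] B.h_summable[OF that z] by blast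
    have "gf_summable (\<lambda>n. ext_count [] (n + (N + (p - 1)))) z"
      unfolding eq by (rule gf_summable_sum) (rule sB)
    then have s: "gf_summable (ext_count []) z" using gf_summable_shift_iff[OF z0] by blast
    have "z ^ (N + (p - 1)) * (?F z - (\<Sum>n<N + (p - 1). ext_count [] n / z ^ n)) =
        gf (\<lambda>n. \<Sum>X\<in>L. begin_count X (n + N)) z"
      using gf_shift[OF z0 s, of "N + (p - 1)"] eq by simp
    also have "\<dots> = (\<Sum>X\<in>L. gf (\<lambda>n. begin_count X (n + N)) z)"
      by (rule gf_sum) (rule sB)
    also have "\<dots> = (\<Sum>X\<in>L. z ^ N * (gf (begin_count X) z - (\<Sum>n<N. begin_count X n / z ^ n)))"
      by (intro sum.cong refl gf_shift z0 B.h_summable z)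
    also have "\<dots> = z ^ N * ((\<Sum>X\<in>L. gf (begin_count X) z) - (\<Sum>X\<in>L. \<Sum>n<N. begin_count X n / z ^ n))"
      by (simp only: sum_distrib_left[symmetric] sum_subtractf)
    finally have "z ^ N * (z ^ (p - 1) * (?F z - (\<Sum>n<N + (p - 1). ext_count [] n / z ^ n))) =
      z ^ N * ((\<Sum>X\<in>L. gf (begin_count X) z) - (\<Sum>X\<in>L. \<Sum>n<N. begin_count X n / z ^ n))"
      by (simp only: power_add mult.assoc)
    then have "z ^ (p - 1) * (?F z - (\<Sum>n<N + (p - 1). ext_count [] n / z ^ n)) =
      (\<Sum>X\<in>L. gf (begin_count X) z) - (\<Sum>X\<in>L. \<Sum>n<N. begin_count X n / z ^ n)"
      using z0 by simp
    then have "?F z - (\<Sum>n<N + (p - 1). ext_count [] n / z ^ n) =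
      ((\<Sum>X\<in>L. gf (begin_count X) z) - (\<Sum>X\<in>L. \<Sum>n<N. begin_count X n / z ^ n)) / z ^ (p - 1)"
      using z0 by (simp add: nonzero_eq_divide_eq mult.commute)
    with s show ?thesis unfolding T_def by (simp add: diff_divide_distrib)
  qed
  define z0 where "z0 k = \<theta> + 1 / real (Suc k)" for k
  have z0: "z0 \<longlonglongrightarrow> \<theta>" "z0 k > \<theta>" "z0 k \<le> \<theta> + 1" for k
  proof -
    have "z0 \<longlonglongrightarrow> \<theta> + 0" unfolding z0_def[abs_def] using LIMSEQ_Suc[OF lim_1_over_n] by (intro tendsto_intros) auto
    then show "z0 \<longlonglongrightarrow> \<theta>" by simp
  qed (auto simp: z0_def field_simps)
  \<comment> \<open>Both families of series are indexed by one sum type, so that a single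
    subsequence serves all of them.\<close>
  define g where "g i k = (z0 k - \<theta>) * gf (case i of Inl X \<Rightarrow> ext_count X | Inr X \<Rightarrow> begin_count X) (z0 k)" for i k
  have bounded: "bounded (range (g i))" if i: "i \<in> Inl ` L \<union> Inr ` L" for i
  proof -
    obtain CE where CE: "CE \<ge> 0" "\<And>X z. X \<in> L \<Longrightarrow> z > \<theta> \<Longrightarrow> (z - \<theta>) * gf (ext_count X) z \<le> CE * z"
      using E.gf_upper by blast
    obtain CB where CB: "CB \<ge> 0" "\<And>X z. X \<in> L \<Longrightarrow> z > \<theta> \<Longrightarrow> (z - \<theta>) * gf (begin_count X) z \<le> CB * z"
      using B.gf_upper by blast
    have "\<bar>g i k\<bar> \<le> (CE + CB) * (\<theta> + 1)" for k
    proof -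
      have nn: "0 \<le> g i k"
        unfolding g_def using i z0(2)[of k] \<theta> E.h_nonneg B.h_nonneg E.h_summable B.h_summable
        by (auto intro!: mult_nonneg_nonneg gf_nonneg)
      have "g i k \<le> (CE + CB) * z0 k"
        unfolding g_def using i z0(2)[of k] \<theta> CE CB
        by (auto simp: distrib_right intro: add_increasing add_increasing2)
      also have "\<dots> \<le> (CE + CB) * (\<theta> + 1)" using CE(1) CB(1) z0(3) by (intro mult_left_mono) auto
      finally show ?thesis using nn by simp
    qed
    then show ?thesis by (intro boundedI[of _ "(CE + CB) * (\<theta> + 1)"]) auto
  qed
  obtain r where r: "strict_mono (r :: nat \<Rightarrow> nat)" "\<forall>i\<in>Inl ` L \<union> Inr ` L. convergent (g i \<circ> r)"
    using bounded_family_subseq[of "Inl ` L \<union> Inr ` L" g] bounded finite_L by auto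
  define z where "z = z0 \<circ> r"
  have z: "z \<longlonglongrightarrow> \<theta>" "\<And>k. z k > \<theta>"
    unfolding z_def using LIMSEQ_subseq_LIMSEQ[OF z0(1) r(1)] z0(2) by auto
  define lE where "lE X = lim (g (Inl X) \<circ> r)" for X
  define lB where "lB X = lim (g (Inr X) \<circ> r)" for X
  have lE: "(\<lambda>k. (z k - \<theta>) * gf (ext_count X) (z k)) \<longlonglongrightarrow> lE X" if "X \<in> L" for X
    using bspec[OF r(2), of "Inl X"] that unfolding lE_def convergent_LIMSEQ_iff by (auto simp: g_def z_def o_def)
  have lB: "(\<lambda>k. (z k - \<theta>) * gf (begin_count X) (z k)) \<longlonglongrightarrow> lB X" if "X \<in> L" for X
    using bspec[OF r(2), of "Inr X"] that unfolding lB_def convergent_LIMSEQ_iff by (auto simp: g_def z_def o_def)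
  have "\<exists>c. \<forall>X\<in>L. lE X = c * U X"
  proof (rule positive_eigenvector_unique[where B = "\<lambda>X Y. real (A X Y)"])
    show "(\<Sum>X\<in>L. lE X * real (A X Y)) = \<theta> * lE Y" if "Y \<in> L" for Y
      using E.limit_eigenvector[OF z lE that] by simp
    show "Z = L" if "Z \<subseteq> L" "Z \<noteq> {}" "\<And>X Y. Y \<in> Z \<Longrightarrow> X \<in> L \<Longrightarrow> real (A X Y) > 0 \<Longrightarrow> X \<in> Z" for Z
      using backward_closed[OF that(1,2)] that(3) by simp
  qed (auto simp: finite_L U)
  then obtain cU where cU: "\<And>X. X \<in> L \<Longrightarrow> lE X = cU * U X" by blast
  have "\<exists>c. \<forall>X\<in>L. lB X = c * V X"
  proof (rule positive_eigenvector_unique[where B = "\<lambda>X Y. real (A Y X)"])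
    show "(\<Sum>X\<in>L. lB X * real (A Y X)) = \<theta> * lB Y" if "Y \<in> L" for Y
      using B.limit_eigenvector[OF z lB that] by simp
    show "Z = L" if "Z \<subseteq> L" "Z \<noteq> {}" "\<And>X Y. Y \<in> Z \<Longrightarrow> X \<in> L \<Longrightarrow> real (A Y X) > 0 \<Longrightarrow> X \<in> Z" for Z
      using forward_closed[OF that(1,2)] that(3) by simp
  qed (auto simp: finite_L V V2)
  then obtain cV where cV: "\<And>X. X \<in> L \<Longrightarrow> lB X = cV * V X" by blast
  define \<rho> where "\<rho> = cV * (\<Sum>X\<in>L. V X) / \<theta> ^ (p - 1)"
  have \<rho>: "(\<lambda>k. (z k - \<theta>) * ?F (z k)) \<longlonglongrightarrow> \<rho>"
  proof -
    have "T \<midarrow>\<theta>\<rightarrow> T \<theta>"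
      unfolding T_def using \<theta> by (intro tendsto_intros) auto
    then have "isCont T \<theta>" by (simp add: isCont_def)
    then have "(\<lambda>k. T (z k)) \<longlonglongrightarrow> T \<theta>" by (rule isCont_tendsto_compose[OF _ z(1)])
    then have "(\<lambda>k. (z k - \<theta>) * T (z k) + (\<Sum>X\<in>L. (z k - \<theta>) * gf (begin_count X) (z k)) / z k ^ (p - 1))
      \<longlonglongrightarrow> (\<theta> - \<theta>) * T \<theta> + (\<Sum>X\<in>L. lB X) / \<theta> ^ (p - 1)"
      using \<theta> by (intro tendsto_intros z(1) lB) auto
    moreover have "(z k - \<theta>) * T (z k) + (\<Sum>X\<in>L. (z k - \<theta>) * gf (begin_count X) (z k)) / z k ^ (p - 1) =
        (z k - \<theta>) * ?F (z k)" for k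
      using F[OF z(2)[of k]] by (simp add: distrib_left sum_distrib_left)
    ultimately show ?thesis by (simp add: \<rho>_def cV sum_distrib_left)
  qed
  \<comment> \<open>Pair \<open>E.gf_rec\<close> with the right eigenvector \<open>V\<close>. As the
    threshold is 0 and \<open>ext_count Y 0 = weight Y = 1\<close>, the result is exact: (z - theta)
    times the sum of \<open>gf (ext_count Y) z * V Y\<close> equals z times the sum of
    \<open>V\<close>. In the limit, the normalization \<open>UV\<close> isolates
    \<open>cU\<close>.\<close>
  have cU_eq: "cU = \<theta> * (\<Sum>X\<in>L. V X)"
  proof -
    have "(\<Sum>Y\<in>L. (z k - \<theta>) * gf (ext_count Y) (z k) * V Y) = z k * (\<Sum>Y\<in>L. V Y)" for k
    proof -
      have "z k * gf (ext_count Y) (z k) - (\<Sum>X\<in>L. gf (ext_count X) (z k) * real (A X Y)) = z k" if "Y \<in> L" for Y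
        using E.gf_rec[OF that z(2)[of k]] weight_L[OF that] by (simp add: ext_count_def)
      then have "(\<Sum>Y\<in>L. (z k * gf (ext_count Y) (z k) - (\<Sum>X\<in>L. gf (ext_count X) (z k) * real (A X Y))) * V Y)
        = (\<Sum>Y\<in>L. z k * V Y)" by (intro sum.cong) auto
      then have "(\<Sum>Y\<in>L. z k * gf (ext_count Y) (z k) * V Y)
          - (\<Sum>Y\<in>L. \<Sum>X\<in>L. gf (ext_count X) (z k) * (real (A X Y) * V Y)) = z k * (\<Sum>Y\<in>L. V Y)"
        by (simp add: left_diff_distrib sum_subtractf sum_distrib_right sum_distrib_left mult.assoc)
      also have "(\<Sum>Y\<in>L. \<Sum>X\<in>L. gf (ext_count X) (z k) * (real (A X Y) * V Y)) =
          (\<Sum>X\<in>L. gf (ext_count X) (z k) * (\<Sum>Y\<in>L. real (A X Y) * V Y))"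
        by (subst sum.swap) (simp add: sum_distrib_left)
      also have "\<dots> = (\<Sum>X\<in>L. gf (ext_count X) (z k) * (\<theta> * V X))"
        by (intro sum.cong) (auto simp: V(2))
      finally show ?thesis
        by (simp add: left_diff_distrib right_diff_distrib sum_subtractf mult_ac)
    qed
    moreover have "(\<lambda>k. \<Sum>Y\<in>L. (z k - \<theta>) * gf (ext_count Y) (z k) * V Y) \<longlonglongrightarrow> (\<Sum>Y\<in>L. lE Y * V Y)"
      by (intro tendsto_intros lE)
    moreover have "(\<lambda>k. z k * (\<Sum>Y\<in>L. V Y)) \<longlonglongrightarrow> \<theta> * (\<Sum>Y\<in>L. V Y)"
      by (intro tendsto_intros z(1))
    ultimately have "(\<Sum>Y\<in>L. lE Y * V Y) = \<theta> * (\<Sum>Y\<in>L. V Y)"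
      using LIMSEQ_unique by auto
    moreover have "(\<Sum>Y\<in>L. lE Y * V Y) = cU * (\<Sum>Y\<in>L. U Y * V Y)"
      by (simp add: cU sum_distrib_left mult.assoc)
    ultimately show ?thesis by (simp add: UV)
  qed
  have SV: "(\<Sum>X\<in>L. V X) > 0" using X finite_L V(1) by (intro sum_pos) auto
  \<comment> \<open>The value of \<open>cU\<close> already gives \<open>lE X > 0\<close>; comparison
    with the count of all words transfers positivity to rho.\<close>
  have "lE X \<le> \<theta> ^ (p - 1) * \<rho>"
  proof (rule LIMSEQ_le)
    show "(\<lambda>k. (z k - \<theta>) * gf (ext_count X) (z k)) \<longlonglongrightarrow> lE X" by (rule lE[OF X])
    show "(\<lambda>k. z k ^ (p - 1) * ((z k - \<theta>) * ?F (z k))) \<longlonglongrightarrow> \<theta> ^ (p - 1) * \<rho>"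
      by (intro tendsto_intros z(1) \<rho>)
    have "(z k - \<theta>) * gf (ext_count X) (z k) \<le> z k ^ (p - 1) * ((z k - \<theta>) * ?F (z k))" for k
    proof -
      have zk: "z k > 0" and s: "gf_summable (ext_count []) (z k)" using z(2)[of k] \<theta> F[OF z(2)[of k]] by auto
      have "gf (ext_count X) (z k) \<le> gf (\<lambda>n. ext_count [] (n + (p - 1))) (z k)"
        using zk s E.h_summable[OF X z(2)] ext_count_le_total[OF X] by (intro gf_mono) (auto simp: gf_summable_shift_iff)
      also have "\<dots> \<le> z k ^ (p - 1) * ?F (z k)"
        unfolding gf_shift[OF zk s] using zk
        by (intro mult_left_mono) (auto intro!: sum_nonneg divide_nonneg_nonneg ext_count_nonneg)
      finally have "gf (ext_count X) (z k) \<le> z k ^ (p - 1) * ?F (z k)" .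
      then have "(z k - \<theta>) * gf (ext_count X) (z k) \<le> (z k - \<theta>) * (z k ^ (p - 1) * ?F (z k))"
        using z(2)[of k] by (intro mult_left_mono) auto
      then show ?thesis by (simp add: mult_ac)
    qed
    then show "\<exists>N. \<forall>k\<ge>N. (z k - \<theta>) * gf (ext_count X) (z k) \<le> z k ^ (p - 1) * ((z k - \<theta>) * ?F (z k))" by blast
  qed
  moreover have "lE X > 0" using cU[OF X] U(1)[OF X] cU_eq SV \<theta> by simp
  ultimately have "0 < \<theta> ^ (p - 1) * \<rho>" by simp
  then have \<rho>_pos: "\<rho> > 0" using \<theta> by (simp add: zero_less_mult_iff)
  have "U_vec Fs R \<theta> X = overlap_form \<theta> X"
    using X pat_le_p p2 by (intro U_vec_overlap_form) (force simp: allowed_words_def)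
  also have "\<dots> = lE X / \<rho>"
    using residue_formulas(1)[OF z \<theta> _ \<rho> \<rho>_pos L_no_pattern[OF X] lE[OF X]] F by blast
  finally have UX: "U_vec Fs R \<theta> X = cU * U X / \<rho>" using cU[OF X] by simp
  have "V_vec Fs R \<theta> Y = reversed.overlap_form \<theta> (rev Y)"
    using L_no_pattern[OF Y] by (rule V_vec_overlap_form)
  \<comment> \<open>Reversal permutes the words of each length and preserves weights, so the
    reversed system has the same F and the same rho.\<close>
  also have "\<dots> = lB Y / \<rho>"
  proof (rule reversed.residue_formulas(1)[OF z \<theta>])
    show "gf_summable (reversed.ext_count []) z" if "z > \<theta>" for z
      unfolding reversed_ext_count_Nil using F[OF that] by blast
    show "(\<lambda>k. (z k - \<theta>) * gf (reversed.ext_count []) (z k)) \<longlonglongrightarrow> \<rho>"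
      unfolding reversed_ext_count_Nil by (rule \<rho>)
    show "(\<lambda>k. (z k - \<theta>) * gf (reversed.ext_count (rev Y)) (z k)) \<longlonglongrightarrow> lB Y"
      unfolding begin_count_reversed by (rule lB[OF Y])
    show "\<not> sublist (pat (map rev Fs) (rev_patterns R) j) (rev Y)"
      if "j < length (rev_patterns R) + length (map rev Fs)" for j
      using that L_no_pattern[OF Y, of j] by (simp add: pat_rev sublist_rev)
  qed (rule \<rho>_pos)
  finally have VY: "V_vec Fs R \<theta> Y = cV * V Y / \<rho>" using cV[OF Y] by simp
  have D: "1 + deriv (R_total Fs R) \<theta> = \<theta> / \<rho>"
    using residue_formulas(2)[OF z \<theta> _ \<rho> \<rho>_pos] F by blast
  have c: "cU * cV = \<theta> ^ (p - 1) * \<theta> * \<rho>"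
    unfolding \<rho>_def cU_eq using \<theta> by simp
  have "U_vec Fs R \<theta> X * V_vec Fs R \<theta> Y / (\<theta> ^ (p - 1) * (1 + deriv (R_total Fs R) \<theta>)) =
    (cU * cV) * (U X * V Y) / (\<theta> ^ (p - 1) * \<theta> * \<rho>)"
    unfolding UX VY D using \<rho>_pos \<theta> by (simp add: field_simps)
  also have "\<dots> = U X * V Y"
    unfolding c using \<rho>_pos \<theta> by simp
  finally show ?thesis ..
qed

end

theorem corollary6p10p1:
  fixes Fs :: "'a::finite list list"
    and R :: "('a list \<times> nat) list"
    and p n :: nat
    and \<theta> :: real
    and \<mu> :: "(nat \<Rightarrow> 'a edge) measure"
    and W :: "'a edge list"
  assumes "CARD('a) \<ge> 2"
    and "distinct Fs" and "reduced_words (set Fs)"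
    and "\<forall>a\<in>set Fs. length a \<ge> 2"
    and "\<forall>x. allowed (set Fs) [x]"
    and "irreducible_subshift (set Fs)"
    and "distinct (map fst R)" and "reduced_words (fst ` set R)"
    and "\<forall>(r, m)\<in>set R. allowed (set Fs) r \<and> m \<ge> 2"
    and "p \<ge> 2"
    and "\<exists>w \<in> set Fs \<union> fst ` set R. length w = p"
    and "\<forall>w \<in> set Fs \<union> fst ` set R. length w \<le> p"
    and "\<forall>r \<in> fst ` set R. length r = p"
    and "\<theta> = perron_root (allowed_words (set Fs) (p - 1)) (adjacency (set Fs) R p)"
    and "\<theta> > 1"
    and "property_P (set Fs) R p"
    and "parry_measure (set Fs) R p \<mu>"
    and "W \<in> language (edge_shift (set Fs) R p)"
    and "length W = n" and "n \<ge> 1"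
  shows "measure \<mu> (cylinder (edge_shift (set Fs) R p) W) =
           U_vec Fs R \<theta> (source (hd W)) * V_vec Fs R \<theta> (target (last W))
             / (\<theta> ^ (n + p - 1) * (1 + deriv (R_total Fs R) \<theta>))"
proof -
  note One_nat_def [simp del]
  have R_facts: "fst (R ! i) \<in> fst ` set R" "allowed (set Fs) (fst (R ! i))" "snd (R ! i) \<ge> 2"
    "length (fst (R ! i)) = p" if "i < length R" for i
    using assms(9,13) that by (force simp: in_set_conv_nth split_beta)+
  interpret repeated_shift Fs R p
  proof
    fix i j assume i: "i < length R + length Fs" and j: "j < length R + length Fs"
      and sub: "sublist (pat Fs R i) (pat Fs R j)"
    have F_mem: "Fs ! (k - length R) \<in> set Fs" if "k < length R + length Fs" "\<not> k < length R" for k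
      using that by auto
    \<comment> \<open>Within one collection this is reducedness together with
      \<open>distinct\<close>. Across collections a forbidden word would occur in an allowed
      repeated word; if the repeated word is the inner one, its maximal length \<open>p\<close>
      turns containment into equality.\<close>
    show "i = j"
    proof (cases "i < length R"; cases "j < length R")
      assume ij: "i < length R" "j < length R"
      then have "sublist (fst (R ! i)) (fst (R ! j))" using sub by (simp add: pat_def)
      then have "fst (R ! i) = fst (R ! j)"
        using assms(8) R_facts(1)[OF ij(1)] R_facts(1)[OF ij(2)] unfolding reduced_words_def by blast
      then have "map fst R ! i = map fst R ! j" using ij by simp
      then show ?thesis using assms(7) ij by (metis length_map nth_eq_iff_index_eq)
    next
      assume ij: "i < length R" "\<not> j < length R"
      then have sub': "sublist (fst (R ! i)) (Fs ! (j - length R))" using sub by (simp add: pat_def)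
      have "length (Fs ! (j - length R)) \<le> length (fst (R ! i))"
        using F_mem[OF j ij(2)] assms(12) R_facts(4)[OF ij(1)] by auto
      then have "fst (R ! i) = Fs ! (j - length R)"
        using sub' sublist_length_le[OF sub'] by (auto simp: sublist_def)
      then have "sublist (Fs ! (j - length R)) (fst (R ! i))" by simp
      then show ?thesis
        using allowed_avoids[OF R_facts(2)[OF ij(1)]] F_mem[OF j ij(2)] by (auto simp: avoids_def)
    next
      assume ij: "\<not> i < length R" "j < length R"
      then have "sublist (Fs ! (i - length R)) (fst (R ! j))" using sub by (simp add: pat_def)
      then show ?thesis
        using allowed_avoids[OF R_facts(2)[OF ij(2)]] F_mem[OF i ij(1)] by (auto simp: avoids_def)
    next
      assume ij: "\<not> i < length R" "\<not> j < length R"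
      then have "Fs ! (i - length R) = Fs ! (j - length R)"
        using sub assms(3) F_mem[OF i ij(1)] F_mem[OF j ij(2)] unfolding reduced_words_def pat_def by auto
      then have "i - length R = j - length R"
        using assms(2) i j ij by (subst (asm) nth_eq_iff_index_eq) auto
      then show ?thesis using ij by simp
    qed
  next
    fix i assume "i < length R + length Fs"
    then show "2 \<le> length (pat Fs R i)"
      using R_facts(4)[of i] assms(4,10) by (auto simp: pat_def)
  qed (use R_facts assms in auto)
  obtain U V where UV: "left_perron_vector L A U" "right_perron_vector L A V" "(\<Sum>X\<in>L. U X * V X) = 1"
    and \<mu>: "\<forall>W\<in>language (edge_shift (set Fs) R p). W \<noteq> [] \<longrightarrow>
      measure \<mu> (cylinder (edge_shift (set Fs) R p) W) = U (source (hd W)) * V (target (last W)) / \<theta> ^ length W"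
    using assms(17) unfolding parry_measure_def Let_def assms(14)[symmetric] by blast
  have "W \<noteq> []" using assms(19,20) by auto
  have W_edges: "e \<in> edges (set Fs) R p" if e: "e \<in> set W" for e
  proof -
    obtain x i m where "W = segment x i m" "x \<in> edge_shift (set Fs) R p"
      using assms(18) unfolding language_def by blast
    then show ?thesis using e by (auto simp: segment_def edge_shift_def)
  qed
  have st: "source (hd W) \<in> L" "target (last W) \<in> L"
    using W_edges[OF hd_in_set[OF \<open>W \<noteq> []\<close>]] W_edges[OF last_in_set[OF \<open>W \<noteq> []\<close>]]
    by (auto simp: edges_def source_def target_def)
  have "U (source (hd W)) * V (target (last W)) =
      U_vec Fs R \<theta> (source (hd W)) * V_vec Fs R \<theta> (target (last W)) / (\<theta> ^ (p - 1) * (1 + deriv (R_total Fs R) \<theta>))"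
    using UV(1,2) assms(15) UV(3) st
    by (intro parry_weight) (auto simp: left_perron_vector_def right_perron_vector_def assms(14)[symmetric])
  moreover have "measure \<mu> (cylinder (edge_shift (set Fs) R p) W) = U (source (hd W)) * V (target (last W)) / \<theta> ^ n"
    using \<mu> assms(18,19) \<open>W \<noteq> []\<close> by auto
  moreover have "\<theta> ^ (n + p - 1) = \<theta> ^ (p - 1) * \<theta> ^ n"
    using assms(10) by (simp add: power_add[symmetric] add.commute)
  ultimately show ?thesis by (simp add: mult_ac)
qed

end
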